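(* Let $R$ be a real closed field, $X\subseteq R^n$ a semialgebraic set, and $S$ a real closed field extension of $R$. Then $\mathrm{cat}(X)^{\mathcal{R}_{sa}}=\mathrm{cat}(X(S))^{\mathcal{S}_{sa}}$.
   Context: $\mathcal{R}_{sa}$ and $\mathcal{S}_{sa}$ denote the ordered field structures on $R$ and $S$; $X(S)$ is the realization in $S^n$ of a formula (with parameters from $R$) defining $X$. For a semialgebraic set $Y$ over a real closed field $K$, a semialgebraic subset $A\subseteq Y$ is semialgebraically categorical in $Y$ if there is a semialgebraic (continuous) homotopy $A\times[0,1]\to Y$ from the inclusion to a constant map; $\mathrm{cat}(Y)^{\mathcal{K}_{sa}}$ is the least $m$ such that $Y$ has a cover by $m+1$ open semialgebraic subsets each semialgebraically categorical in $Y$. *)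

theory Defs
  imports "HOL-Analysis.Analysis"
begin

section \<open>Real closed fields\<close>

class real_closed_field = linordered_field +
  assumes nonneg_imp_square: "0 \<le> a \<Longrightarrow> \<exists>x. x * x = a"
    and odd_degree_imp_root:
      "\<And>n (c :: nat \<Rightarrow> 'a). odd n \<Longrightarrow> c n \<noteq> 0 \<Longrightarrow> \<exists>x. (\<Sum>k\<le>n. c k * x ^ k) = 0"

text \<open>
  A ring homomorphism between fields is injective, and between real closed fields it
  automatically preserves the order, since the nonnegative elements are the squares.
\<close>

definition field_embedding :: "('a::field \<Rightarrow> 'b::field) \<Rightarrow> bool" where
  "field_embedding h \<longleftrightarrow> h 1 = 1 \<and> (\<forall>x y. h (x + y) = h x + h y) \<and> (\<forall>x y. h (x * y) = h x * h y)"

section \<open>First-order formulas over an ordered field, with parameters\<close>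

text \<open>
  Terms denote polynomials with coefficients in the field. Variables are de Bruijn
  indices: inside \<open>Exists p\<close>, variable 0 is the bound one and the free variables of
  the context are shifted by one. The functorial action \<open>map_fm h\<close> replaces every
  parameter \<open>c\<close> by \<open>h c\<close>.
\<close>

datatype 'a trm = Var nat | Const 'a | Add "'a trm" "'a trm" | Mult "'a trm" "'a trm"

datatype 'a fm =
    Equal "'a trm" "'a trm"
  | Less "'a trm" "'a trm"
  | Neg "'a fm"
  | Conj "'a fm" "'a fm"
  | Exists "'a fm"

primrec eval_trm :: "(nat \<Rightarrow> 'a::linordered_field) \<Rightarrow> 'a trm \<Rightarrow> 'a" where
  "eval_trm e (Var i) = e i"
| "eval_trm e (Const c) = c"
| "eval_trm e (Add s t) = eval_trm e s + eval_trm e t"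
| "eval_trm e (Mult s t) = eval_trm e s * eval_trm e t"

primrec sat :: "(nat \<Rightarrow> 'a::linordered_field) \<Rightarrow> 'a fm \<Rightarrow> bool" where
  "sat e (Equal s t) \<longleftrightarrow> eval_trm e s = eval_trm e t"
| "sat e (Less s t) \<longleftrightarrow> eval_trm e s < eval_trm e t"
| "sat e (Neg p) \<longleftrightarrow> \<not> sat e p"
| "sat e (Conj p q) \<longleftrightarrow> sat e p \<and> sat e q"
| "sat e (Exists p) \<longleftrightarrow> (\<exists>x. sat (case_nat x e) p)"

primrec trm_in :: "nat \<Rightarrow> 'a trm \<Rightarrow> bool" where
  "trm_in n (Var i) \<longleftrightarrow> i < n"
| "trm_in n (Const c) \<longleftrightarrow> True"
| "trm_in n (Add s t) \<longleftrightarrow> trm_in n s \<and> trm_in n t"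
| "trm_in n (Mult s t) \<longleftrightarrow> trm_in n s \<and> trm_in n t"

text \<open>\<open>fm_in n p\<close>: all free variables of \<open>p\<close> are among the first \<open>n\<close>.\<close>

primrec fm_in :: "nat \<Rightarrow> 'a fm \<Rightarrow> bool" where
  "fm_in n (Equal s t) \<longleftrightarrow> trm_in n s \<and> trm_in n t"
| "fm_in n (Less s t) \<longleftrightarrow> trm_in n s \<and> trm_in n t"
| "fm_in n (Neg p) \<longleftrightarrow> fm_in n p"
| "fm_in n (Conj p q) \<longleftrightarrow> fm_in n p \<and> fm_in n q"
| "fm_in n (Exists p) \<longleftrightarrow> fm_in (Suc n) p"

primrec quantifier_free :: "'a fm \<Rightarrow> bool" where
  "quantifier_free (Equal s t) \<longleftrightarrow> True"
| "quantifier_free (Less s t) \<longleftrightarrow> True"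
| "quantifier_free (Neg p) \<longleftrightarrow> quantifier_free p"
| "quantifier_free (Conj p q) \<longleftrightarrow> quantifier_free p \<and> quantifier_free q"
| "quantifier_free (Exists p) \<longleftrightarrow> False"

section \<open>Semialgebraic sets and maps\<close>

text \<open>
  The points of affine \<open>n\<close>-space are the functions on \<open>{..<n}\<close> (extended by
  \<open>undefined\<close>), and the topology is the product of the order topologies: class
  \<open>linorder_topology\<close> says exactly that \<open>euclidean\<close> is the order topology.
\<close>

definition aff :: "nat \<Rightarrow> (nat \<Rightarrow> 'a) set" where
  "aff n = {..<n} \<rightarrow>\<^sub>E UNIV"

definition aff_top :: "nat \<Rightarrow> (nat \<Rightarrow> 'a::linorder_topology) topology" where
  "aff_top n = product_topology (\<lambda>_. euclidean) {..<n}"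

definition realization :: "nat \<Rightarrow> 'a::linordered_field fm \<Rightarrow> (nat \<Rightarrow> 'a) set" where
  "realization n p = {x \<in> aff n. sat x p}"

text \<open>Finite Boolean combinations of polynomial equations and inequalities.\<close>

definition semialgebraic :: "nat \<Rightarrow> (nat \<Rightarrow> 'a::linordered_field) set \<Rightarrow> bool" where
  "semialgebraic n X \<longleftrightarrow> (\<exists>p. quantifier_free p \<and> fm_in n p \<and> X = realization n p)"

definition append_pt :: "nat \<Rightarrow> nat \<Rightarrow> (nat \<Rightarrow> 'a) \<Rightarrow> (nat \<Rightarrow> 'a) \<Rightarrow> nat \<Rightarrow> 'a" where
  "append_pt m n x y = (\<lambda>i\<in>{..<m + n}. if i < m then x i else y (i - m))"

definition graph_of :: "nat \<Rightarrow> nat \<Rightarrow> (nat \<Rightarrow> 'a) set \<Rightarrow> ((nat \<Rightarrow> 'a) \<Rightarrow> nat \<Rightarrow> 'a) \<Rightarrow> (nat \<Rightarrow> 'a) set" where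
  "graph_of m n A f = (\<lambda>x. append_pt m n x (f x)) ` A"

definition continuous_semialgebraic_map ::
    "nat \<Rightarrow> (nat \<Rightarrow> 'a::{linordered_field,linorder_topology}) set \<Rightarrow>
     nat \<Rightarrow> (nat \<Rightarrow> 'a) set \<Rightarrow> ((nat \<Rightarrow> 'a) \<Rightarrow> nat \<Rightarrow> 'a) \<Rightarrow> bool" where
  "continuous_semialgebraic_map m A n B f \<longleftrightarrow>
     semialgebraic m A \<and> semialgebraic n B \<and>
     continuous_map (subtopology (aff_top m) A) (subtopology (aff_top n) B) f \<and>
     semialgebraic (m + n) (graph_of m n A f)"

section \<open>Semialgebraic Lusternik--Schnirelmann category\<close>

text \<open>
  \<open>A \<times> [0,1]\<close> as a subset of affine \<open>(n+1)\<close>-space, where \<open>[0,1]\<close> is the unit interval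
  of the field: the point \<open>(x, t)\<close> is \<open>x(n := t)\<close>.
\<close>

definition cylinder :: "nat \<Rightarrow> (nat \<Rightarrow> 'a::linordered_field) set \<Rightarrow> (nat \<Rightarrow> 'a) set" where
  "cylinder n A = {x(n := t) | x t. x \<in> A \<and> t \<in> {0..1}}"

definition sa_categorical ::
    "nat \<Rightarrow> (nat \<Rightarrow> 'a::{linordered_field,linorder_topology}) set \<Rightarrow> (nat \<Rightarrow> 'a) set \<Rightarrow> bool" where
  "sa_categorical n Y A \<longleftrightarrow> semialgebraic n A \<and> A \<subseteq> Y \<and>
     (\<exists>H. continuous_semialgebraic_map (Suc n) (cylinder n A) n Y H \<and>
          (\<forall>x\<in>A. H (x(n := 0)) = x) \<and>
          (\<lambda>x. H (x(n := 1))) constant_on A)"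

definition sa_categorical_cover ::
    "nat \<Rightarrow> (nat \<Rightarrow> 'a::{linordered_field,linorder_topology}) set \<Rightarrow> nat \<Rightarrow> (nat \<Rightarrow> (nat \<Rightarrow> 'a) set) \<Rightarrow> bool" where
  "sa_categorical_cover n Y m U \<longleftrightarrow>
     (\<Union>i\<le>m. U i) = Y \<and>
     (\<forall>i\<le>m. openin (subtopology (aff_top n) Y) (U i) \<and> semialgebraic n (U i) \<and> sa_categorical n Y (U i))"

text \<open>The least \<open>m\<close> as an extended natural number; it is \<open>\<infinity>\<close> if there is no such cover.\<close>

definition sa_cat :: "nat \<Rightarrow> (nat \<Rightarrow> 'a::{linordered_field,linorder_topology}) set \<Rightarrow> enat" where
  "sa_cat n Y = Inf {enat m | m. \<exists>U. sa_categorical_cover n Y m U}"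

end

theory Submission
  imports Defs "HOL-Algebra.Algebraic_Closure_Type"
begin

text \<open>
  Having a cover by \<open>m + 1\<close> categorical sets is a first-order condition on \<open>X\<close>: such a cover is given
  by finitely many quantifier-free formulas, for the sets and for the graphs of the homotopies. Once
  their parameters are replaced by variables, a first-order formula expresses that these templates
  define a categorical cover for some value of the parameters. By quantifier elimination, the truth of
  a sentence with parameters in \<open>R\<close> does not change when passing from \<open>R\<close> to \<open>S\<close>; quantifying over
  the parameters is what allows a cover over \<open>S\<close> to be brought back to \<open>R\<close>.

  Quantifier elimination follows Hoermander: in a finite family closed under truncation, differentiation
  and pseudo-remainders, the signs of the coefficients determine which sign conditions are realized.
  By Thom's lemma the set of realized sign conditions also fixes the order of their cells, so that it
  is the only invariant to be carried through the induction.
\<close>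

text \<open>A real closed field is given by square roots and by roots in odd degree only, and it may
  be non-Archimedean and incomplete, so limits are of no use. The intermediate value theorem has to
  come from algebra: every nonconstant polynomial over R has a root in R(i), hence R-polynomials
  split into linear factors and positive quadratic ones. Rolle's theorem, monotonicity and Thom's
  lemma follow. R and S are two types related by an embedding. Elimination and transfer are proved
  together: a predicate over R and one over S are carried along as a pair defined by one
  quantifier-free formula. That formula is not computed. It lists the sign vectors of the
  coefficients at which the quantified formula holds somewhere over R or over S; comparing the cells
  of two fields shows that it then holds wherever these signs occur. A homotopy is a function, which
  no first-order quantifier reaches, so it is replaced by its graph. A number is quantified as a
  coordinate of a point, so that points are the only sort of variable.\<close>

no_notation Polynomials.var (\<open>X\<index>\<close>)

section \<open>The fundamental theorem of algebra over a real closed field\<close>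

abbreviation pdeg :: "'a::zero poly \<Rightarrow> nat" where
  "pdeg \<equiv> Polynomial.degree"

abbreviation emb :: "'a::field poly \<Rightarrow> 'a alg_closure poly" where
  "emb \<equiv> map_poly to_ac"

lemma coeff_emb: "poly.coeff (emb p) k = to_ac (poly.coeff p k)"
  by (simp add: coeff_map_poly)

lemma emb_add: "emb (p + q) = emb p + emb q"
  by (rule poly_eqI) (simp add: coeff_emb)

lemma emb_mult: "emb (p * q) = emb p * emb q"
  by (rule poly_eqI) (simp add: coeff_emb coeff_mult to_ac_sum)

lemma emb_smult: "emb (Polynomial.smult c p) = Polynomial.smult (to_ac c) (emb p)"
  by (rule poly_eqI) (simp add: coeff_emb)

lemma emb_power: "emb (p ^ k) = emb p ^ k"
  by (induction k) (simp_all add: emb_mult)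

lemma emb_sum: "emb (sum f A) = (\<Sum>a\<in>A. emb (f a))"
  by (rule poly_eqI) (simp add: coeff_emb coeff_sum to_ac_sum)

lemma pdeg_emb: "pdeg (emb p) = pdeg p"
  by (rule degree_map_poly) simp

lemma emb_eq_0_iff: "emb p = 0 \<longleftrightarrow> p = 0"
  by (rule map_poly_eq_0_iff) simp_all

lemma poly_emb_to_ac: "poly (emb p) (to_ac x) = to_ac (poly p x)"
  by (induction p) (simp_all add: map_poly_pCons)

lemma monic_linear_prod:
  fixes A :: "'a::field multiset"
  shows "Polynomial.lead_coeff (\<Prod>x\<in>#A. [:-x, 1:]) = 1"
    and "pdeg (\<Prod>x\<in>#A. [:-x, 1:]) = size A"
    and "(\<Prod>x\<in>#A. [:-x, 1:]) \<noteq> 0"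
proof -
  have "Polynomial.lead_coeff (\<Prod>x\<in>#A. [:-x, 1:]) = 1 \<and> pdeg (\<Prod>x\<in>#A. [:-x, 1:]) = size A \<and> (\<Prod>x\<in>#A. [:-x, 1:]) \<noteq> 0"
  proof (induction A)
    case (add x A)
    let ?P = "\<Prod>x\<in>#A. [:-x, 1:]"
    have nz: "?P \<noteq> 0" "[:-x, 1:] \<noteq> 0" using add by auto
    then have "pdeg ([:-x, 1:] * ?P) = Suc (size A)"
      using add by (subst degree_mult_eq) auto
    moreover have "Polynomial.lead_coeff ([:-x, 1:] * ?P) = 1"
      using add.IH by (metis lead_coeff_mult lead_coeff_pCons(1) lead_coeff_1 one_neq_zero pCons_one mult_1 zero_neq_one)
    moreover have "[:-x, 1:] * ?P \<noteq> 0"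
      using nz no_zero_divisors by blast
    ultimately show ?case by (simp del: mult_pCons_left)
  qed simp
  then show "Polynomial.lead_coeff (\<Prod>x\<in>#A. [:-x, 1:]) = 1"
    and "pdeg (\<Prod>x\<in>#A. [:-x, 1:]) = size A"
    and "(\<Prod>x\<in>#A. [:-x, 1:]) \<noteq> 0" by auto
qed

lemma poly_linear_prod:
  fixes y :: "'a::field"
  shows "poly (\<Prod>x\<in>#A. [:-x, 1:]) y = (\<Prod>x\<in>#A. y - x)"
  by (induction A) (simp_all add: algebra_simps)

text \<open>
  The product is the resultant of \<open>f\<close> and \<open>h\<close>. Euclid's algorithm computes it: \<open>h\<close> can be
  reduced modulo \<open>f\<close>, and the roles of the two polynomials can be exchanged up to a sign.
\<close>

lemma prod_over_roots_in_base:
  fixes f h :: "'a::field poly"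
  assumes "emb f = (\<Prod>x\<in>#A. [:-x, 1:])"
  shows "(\<Prod>x\<in>#A. poly (emb h) x) \<in> range to_ac"
  using assms
proof (induction "pdeg f" arbitrary: f h A rule: less_induct)
  case less
  have deg: "pdeg f = size A"
    using pdeg_emb[of f] monic_linear_prod(2)[of A] less.prems by simp
  have "f \<noteq> 0"
    using emb_eq_0_iff[of f] monic_linear_prod(3)[of A] less.prems by auto
  define r where "r = h mod f"
  have root: "poly (emb f) x = 0" if "x \<in># A" for x
    using that by (simp add: less.prems poly_linear_prod prod_mset_zero_iff image_iff)
  have "emb h = emb (h div f) * emb f + emb r"
    unfolding r_def by (simp flip: emb_mult emb_add)
  then have hr: "poly (emb h) x = poly (emb r) x" if "x \<in># A" for x
    using root[OF that] by simp
  have prod_eq: "(\<Prod>x\<in>#A. poly (emb h) x) = (\<Prod>x\<in>#A. poly (emb r) x)"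
    using hr by (intro arg_cong[where f = prod_mset] image_mset_cong) auto
  show ?case
  proof (cases "A = {#}")
    case True
    then show ?thesis by (auto intro: image_eqI[of _ _ 1])
  next
    case nonempty: False
    show ?thesis
    proof (cases "r = 0")
      case True
      then have "(\<Prod>x\<in>#A. poly (emb h) x) = 0"
        using nonempty prod_eq by (simp add: nonempty_has_size zero_power)
      then show ?thesis by (auto intro: image_eqI[of _ _ 0])
    next
      case False
      then have less_deg: "pdeg r < pdeg f"
        using degree_mod_less'[OF \<open>f \<noteq> 0\<close>, of h] by (auto simp: r_def)
      define l where "l = Polynomial.lead_coeff r"
      \<comment> \<open>A factorization into monic linear factors requires a monic polynomial; the
        leading coefficient removed here returns as the factor \<open>l ^ size A\<close>.\<close>
      define r1 where "r1 = Polynomial.smult (inverse l) r"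
      have l: "l \<noteq> 0" using False by (simp add: l_def)
      have deg1: "pdeg r1 = pdeg r" using l by (simp add: r1_def)
      have r_eq: "r = Polynomial.smult l r1" using l by (simp add: r1_def)
      have "r1 \<noteq> 0" using False r_eq by auto
      have "Polynomial.lead_coeff r1 = 1" using l by (simp add: r1_def l_def)
      then have lead: "Polynomial.lead_coeff (emb r1) = 1" by (simp add: coeff_emb pdeg_emb)
      obtain B where B: "emb r1 = (\<Prod>x\<in>#B. [:-x, 1:])"
        using alg_closed_imp_factorization[of "emb r1"] \<open>r1 \<noteq> 0\<close> lead by (auto simp: emb_eq_0_iff)
      have swap: "(\<Prod>y\<in>#B. poly (emb f) y) \<in> range to_ac"
        using less.hyps[OF _ B] less_deg deg1 by simp
      have "(\<Prod>x\<in>#A. poly (emb r) x) = (\<Prod>x\<in>#A. to_ac l * (\<Prod>y\<in>#B. x - y))"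
        by (simp add: r_eq emb_smult B poly_linear_prod)
      also have "\<dots> = to_ac l ^ size A * (\<Prod>x\<in>#A. \<Prod>y\<in>#B. x - y)"
        by (simp add: prod_mset.distrib)
      also have "(\<Prod>x\<in>#A. \<Prod>y\<in>#B. x - y) = (\<Prod>y\<in>#B. \<Prod>x\<in>#A. x - y)"
        by (rule prod_mset.swap)
      also have "\<dots> = (\<Prod>y\<in>#B. (-1) ^ size A * (\<Prod>x\<in>#A. y - x))"
      proof -
        have "(\<Prod>x\<in>#A. x - y) = (-1) ^ size A * (\<Prod>x\<in>#A. y - x)" for y
          by (induction A) (simp_all add: algebra_simps)
        then show ?thesis by simp
      qed
      also have "\<dots> = ((-1) ^ size A) ^ size B * (\<Prod>y\<in>#B. poly (emb f) y)"
        by (simp add: prod_mset.distrib less.prems poly_linear_prod)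
      also obtain c where "(\<Prod>y\<in>#B. poly (emb f) y) = to_ac c" using swap by auto
      also have "to_ac l ^ size A * (((-1) ^ size A) ^ size B * to_ac c)
          = to_ac (l ^ size A * (((-1) ^ size A) ^ size B * c))" by simp
      finally show ?thesis unfolding prod_eq by (metis rangeI)
    qed
  qed
qed

text \<open>Induction on the degree: split off X - a at a base point a with a base value. The
  quotient takes the values (p(c) - p(a)) / (c - a), which are in the base except perhaps at c = a.
  This point, lost at each step, is the reason for allowing finitely many exceptions.\<close>

lemma cofinite_values_in_base_imp:
  fixes p :: "'a::field_char_0 alg_closure poly"
  assumes "finite {a. poly p (to_ac a) \<notin> range to_ac}"
  shows "p \<in> range emb"
  using assms
proof (induction "pdeg p" arbitrary: p rule: less_induct)
  case less
  obtain a where a: "poly p (to_ac a) \<in> range to_ac"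
    using less.prems infinite_UNIV_char_0[where 'a = 'a] by (metis (mono_tags, lifting) UNIV_eq_I mem_Collect_eq)
  then obtain b where b: "poly p (to_ac a) = to_ac b" by auto
  define q where "q = synthetic_div p (to_ac a)"
  have p_eq: "p = [:to_ac b:] + [:- to_ac a, 1:] * q"
    using synthetic_div_correct'[of "to_ac a" p] by (simp add: q_def b algebra_simps)
  show ?case
  proof (cases "pdeg p = 0")
    case True
    then have "q = 0" unfolding q_def using synthetic_div_eq_0_iff by blast
    then have "p = emb [:b:]" using p_eq by (simp add: map_poly_pCons)
    then show ?thesis by blast
  next
    case False
    then have dq: "pdeg q < pdeg p" by (simp add: q_def degree_synthetic_div)
    have "poly q (to_ac c) \<in> range to_ac" if c: "poly p (to_ac c) \<in> range to_ac" "c \<noteq> a" for c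
    proof -
      obtain d where d: "poly p (to_ac c) = to_ac d" using c by auto
      have "poly p (to_ac c) = to_ac b + (to_ac c - to_ac a) * poly q (to_ac c)"
        by (subst p_eq) (simp add: algebra_simps)
      then have "poly q (to_ac c) = (to_ac d - to_ac b) / (to_ac c - to_ac a)"
        using d c by (simp add: field_simps)
      also have "\<dots> = to_ac ((d - b) / (c - a))" by simp
      finally show ?thesis by blast
    qed
    then have "{c. poly q (to_ac c) \<notin> range to_ac} \<subseteq> insert a {a. poly p (to_ac a) \<notin> range to_ac}"
      by blast
    then have "finite {c. poly q (to_ac c) \<notin> range to_ac}"
      using less.prems by (meson finite_insert finite_subset)
    from less.hyps[OF dq this] obtain q' where "q = emb q'" by auto
    then have "p = emb ([:b:] + [:- a, 1:] * q')"
      using p_eq by (simp add: emb_add emb_mult map_poly_pCons del: mult_pCons_left)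
    then show ?thesis by blast
  qed
qed

lemma values_in_base_imp:
  fixes p :: "'a::field_char_0 alg_closure poly"
  assumes "\<And>a. poly p (to_ac a) \<in> range to_ac"
  shows "p \<in> range emb"
  by (rule cofinite_values_in_base_imp) (simp add: assms)

text \<open>With d the degree and k > 0, the coefficient of X^(2d - k) in g^2 is twice that of X^(d
  - k) in g plus products of coefficients of g of higher index. So the coefficients are obtained
  from the top downwards, dividing only by 2.\<close>

lemma monic_square_in_base_imp:
  fixes g :: "'a::field_char_0 alg_closure poly"
  assumes lead: "Polynomial.lead_coeff g = 1" and sq: "g * g \<in> range emb"
  shows "g \<in> range emb"
proof -
  define d where "d = pdeg g"
  let ?c = "poly.coeff g"
  have mult_in: "x * y \<in> range to_ac" if "x \<in> range to_ac" "y \<in> range to_ac" for x y :: "'a alg_closure"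
    using that by (metis (no_types, lifting) imageE rangeI to_ac_mult)
  have sum_in: "sum f A \<in> range to_ac" if "\<And>x. x \<in> A \<Longrightarrow> f x \<in> range to_ac" for f :: "nat \<Rightarrow> 'a alg_closure" and A
  proof -
    have "sum f A = (\<Sum>x\<in>A. to_ac (of_ac (f x)))"
      by (rule sum.cong) (simp_all add: to_ac_of_ac that)
    then show ?thesis by (metis rangeI to_ac_sum)
  qed
  have "k \<le> d \<Longrightarrow> ?c (d - k) \<in> range to_ac" for k
  proof (induction k rule: less_induct)
    case (less k)
    show ?case
    proof (cases "k = 0")
      case True
      then show ?thesis using lead by (auto simp: d_def intro: image_eqI[of _ _ 1])
    next
      case False
      obtain s where s: "poly.coeff (g * g) (2 * d - k) = to_ac s"
        using sq by (auto simp: coeff_emb)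
      have "poly.coeff (g * g) (2 * d - k) = (\<Sum>i\<le>2 * d - k. ?c i * ?c (2 * d - k - i))"
        by (rule coeff_mult)
      also have "\<dots> = (\<Sum>i\<in>{d - k..d}. ?c i * ?c (2 * d - k - i))"
      proof (rule sum.mono_neutral_right)
        show "\<forall>i\<in>{..2 * d - k} - {d - k..d}. ?c i * ?c (2 * d - k - i) = 0"
        proof
          fix i assume "i \<in> {..2 * d - k} - {d - k..d}"
          then have "i > d \<or> 2 * d - k - i > d" using less.prems by auto
          then show "?c i * ?c (2 * d - k - i) = 0"
            using coeff_eq_0[of g] by (auto simp: d_def)
        qed
      qed (use less.prems in auto)
      also have "{d - k..d} = insert (d - k) (insert d {d - k<..<d})"
        using less.prems False by auto
      also have "(\<Sum>i\<in>insert (d - k) (insert d {d - k<..<d}). ?c i * ?c (2 * d - k - i))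
        = ?c (d - k) * ?c d + (?c d * ?c (d - k) + (\<Sum>i\<in>{d - k<..<d}. ?c i * ?c (2 * d - k - i)))"
      proof -
        have "2 * d - k - (d - k) = d" "2 * d - k - d = d - k" using less.prems by auto
        then show ?thesis using less.prems False by simp
      qed
      also have "\<dots> = 2 * ?c (d - k) + (\<Sum>i\<in>{d - k<..<d}. ?c i * ?c (2 * d - k - i))"
        using lead by (simp add: d_def)
      finally have eq: "to_ac s = 2 * ?c (d - k) + (\<Sum>i\<in>{d - k<..<d}. ?c i * ?c (2 * d - k - i))"
        using s by simp
      have "(\<Sum>i\<in>{d - k<..<d}. ?c i * ?c (2 * d - k - i)) \<in> range to_ac"
      proof (rule sum_in, rule mult_in)
        fix i assume i: "i \<in> {d - k<..<d}"
        have "d - i < k" "d - i \<le> d" using i by auto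
        from less.IH[OF this] show "?c i \<in> range to_ac" using i by simp
        have "i + k - d < k" "i + k - d \<le> d" using i less.prems by auto
        moreover have "d - (i + k - d) = 2 * d - k - i" using i less.prems by auto
        ultimately show "?c (2 * d - k - i) \<in> range to_ac"
          using less.IH by metis
      qed
      then obtain u where "(\<Sum>i\<in>{d - k<..<d}. ?c i * ?c (2 * d - k - i)) = to_ac u" by auto
      with eq have "?c (d - k) = to_ac ((s - u) / 2)" by simp
      then show ?thesis by blast
    qed
  qed
  then have "?c i \<in> range to_ac" if "i \<le> d" for i
    using that by (metis diff_diff_cancel diff_le_self)
  moreover have "?c i = to_ac 0" if "\<not> i \<le> d" for i
    using that coeff_eq_0[of g i] by (simp add: d_def)
  ultimately have "?c i \<in> range to_ac" for i
    by (cases "i \<le> d") auto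
  then have "g = emb (map_poly of_ac g)"
    by (intro poly_eqI) (simp add: coeff_emb coeff_map_poly to_ac_of_ac)
  then show ?thesis by (rule range_eqI)
qed

text \<open>The square reaches each ordered pair off the diagonal once and each diagonal pair twice.
  This trades a product over pairs i <= j for iterated products over all roots, to which
  \<open>prod_over_roots_in_base\<close> can be applied.\<close>

lemma prod_symmetric_square:
  fixes f :: "nat \<Rightarrow> nat \<Rightarrow> 'a::comm_monoid_mult"
  assumes "\<And>i j. f i j = f j i"
  shows "(\<Prod>j<n. \<Prod>i\<le>j. f i j) * (\<Prod>j<n. \<Prod>i\<le>j. f i j) = (\<Prod>i<n. \<Prod>j<n. f i j) * (\<Prod>j<n. f j j)"
proof (induction n)
  case (Suc n)
  have "(\<Prod>i<Suc n. \<Prod>j<Suc n. f i j) = (\<Prod>i<n. \<Prod>j<n. f i j) * (\<Prod>i<n. f i n) * (\<Prod>i<n. f i n) * f n n"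
  proof -
    have "(\<Prod>j<n. f n j) = (\<Prod>i<n. f i n)" by (rule prod.cong[OF refl assms])
    then show ?thesis by (simp add: prod.distrib mult.assoc)
  qed
  moreover have "(\<Prod>i\<le>n. f i n) = (\<Prod>i<n. f i n) * f n n"
    by (simp flip: lessThan_Suc_atMost)
  ultimately show ?case using Suc by (simp add: ac_simps)
qed simp

text \<open>The sum is the homogenization v^n f(u / v), which keeps its meaning at v = 0. It will be
  applied with u and v depending on a root, where v may vanish.\<close>

lemma prod_homogenized:
  fixes f :: "'a::field poly"
  assumes f: "f = (\<Prod>x\<in>#A. [:-x, 1:])"
  shows "(\<Prod>x\<in>#A. u - v * x) = (\<Sum>k\<le>size A. poly.coeff f k * u ^ k * v ^ (size A - k))"
proof (cases "v = 0")
  case True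
  have "(\<Sum>k\<le>size A. poly.coeff f k * u ^ k * v ^ (size A - k)) = (\<Sum>k\<in>{size A}. poly.coeff f k * u ^ k * v ^ (size A - k))"
    by (rule sum.mono_neutral_right) (auto simp: True)
  also have "\<dots> = u ^ size A"
    using monic_linear_prod(1,2)[of A] by (simp add: f)
  finally show ?thesis using True by simp
next
  case False
  have "(\<Prod>x\<in>#A. u - v * x) = (\<Prod>x\<in>#A. v * (u / v - x))"
    using False by (simp add: algebra_simps)
  also have "\<dots> = v ^ size A * poly f (u / v)"
    by (simp add: prod_mset.distrib f poly_linear_prod)
  also have "\<dots> = (\<Sum>k\<le>size A. v ^ size A * (poly.coeff f k * (u / v) ^ k))"
    using monic_linear_prod(2)[of A] by (simp add: poly_altdef f sum_distrib_left)
  also have "\<dots> = (\<Sum>k\<le>size A. poly.coeff f k * u ^ k * v ^ (size A - k))"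
    using False by (intro sum.cong) (simp_all add: power_diff power_divide)
  finally show ?thesis .
qed

text \<open>The product is symmetric in the roots. Its square is a product over all ordered pairs
  times one over the diagonal, and at a base point both are products, over the roots of f, of the
  values of a base polynomial. So the square has values, hence coefficients, in the base, and its
  monic square root inherits this.\<close>

lemma pair_polynomial_in_base:
  fixes f :: "'a::field_char_0 poly" and t :: 'a
  assumes f: "emb f = (\<Prod>x\<in>#mset rs. [:-x, 1:])"
  shows "(\<Prod>j<length rs. \<Prod>i\<le>j. [:-(rs ! i + rs ! j + to_ac t * rs ! i * rs ! j), 1:]) \<in> range emb"
proof (rule monic_square_in_base_imp)
  let ?n = "length rs"
  let ?L = "\<lambda>i j. [:-(rs ! i + rs ! j + to_ac t * rs ! i * rs ! j), 1:]"
  let ?G = "\<Prod>j<?n. \<Prod>i\<le>j. ?L i j"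
  show "Polynomial.lead_coeff ?G = 1"
    by (simp add: lead_coeff_prod)
  have square: "?G * ?G = (\<Prod>i<?n. \<Prod>j<?n. ?L i j) * (\<Prod>j<?n. ?L j j)"
  proof (rule prod_symmetric_square[where f = ?L])
    fix i j
    have "rs ! i + rs ! j + to_ac t * rs ! i * rs ! j = rs ! j + rs ! i + to_ac t * rs ! j * rs ! i"
      by (simp only: add.commute[of "rs ! i" "rs ! j"] mult.assoc mult.commute[of "rs ! i" "rs ! j"])
    then show "?L i j = ?L j i" by (simp only:)
  qed
  show "?G * ?G \<in> range emb"
    unfolding square
  proof (rule values_in_base_imp)
    have to_mset: "(\<Prod>i<?n. F (rs ! i)) = (\<Prod>x\<in>#mset rs. F x)" for F :: "'a alg_closure \<Rightarrow> 'a alg_closure"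
    proof -
      have "(\<Prod>x\<in>#mset rs. F x) = prod_list (map F rs)"
        by (metis mset_map prod_mset_prod_list)
      also have "\<dots> = (\<Prod>i<?n. F (rs ! i))"
        by (simp add: prod.list_conv_set_nth atLeast0LessThan)
      finally show ?thesis by simp
    qed
    show "poly ((\<Prod>i<?n. \<Prod>j<?n. ?L i j) * (\<Prod>j<?n. ?L j j)) (to_ac a) \<in> range to_ac" for a
    proof -
      \<comment> \<open>For a fixed root x the factors are (a - x) - (1 + t x) y with y running over
        the roots. Homogenizing f at u = a - x, v = 1 + t x turns their product into the value at x
        of a polynomial over the base.\<close>
      define H where "H = (\<Sum>k\<le>?n. Polynomial.smult (poly.coeff f k) ([:a, -1:] ^ k * [:1, t:] ^ (?n - k)))"
      define D where "D = [:a, -2, -t:]"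
      have "poly (\<Prod>i<?n. \<Prod>j<?n. ?L i j) (to_ac a)
        = (\<Prod>i<?n. \<Prod>j<?n. (to_ac a - rs ! i) - (1 + to_ac t * rs ! i) * rs ! j)"
        by (simp add: poly_prod algebra_simps)
      also have "\<dots> = (\<Prod>x\<in>#mset rs. \<Prod>y\<in>#mset rs. (to_ac a - x) - (1 + to_ac t * x) * y)"
        by (simp only: flip: to_mset)
      also have "\<dots> = (\<Prod>x\<in>#mset rs. poly (emb H) x)"
        unfolding prod_homogenized[OF f]
        by (simp add: H_def emb_sum emb_smult emb_mult emb_power poly_sum map_poly_pCons coeff_emb algebra_simps)
      finally have 1: "poly (\<Prod>i<?n. \<Prod>j<?n. ?L i j) (to_ac a) = (\<Prod>x\<in>#mset rs. poly (emb H) x)" .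
      have "poly (\<Prod>j<?n. ?L j j) (to_ac a) = (\<Prod>i<?n. poly (emb D) (rs ! i))"
        by (simp add: poly_prod D_def map_poly_pCons algebra_simps)
      also have "\<dots> = (\<Prod>x\<in>#mset rs. poly (emb D) x)"
        by (simp only: flip: to_mset)
      finally have 2: "poly (\<Prod>j<?n. ?L j j) (to_ac a) = (\<Prod>x\<in>#mset rs. poly (emb D) x)" .
      obtain c where c: "(\<Prod>x\<in>#mset rs. poly (emb H) x) = to_ac c"
        by (rule rangeE[OF prod_over_roots_in_base[OF f, of H]])
      obtain d where d: "(\<Prod>x\<in>#mset rs. poly (emb D) x) = to_ac d"
        by (rule rangeE[OF prod_over_roots_in_base[OF f, of D]])
      show ?thesis
        unfolding Polynomial.poly_mult 1 2 c d to_ac_mult[symmetric] by (rule rangeI)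
    qed
  qed
qed


text \<open>The number of unordered pairs, in a form that shows one factor 2 less than n: for k a
  power of 2 and m odd, n is even and m (n + 1) is odd. This is what makes Laplace's induction
  descend.\<close>

lemma sum_Suc_lessThan_even:
  fixes n k m :: nat
  assumes "n = 2 * k * m"
  shows "(\<Sum>j<n. Suc j) = k * (m * (n + 1))"
proof -
  have "2 * (\<Sum>j<n. Suc j) = n * (n + 1)"
    by (induction n) (simp_all add: algebra_simps)
  then show ?thesis using assms by (simp add: algebra_simps)
qed

lemma infinite_pigeonhole:
  assumes "finite P" "infinite (UNIV :: 'a set)" "\<And>t :: 'a. \<exists>p\<in>P. R t p"
  obtains t t' p where "t \<noteq> t'" "p \<in> P" "R t p" "R t' p"
proof -
  obtain f where f: "\<And>t. f t \<in> P" "\<And>t. R t (f t)" using assms(3) by metis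
  then have "finite (range f)" using assms(1) by (meson finite_subset image_subsetI)
  then have "\<not> inj f" using assms(2) finite_imageD by blast
  then obtain t t' where "t \<noteq> t'" "f t = f t'" by (auto simp: inj_on_def)
  then show ?thesis using f that by metis
qed

section \<open>Adjoining a square root of -1 inside the algebraic closure\<close>

definition adjoin_root :: "'a::field alg_closure \<Rightarrow> 'a alg_closure set" where
  "adjoin_root w = {to_ac a + w * to_ac b | a b. True}"

context
  fixes w :: "'a::real_closed_field alg_closure"
  assumes w: "w * w = -1"
begin

lemma adjoin_root_base: "to_ac a \<in> adjoin_root w"
  unfolding adjoin_root_def by (auto intro: exI[of _ a] exI[of _ 0])

lemma adjoin_root_add: "x \<in> adjoin_root w \<Longrightarrow> y \<in> adjoin_root w \<Longrightarrow> x + y \<in> adjoin_root w"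
  unfolding adjoin_root_def
proof clarify
  fix a b c d
  have "to_ac a + w * to_ac b + (to_ac c + w * to_ac d) = to_ac (a + c) + w * to_ac (b + d)"
    by (simp add: algebra_simps)
  then show "\<exists>a' b'. to_ac a + w * to_ac b + (to_ac c + w * to_ac d) = to_ac a' + w * to_ac b' \<and> True"
    by blast
qed

lemma adjoin_root_mult: "x \<in> adjoin_root w \<Longrightarrow> y \<in> adjoin_root w \<Longrightarrow> x * y \<in> adjoin_root w"
  unfolding adjoin_root_def
proof clarify
  fix a b c d
  have "(to_ac a + w * to_ac b) * (to_ac c + w * to_ac d)
    = to_ac a * to_ac c + (w * w) * (to_ac b * to_ac d) + w * (to_ac a * to_ac d + to_ac b * to_ac c)"
    by (simp add: algebra_simps)
  also have "\<dots> = to_ac (a * c - b * d) + w * to_ac (a * d + b * c)"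
    by (simp add: w)
  finally show "\<exists>a' b'. (to_ac a + w * to_ac b) * (to_ac c + w * to_ac d) = to_ac a' + w * to_ac b' \<and> True"
    by blast
qed

lemma adjoin_root_scale: "x \<in> adjoin_root w \<Longrightarrow> to_ac c * x \<in> adjoin_root w"
  by (rule adjoin_root_mult[OF adjoin_root_base])

text \<open>With s the modulus of a + w b, the root is u + w v with u^2 = (s + a) / 2 and v^2 = (s -
  a) / 2. These equations give 2 u v = b only up to sign, so v may have to be negated.\<close>

lemma adjoin_root_sqrt:
  assumes "x \<in> adjoin_root w"
  shows "\<exists>y\<in>adjoin_root w. y * y = x"
proof -
  obtain a b where x: "x = to_ac a + w * to_ac b" using assms by (auto simp: adjoin_root_def)
  obtain s0 where s0: "s0 * s0 = a * a + b * b"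
    using nonneg_imp_square[of "a * a + b * b"] by auto
  define s where "s = \<bar>s0\<bar>"
  have s: "s * s = a * a + b * b" "s \<ge> 0" using s0 by (simp_all add: s_def)
  have "\<bar>a\<bar> \<le> s"
    using s by (metis abs_le_square_iff abs_of_nonneg le_add_same_cancel1 power2_eq_square zero_le_square)
  then have "0 \<le> (s + a) / 2" "0 \<le> (s - a) / 2" by auto
  then obtain u v where u: "u * u = (s + a) / 2" and v: "v * v = (s - a) / 2"
    using nonneg_imp_square by meson
  have "(2 * (u * v)) * (2 * (u * v)) = 4 * (u * u) * (v * v)" by simp
  also have "\<dots> = s * s - a * a" unfolding u v by (simp add: field_simps)
  also have "\<dots> = b * b" using s by simp
  finally have "2 * (u * v) = b \<or> 2 * (u * v) = -b"
    using square_eq_iff by blast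
  moreover have "(to_ac u + w * to_ac v') * (to_ac u + w * to_ac v') = x"
    if "2 * (u * v') = b" "v' * v' = (s - a) / 2" for v'
  proof -
    have "(to_ac u + w * to_ac v') * (to_ac u + w * to_ac v')
      = to_ac u * to_ac u + (w * w) * (to_ac v' * to_ac v') + w * (2 * (to_ac u * to_ac v'))"
      by (simp add: algebra_simps)
    also have "\<dots> = to_ac (u * u - v' * v') + w * to_ac (2 * (u * v'))"
      by (simp add: w)
    also have "u * u - v' * v' = a" unfolding u that(2) by (simp add: field_simps)
    finally show ?thesis using that(1) by (simp add: x)
  qed
  from this[of v] this[of "- v"] have "2 * (u * v) = b \<Longrightarrow> (to_ac u + w * to_ac v) * (to_ac u + w * to_ac v) = x"
    "2 * (u * v) = - b \<Longrightarrow> (to_ac u + w * to_ac (-v)) * (to_ac u + w * to_ac (-v)) = x"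
    using v by (simp_all del: to_ac_minus)
  moreover have "to_ac u + w * to_ac v' \<in> adjoin_root w" for v'
    by (auto simp: adjoin_root_def)
  ultimately show ?thesis by blast
qed

text \<open>The discriminant (x + y)^2 - 4 x y has a square root in the set, and this root is x - y
  up to sign.\<close>

lemma adjoin_root_quadratic:
  assumes "x + y \<in> adjoin_root w" "x * y \<in> adjoin_root w"
  shows "x \<in> adjoin_root w"
proof -
  have "(x + y) * (x + y) + to_ac (-4) * (x * y) \<in> adjoin_root w"
    using assms by (intro adjoin_root_add adjoin_root_mult[OF assms(1,1)] adjoin_root_scale)
  then obtain d where d: "d \<in> adjoin_root w" "d * d = (x + y) * (x + y) + to_ac (-4) * (x * y)"
    using adjoin_root_sqrt by blast
  have "d * d = (x - y) * (x - y)"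
    unfolding d(2) by (simp add: algebra_simps)
  then have "x - y = d \<or> x - y = - d"
    using square_eq_iff by metis
  then have "x = to_ac (1/2) * ((x + y) + d) \<or> x = to_ac (1/2) * ((x + y) + to_ac (-1) * d)"
    by (auto simp: field_simps)
  moreover have "to_ac (1/2) * ((x + y) + d) \<in> adjoin_root w"
      "to_ac (1/2) * ((x + y) + to_ac (-1) * d) \<in> adjoin_root w"
    by (intro adjoin_root_scale adjoin_root_add assms d)+
  ultimately show ?thesis by metis
qed

text \<open>
  Laplace's argument: the induction is on the exponent of 2 in the degree. For each of
  infinitely many \<open>t\<close>, the polynomial with roots \<open>x + y + t x y\<close>, one for each unordered pair
  of roots, has a root in the adjunction; two values of \<open>t\<close> must share their pair.
\<close>

lemma root_in_adjoin_root:
  fixes f :: "'a poly"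
  assumes "pdeg f = 2 ^ k * m" "odd m"
  shows "\<exists>z\<in>adjoin_root w. poly (emb f) z = 0"
  using assms
proof (induction k arbitrary: f m)
  case 0
  then have odd: "odd (pdeg f)" by simp
  then have "poly.coeff f (pdeg f) \<noteq> 0" by (metis degree_0 even_zero leading_coeff_neq_0)
  from odd_degree_imp_root[where c = "poly.coeff f", OF odd this] obtain x where "poly f x = 0"
    by (auto simp: poly_altdef)
  then have "poly (emb f) (to_ac x) = 0" by (simp add: poly_emb_to_ac)
  then show ?case using adjoin_root_base by blast
next
  case (Suc k)
  define f1 where "f1 = Polynomial.smult (inverse (Polynomial.lead_coeff f)) f"
  have "f \<noteq> 0" using Suc.prems by (intro notI) (auto simp: odd_pos)
  then have l: "Polynomial.lead_coeff f \<noteq> 0" by simp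
  have f_eq: "f = Polynomial.smult (Polynomial.lead_coeff f) f1" using l by (simp add: f1_def)
  have "f1 \<noteq> 0" using \<open>f \<noteq> 0\<close> l by (simp add: f1_def)
  have deg1: "pdeg f1 = pdeg f" using l by (simp add: f1_def)
  have "Polynomial.lead_coeff f1 = 1" using l by (simp add: f1_def)
  then have "Polynomial.lead_coeff (emb f1) = 1" by (simp add: coeff_emb pdeg_emb)
  then obtain A where A: "emb f1 = (\<Prod>x\<in>#A. [:-x, 1:])"
    using alg_closed_imp_factorization[of "emb f1"] \<open>f1 \<noteq> 0\<close> by (auto simp: emb_eq_0_iff)
  obtain rs where rs: "A = mset rs" by (metis ex_mset)
  define n where "n = length rs"
  have n: "n = 2 * 2 ^ k * m"
    using arg_cong[OF A, of pdeg] Suc.prems deg1 by (simp add: n_def rs pdeg_emb monic_linear_prod(2))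
  let ?s = "\<lambda>t i j. rs ! i + rs ! j + to_ac t * rs ! i * rs ! j"
  have ex: "\<exists>p\<in>{..<n} \<times> {..<n}. ?s t (fst p) (snd p) \<in> adjoin_root w" for t
  proof -
    obtain Q where Q: "(\<Prod>j<n. \<Prod>i\<le>j. [:-?s t i j, 1:]) = emb Q"
      unfolding n_def by (rule rangeE[OF pair_polynomial_in_base[OF A[unfolded rs], of t]])
    have "pdeg Q = pdeg (\<Prod>j<n. \<Prod>i\<le>j. [:-?s t i j, 1:])"
      unfolding Q by (simp add: pdeg_emb)
    also have "\<dots> = (\<Sum>j<n. Suc j)"
      by (simp add: degree_prod_eq_sum_degree prod_zero_iff)
    also have "\<dots> = 2 ^ k * (m * (n + 1))"
      using n Suc.prems by (intro sum_Suc_lessThan_even)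
    finally have "pdeg Q = 2 ^ k * (m * (n + 1))" .
    moreover have "odd (m * (n + 1))" using n Suc.prems by simp
    ultimately obtain z where z: "z \<in> adjoin_root w" "poly (emb Q) z = 0"
      using Suc.IH by blast
    have "poly [:- s, 1:] z = z - s" for s by simp
    then have "(\<Prod>j<n. \<Prod>i\<le>j. z - ?s t i j) = 0"
      using z(2) by (simp only: Q[symmetric] poly_prod)
    then obtain j where j: "j < n" "(\<Prod>i\<le>j. z - ?s t i j) = 0"
      by (auto simp only: prod_zero_iff finite_lessThan lessThan_iff)
    then obtain i where "i \<le> j" "z - ?s t i j = 0"
      by (auto simp only: prod_zero_iff finite_atMost atMost_iff)
    then have "i \<le> j" "z = ?s t i j" by (simp_all only: right_minus_eq)
    then show ?thesis using z(1) j(1) by (intro bexI[of _ "(i, j)"]) auto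
  qed
  obtain t t' p where t: "t \<noteq> t'" and p: "p \<in> {..<n} \<times> {..<n}"
      "?s t (fst p) (snd p) \<in> adjoin_root w" "?s t' (fst p) (snd p) \<in> adjoin_root w"
    by (rule infinite_pigeonhole[OF _ infinite_UNIV_char_0 ex]) (rule finite_cartesian_product; rule finite_lessThan)
  define x y where "x = rs ! fst p" and "y = rs ! snd p"
  have xt: "x + y + to_ac t * x * y \<in> adjoin_root w" "x + y + to_ac t' * x * y \<in> adjoin_root w"
    using p(2,3) by (simp_all only: x_def y_def)
  \<comment> \<open>Two values of t at the same pair give two linear equations for x + y and x y;
    their difference isolates x y.\<close>
  have "to_ac (1 / (t - t')) * ((x + y + to_ac t * x * y) + to_ac (-1) * (x + y + to_ac t' * x * y)) \<in> adjoin_root w"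
    by (intro adjoin_root_scale[OF adjoin_root_add[OF xt(1) adjoin_root_scale[OF xt(2)]]])
  moreover have "to_ac (1 / (t - t')) * ((x + y + to_ac t * x * y) + to_ac (-1) * (x + y + to_ac t' * x * y)) = x * y"
  proof -
    have "(x + y + to_ac t * x * y) + to_ac (-1) * (x + y + to_ac t' * x * y) = to_ac (t - t') * (x * y)"
      by (simp add: algebra_simps)
    moreover have "to_ac (1 / (t - t')) * (to_ac (t - t') * (x * y)) = to_ac (1 / (t - t') * (t - t')) * (x * y)"
      by (simp only: to_ac_mult mult.assoc)
    ultimately show ?thesis using t by simp
  qed
  ultimately have xy: "x * y \<in> adjoin_root w" by simp
  have "(x + y + to_ac t * x * y) + to_ac (-t) * (x * y) \<in> adjoin_root w"
    by (rule adjoin_root_add[OF xt(1) adjoin_root_scale[OF xy]])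
  then have "x + y \<in> adjoin_root w" by (simp add: algebra_simps)
  then have "x \<in> adjoin_root w" using xy by (rule adjoin_root_quadratic)
  moreover have "fst p < length rs" using p(1) by (auto simp: n_def)
  then have "x \<in> set rs" unfolding x_def by (rule nth_mem)
  then have "poly (emb f1) x = 0"
    by (simp add: A rs poly_linear_prod prod_mset_zero_iff image_iff)
  then have "poly (emb f) x = 0" by (subst f_eq) (simp add: emb_smult)
  ultimately show ?case by blast
qed

end

text \<open>Take a root a + w b in the extension. If b = 0 it yields a linear factor. Otherwise it
  is also a root of (X - a)^2 + b^2, and the remainder modulo this quadratic, of degree at most 1
  with base coefficients, can vanish there only if it is 0.\<close>

lemma real_closed_poly_factor:
  fixes p :: "'a::real_closed_field poly"
  assumes "pdeg p > 0"
  shows "(\<exists>a g. p = [:-a, 1:] * g) \<or> (\<exists>a b g. b \<noteq> 0 \<and> p = [:a * a + b * b, - 2 * a, 1:] * g)"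
proof -
  obtain w :: "'a alg_closure" where w: "w * w = -1"
    using nth_root_exists[of 2 "-1 :: 'a alg_closure"] by (auto simp: power2_eq_square)
  obtain k m where km: "pdeg p = 2 ^ k * m" "odd m"
    using multiplicity_decompose'[of "pdeg p" 2] assms by (metis gr_implies_not0 prime_elem_nat_iff two_is_prime_nat not_prime_unit)
  obtain z where z: "z \<in> adjoin_root w" "poly (emb p) z = 0"
    using root_in_adjoin_root[OF w km] by blast
  obtain a b where ab: "z = to_ac a + w * to_ac b" using z(1) by (auto simp: adjoin_root_def)
  \<comment> \<open>1 and w are independent over the base, since u + w v = 0 gives u^2 + v^2 = 0,
    which the order forbids unless both are 0.\<close>
  have not_base: "u = 0 \<and> v = 0" if "to_ac u + w * to_ac v = 0" for u v
  proof (rule ccontr)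
    assume "\<not> (u = 0 \<and> v = 0)"
    then have "v \<noteq> 0" using that by auto
    have "to_ac (- u) = w * to_ac v" using that by (simp add: add_eq_0_iff)
    then have "to_ac (- u) * to_ac (- u) = (w * w) * (to_ac v * to_ac v)" by simp
    then have "to_ac (u * u) = to_ac (- (v * v))" by (simp add: w)
    then have "u * u + v * v = 0" by (simp del: to_ac_mult to_ac_minus)
    then show False using \<open>v \<noteq> 0\<close> by (simp add: add_nonneg_eq_0_iff)
  qed
  show ?thesis
  proof (cases "b = 0")
    case True
    then have "poly p a = 0" using z(2) by (simp add: ab poly_emb_to_ac)
    then show ?thesis by (metis dvdE poly_eq_0_iff_dvd)
  next
    case False
    define q where "q = [:a * a + b * b, - 2 * a, 1:]"
    have "poly (emb q) z = (to_ac a * to_ac a + to_ac b * to_ac b) - 2 * to_ac a * z + z * z"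
      by (simp add: q_def map_poly_pCons algebra_simps)
    also have "\<dots> = to_ac b * to_ac b + (w * w) * (to_ac b * to_ac b)"
      by (simp add: ab algebra_simps)
    finally have qz: "poly (emb q) z = 0" by (simp add: w)
    define r where "r = p mod q"
    have p_eq: "p = q * (p div q) + r" by (simp add: r_def)
    then have "emb p = emb q * emb (p div q) + emb r" by (metis emb_add emb_mult)
    then have rz: "poly (emb r) z = 0" using qz z(2) by simp
    have "q \<noteq> 0" by (simp add: q_def)
    have "pdeg q = 2" by (simp add: q_def)
    then have "r = 0 \<or> pdeg r < 2" using degree_mod_less[OF \<open>q \<noteq> 0\<close>, of p] by (simp add: r_def)
    then have "pdeg r \<le> 1" by auto
    obtain c r' where r': "r = pCons c r'" by (cases r) auto
    have "pdeg r' = 0" using \<open>pdeg r \<le> 1\<close> r' by (auto simp: degree_pCons_eq_if split: if_splits)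
    then obtain d where "r' = [:d:]" by (rule degree_eq_zeroE)
    then have r: "r = [:c, d:]" using r' by simp
    then have "to_ac (c + d * a) + w * to_ac (d * b) = 0"
      using rz by (simp add: ab map_poly_pCons algebra_simps)
    from not_base[OF this] have "r = 0" using False r by auto
    then show ?thesis using p_eq False unfolding q_def by (metis add.right_neutral)
  qed
qed

section \<open>Polynomials over a real closed field\<close>

text \<open>Splitting off a factor keeps the sign change. A quadratic factor (X - c)^2 + d^2 is
  positive; a linear factor either has its root between a and b, which suffices, or takes values at
  a and b whose product is not negative.\<close>

theorem real_closed_poly_IVT:
  fixes p :: "'a::real_closed_field poly"
  assumes "a < b" "poly p a * poly p b < 0"
  shows "\<exists>x. a < x \<and> x < b \<and> poly p x = 0"
  using assms(2)
proof (induction "pdeg p" arbitrary: p rule: less_induct)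
  case less
  have "pdeg p > 0"
  proof (rule ccontr)
    assume "\<not> pdeg p > 0"
    then obtain c where "p = [:c:]" by (auto elim: degree_eq_zeroE)
    then show False using less.prems by (simp add: mult_less_0_iff)
  qed
  from real_closed_poly_factor[OF this] show ?case
  proof (elim disjE exE conjE)
    fix c g assume p: "p = [:-c, 1:] * g"
    have "g \<noteq> 0" using less.prems p by auto
    then have "pdeg p = Suc (pdeg g)" unfolding p by (subst degree_mult_eq) auto
    show ?thesis
    proof (cases "a < c \<and> c < b")
      case True
      then show ?thesis using p by (intro exI[of _ c]) simp
    next
      case False
      have "poly p a * poly p b = ((a - c) * (b - c)) * (poly g a * poly g b)"
        by (simp add: p algebra_simps)
      moreover have "(a - c) * (b - c) \<ge> 0"
        using False assms(1) by (auto simp: zero_le_mult_iff not_less)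
      ultimately have "poly g a * poly g b < 0"
        using less.prems by (metis mult_nonneg_nonneg not_less)
      from less.hyps[OF _ this] \<open>pdeg p = Suc (pdeg g)\<close> obtain x where "a < x" "x < b" "poly g x = 0" by auto
      then show ?thesis using p by (intro exI[of _ x]) simp
    qed
  next
    fix c d g assume d: "d \<noteq> 0" and p: "p = [:c * c + d * d, - 2 * c, 1:] * g"
    let ?q = "[:c * c + d * d, - 2 * c, 1:]"
    have "g \<noteq> 0" using less.prems p by auto
    then have "pdeg p = 2 + pdeg g" unfolding p by (subst degree_mult_eq) auto
    have pos: "poly ?q x > 0" for x
    proof -
      have "poly ?q x = (x - c) * (x - c) + d * d" by (simp add: algebra_simps)
      moreover have "d * d > 0" using d by (auto simp: zero_less_mult_iff neq_iff)
      ultimately show ?thesis using zero_le_square[of "x - c"] by linarith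
    qed
    have "poly p a * poly p b = (poly ?q a * poly ?q b) * (poly g a * poly g b)"
      by (simp only: p Polynomial.poly_mult ac_simps)
    moreover have "poly ?q a * poly ?q b > 0" using pos by (simp only: mult_pos_pos)
    ultimately have "poly g a * poly g b < 0"
      using less.prems by (metis mult_less_0_iff less_asym)
    from less.hyps[OF _ this] \<open>pdeg p = 2 + pdeg g\<close> obtain x where "a < x" "x < b" "poly g x = 0" by auto
    then show ?thesis using p by (intro exI[of _ x]) simp
  qed
qed

text \<open>
  For neighbouring roots \<open>a\<close> and \<open>b\<close>, write \<open>p = (x - a)^m (x - b)^k g\<close>; the cofactor of
  \<open>(x - a)^(m - 1) (x - b)^(k - 1)\<close> in \<open>p'\<close> has opposite signs at \<open>a\<close> and \<open>b\<close>.
\<close>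

lemma real_closed_poly_Rolle:
  fixes p :: "'a::real_closed_field poly"
  assumes "a < b" "poly p a = 0" "poly p b = 0"
  shows "\<exists>x. a < x \<and> x < b \<and> poly (pderiv p) x = 0"
proof (cases "p = 0")
  case True
  then show ?thesis using dense[OF assms(1)] by auto
next
  case nz: False
  \<comment> \<open>There may be roots between a and b. The argument is run up to the first root c
    after a, so that g cannot change sign in between.\<close>
  define R where "R = {x. poly p x = 0 \<and> a < x}"
  define c where "c = Min R"
  have R: "finite R" "b \<in> R" using poly_roots_finite[OF nz] assms by (auto simp: R_def)
  then have "c \<in> R" unfolding c_def by (intro Min_in) auto
  then have c: "poly p c = 0" "a < c" by (auto simp: R_def)
  have "c \<le> b" using R unfolding c_def by (intro Min_le)
  have no_root: "poly p x \<noteq> 0" if "a < x" "x < c" for x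
  proof
    assume "poly p x = 0"
    then have "x \<in> R" using that by (simp add: R_def)
    then have "c \<le> x" unfolding c_def by (rule Min_le[OF R(1)])
    then show False using that by simp
  qed
  let ?x = "[:-a, 1:]" and ?y = "[:-c, 1:]"
  obtain q where q: "p = ?x ^ Polynomial.order a p * q" "\<not> ?x dvd q"
    using order_decomp[OF nz] by blast
  have "q \<noteq> 0" using q nz by auto
  obtain g where g: "q = ?y ^ Polynomial.order c q * g" "\<not> ?y dvd g"
    using order_decomp[OF \<open>q \<noteq> 0\<close>] by blast
  have "Polynomial.order a p \<noteq> 0" using nz assms(2) by (simp add: order_root)
  then obtain m where m: "Polynomial.order a p = Suc m" by (cases "Polynomial.order a p") auto
  have "poly q c = 0" using arg_cong[OF q(1), of "\<lambda>r. poly r c"] c by auto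
  then have "Polynomial.order c q \<noteq> 0" using \<open>q \<noteq> 0\<close> by (simp add: order_root)
  then obtain k where k: "Polynomial.order c q = Suc k" by (cases "Polynomial.order c q") auto
  have p: "p = ?x ^ Suc m * (?y ^ Suc k * g)" using q(1) g(1) m k by simp
  have ga: "poly g a \<noteq> 0" using q(2) g(1) by (metis dvd_mult poly_eq_0_iff_dvd)
  have gc: "poly g c \<noteq> 0" using g(2) by (simp add: poly_eq_0_iff_dvd)
  define h where "h = Polynomial.smult (of_nat (Suc m)) (?y * g) + Polynomial.smult (of_nat (Suc k)) (?x * g)
    + ?x * ?y * pderiv g"
  have dp: "pderiv p = ?x ^ m * ?y ^ k * h"
    unfolding p pderiv_mult pderiv_power_Suc h_def
    by (simp add: pderiv_pCons algebra_simps del: mult_pCons_left mult_pCons_right of_nat_Suc flip: one_pCons)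
  have ha: "poly h a = of_nat (Suc m) * (a - c) * poly g a"
    by (simp add: h_def algebra_simps del: mult_pCons_left mult_pCons_right)
  have hc: "poly h c = of_nat (Suc k) * (c - a) * poly g c"
    by (simp add: h_def algebra_simps del: mult_pCons_left mult_pCons_right)
  have "\<not> poly g a * poly g c < 0"
  proof
    assume "poly g a * poly g c < 0"
    from real_closed_poly_IVT[OF c(2) this] obtain x where "a < x" "x < c" "poly g x = 0" by blast
    then show False using no_root[of x] p by simp
  qed
  moreover have "poly g a * poly g c \<noteq> 0" using ga gc by simp
  ultimately have gac: "poly g a * poly g c > 0" by (simp only: linorder_neq_iff simp_thms)
  have pos: "(of_nat (Suc m) * of_nat (Suc k) * ((c - a) * (c - a)) :: 'a) > 0"
    using c(2) by (intro mult_pos_pos) (auto simp del: of_nat_Suc)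
  have "poly h a * poly h c = - ((of_nat (Suc m) * of_nat (Suc k) * ((c - a) * (c - a))) * (poly g a * poly g c))"
    unfolding ha hc by (simp add: algebra_simps del: of_nat_Suc)
  then have "poly h a * poly h c < 0"
    using mult_pos_pos[OF pos gac] by linarith
  from real_closed_poly_IVT[OF c(2) this] obtain x where "a < x" "x < c" "poly h x = 0" by blast
  then show ?thesis using \<open>c \<le> b\<close> dp by (intro exI[of _ x]) auto
qed

theorem real_closed_poly_MVT:
  fixes p :: "'a::real_closed_field poly"
  assumes "a < b"
  shows "\<exists>x. a < x \<and> x < b \<and> poly p b - poly p a = (b - a) * poly (pderiv p) x"
proof -
  define s where "s = (poly p b - poly p a) / (b - a)"
  define q where "q = p - [:poly p a - s * a, s:]"
  have s: "s * (b - a) = poly p b - poly p a" using assms by (simp add: s_def)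
  have "poly q a = 0" by (simp add: q_def algebra_simps)
  moreover have "poly q b = 0" using s by (simp add: q_def algebra_simps)
  ultimately obtain x where x: "a < x" "x < b" "poly (pderiv q) x = 0"
    using real_closed_poly_Rolle[OF assms] by blast
  have "poly (pderiv p) x = s" using x(3) by (simp add: q_def pderiv_diff pderiv_pCons)
  then show ?thesis using x s by (intro exI[of _ x]) (simp add: mult.commute)
qed

lemma real_closed_poly_mono:
  fixes p :: "'a::real_closed_field poly"
  assumes "a \<le> b" "\<And>x. a < x \<Longrightarrow> x < b \<Longrightarrow> poly (pderiv p) x \<ge> 0"
  shows "poly p a \<le> poly p b"
proof (cases "a = b")
  case False
  then have "a < b" using assms(1) by simp
  from real_closed_poly_MVT[OF this, of p] obtain x where
    x: "a < x" "x < b" "poly p b - poly p a = (b - a) * poly (pderiv p) x" by blast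
  then show ?thesis using assms(2)[of x] \<open>a < b\<close> by (metis diff_ge_0_iff_ge less_imp_le mult_nonneg_nonneg)
qed simp

lemma real_closed_poly_strict_mono:
  fixes p :: "'a::real_closed_field poly"
  assumes "a < b" "\<And>x. a < x \<Longrightarrow> x < b \<Longrightarrow> poly (pderiv p) x > 0"
  shows "poly p a < poly p b"
proof -
  from real_closed_poly_MVT[OF assms(1), of p] obtain x where
    x: "a < x" "x < b" "poly p b - poly p a = (b - a) * poly (pderiv p) x" by blast
  then show ?thesis using assms(2)[of x] assms(1) by (metis diff_gt_0_iff_gt mult_pos_pos)
qed


lemma real_closed_poly_antimono:
  fixes p :: "'a::real_closed_field poly"
  assumes "a \<le> b" "\<And>x. a < x \<Longrightarrow> x < b \<Longrightarrow> poly (pderiv p) x \<le> 0"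
  shows "poly p b \<le> poly p a"
  using real_closed_poly_mono[of a b "- p"] assms by (simp add: pderiv_minus)

text \<open>Integer-valued, so that signs in two different fields can be compared.\<close>

definition sg :: "'a::linordered_field \<Rightarrow> int" where
  "sg x = (if x > 0 then 1 else if x < 0 then -1 else 0)"

lemma sg_eq_0_iff [simp]: "sg x = 0 \<longleftrightarrow> x = 0"
  by (auto simp: sg_def)

lemma sg_pos_iff [simp]: "0 < sg x \<longleftrightarrow> 0 < x"
  by (auto simp: sg_def)

lemma sg_neg_iff [simp]: "sg x < 0 \<longleftrightarrow> x < 0"
  by (auto simp: sg_def)

lemma sg_0 [simp]: "sg 0 = 0"
  by simp

lemma sg_minus [simp]: "sg (- x) = - sg x"
  by (auto simp: sg_def)

lemma sg_mono: "x \<le> y \<Longrightarrow> sg x \<le> sg y"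
  by (auto simp: sg_def)

lemma sg_between: "sg a = sg c \<Longrightarrow> a \<le> b \<Longrightarrow> b \<le> c \<Longrightarrow> sg b = sg a"
  using sg_mono[of a b] sg_mono[of b c] by linarith

lemma sg_mult_pos: "0 < c \<Longrightarrow> sg (c * x) = sg x"
  by (auto simp: sg_def zero_less_mult_iff mult_less_0_iff)

lemma sg_cases: "sg x = -1 \<or> sg x = 0 \<or> sg x = 1"
  by (auto simp: sg_def)

lemma sg_constant_if_no_root:
  fixes p :: "'a::real_closed_field poly"
  assumes "a \<le> b" "\<And>u. a \<le> u \<Longrightarrow> u \<le> b \<Longrightarrow> poly p u \<noteq> 0"
  shows "sg (poly p a) = sg (poly p b)"
proof (rule ccontr)
  assume neq: "sg (poly p a) \<noteq> sg (poly p b)"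
  have "poly p a \<noteq> 0" "poly p b \<noteq> 0" using assms by auto
  then have "poly p a * poly p b < 0"
    using neq by (auto simp: sg_def mult_less_0_iff split: if_splits)
  moreover have "a < b" using neq assms(1) by (cases "a = b") auto
  ultimately obtain u where "a < u" "u < b" "poly p u = 0"
    using real_closed_poly_IVT by blast
  then show False using assms(2)[of u] by simp
qed

text \<open>A positive lower bound l, rather than mere positivity, carries the induction: a + x p(x)
  >= l as soon as p(x) >= l, x >= 0 and x l >= l + |a|.\<close>

lemma eventually_pos_if_lead_coeff_pos:
  fixes p :: "'a::linordered_field poly"
  assumes "Polynomial.lead_coeff p > 0"
  shows "\<exists>n. \<forall>x\<ge>n. poly p x \<ge> Polynomial.lead_coeff p"
  using assms
proof (induction p)
  case (pCons a p)
  show ?case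
  proof (cases "p = 0")
    case False
    define l where "l = Polynomial.lead_coeff p"
    have "l > 0" using pCons.prems False by (simp add: l_def)
    then obtain n where n: "\<And>x. x \<ge> n \<Longrightarrow> poly p x \<ge> l"
      using pCons.IH by (auto simp: l_def)
    define m where "m = max n (max 0 ((l + \<bar>a\<bar>) / l))"
    have "poly (pCons a p) x \<ge> l" if "x \<ge> m" for x
    proof -
      have "(l + \<bar>a\<bar>) / l \<le> x" "0 \<le> x" "n \<le> x" using that by (auto simp: m_def)
      then have "l + \<bar>a\<bar> \<le> x * l" using \<open>l > 0\<close> by (simp add: divide_le_eq)
      also have "\<dots> \<le> x * poly p x" using n[OF \<open>n \<le> x\<close>] \<open>0 \<le> x\<close> by (rule mult_left_mono)
      finally show ?thesis using abs_ge_minus_self[of a] by simp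
    qed
    then show ?thesis using False by (auto simp: l_def)
  qed simp
qed simp

text \<open>With a negative leading coefficient, p(a) - p would be positive far to the right,
  against monotonicity. This serves the cells unbounded to the right, which have no end point to
  compare.\<close>

lemma increasing_poly_eventually_pos:
  fixes p :: "'a::real_closed_field poly"
  assumes "\<And>x. a \<le> x \<Longrightarrow> poly (pderiv p) x > 0"
  shows "\<exists>b>a. poly p b > 0"
proof -
  have "pderiv p \<noteq> 0" using assms[of a] by auto
  then have deg: "pdeg p > 0" by (metis gr0I pderiv_eq_0_iff)
  have "Polynomial.lead_coeff p > 0"
  proof (rule ccontr)
    assume "\<not> Polynomial.lead_coeff p > 0"
    moreover have "p \<noteq> 0" using deg by auto
    ultimately have neg: "Polynomial.lead_coeff p < 0" by (simp add: not_less order_le_less)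
    define q where "q = [:poly p a:] - p"
    have "pdeg q = pdeg p"
      using degree_add_eq_right[of "[:poly p a:]" "- p"] deg by (simp add: q_def)
    moreover have "poly.coeff q (pdeg p) = - poly.coeff p (pdeg p)"
      using deg by (cases "pdeg p") (simp_all add: q_def)
    ultimately have "Polynomial.lead_coeff q > 0"
      using neg by simp
    then obtain n where n: "\<And>x. x \<ge> n \<Longrightarrow> poly q x > 0"
      using eventually_pos_if_lead_coeff_pos[of q] by (meson less_le_trans)
    define b where "b = max n (a + 1)"
    have "a < b" "n \<le> b" unfolding b_def by (auto simp: less_max_iff_disj)
    then have "poly p b < poly p a" using n[of b] by (simp add: q_def)
    moreover have "poly p a < poly p b"
      using \<open>a < b\<close> assms by (intro real_closed_poly_strict_mono) auto
    ultimately show False by simp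
  qed
  then obtain n where n: "\<And>x. x \<ge> n \<Longrightarrow> poly p x > 0"
    using eventually_pos_if_lead_coeff_pos[of p] by (meson less_le_trans)
  define b where "b = max n (a + 1)"
  have "a < b" "n \<le> b" unfolding b_def by (auto simp: less_max_iff_disj)
  then show ?thesis using n by auto
qed

text \<open>Thom's lemma, by induction on the degree: the derivative has a constant sign between x
  and y, so f is monotone there, and its value at u lies between two values of the same
  sign.\<close>

lemma Thom_convex:
  fixes F :: "'a::real_closed_field poly set"
  assumes closed: "\<And>f. f \<in> F \<Longrightarrow> pderiv f \<in> F"
    and eq: "\<And>f. f \<in> F \<Longrightarrow> sg (poly f x) = sg (poly f y)"
    and "f \<in> F" "x \<le> u" "u \<le> y"
  shows "sg (poly f u) = sg (poly f x)"
  using assms(3-)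
proof (induction "pdeg f" arbitrary: f u rule: less_induct)
  case less
  show ?case
  proof (cases "pdeg f = 0")
    case True
    then obtain c where "f = [:c:]" by (auto elim: degree_eq_zeroE)
    then show ?thesis by simp
  next
    case False
    then have "pdeg (pderiv f) < pdeg f" by (simp add: degree_pderiv)
    then have deriv: "sg (poly (pderiv f) v) = sg (poly (pderiv f) x)" if "x \<le> v" "v \<le> y" for v
      using less.hyps closed[OF less.prems(1)] that by blast

    show ?thesis
    proof (cases "poly (pderiv f) x \<ge> 0")
      case True
      then have "poly (pderiv f) v \<ge> 0" if "x \<le> v" "v \<le> y" for v
        using deriv[OF that] by (metis not_less sg_neg_iff)
      then have "poly f x \<le> poly f u" "poly f u \<le> poly f y"
        using less.prems by (auto intro!: real_closed_poly_mono)
      then show ?thesis using eq[OF less.prems(1)] sg_between by metis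
    next
      case False
      then have "poly (pderiv f) v \<le> 0" if "x \<le> v" "v \<le> y" for v
        using deriv[OF that] by (metis not_less sg_neg_iff less_imp_le)
      then have "poly f y \<le> poly f u" "poly f u \<le> poly f x"
        using less.prems by (auto intro!: real_closed_poly_antimono)
      then show ?thesis using eq[OF less.prems(1)] sg_between by metis
    qed
  qed
qed

text \<open>By Thom's lemma f' keeps one sign between x and y, so f is monotone; as the sign of f
  differs at the ends, f' is not 0. The sign of f' then tells which of the two signs of f belongs to
  the smaller point: the order of x and y can be read off from signs.\<close>

lemma Thom_separation:
  fixes F :: "'a::real_closed_field poly set"
  assumes closed: "\<And>f. f \<in> F \<Longrightarrow> pderiv f \<in> F"
    and eq: "\<And>f. f \<in> F \<Longrightarrow> sg (poly f x) = sg (poly f y)"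
    and f: "pderiv f \<in> F" "sg (poly f x) \<noteq> sg (poly f y)" and "x < y"
  shows "poly (pderiv f) x > 0 \<and> sg (poly f x) < sg (poly f y)
    \<or> poly (pderiv f) x < 0 \<and> sg (poly f y) < sg (poly f x)"
proof -
  have deriv: "sg (poly (pderiv f) v) = sg (poly (pderiv f) x)" if "x \<le> v" "v \<le> y" for v
    using Thom_convex[OF closed eq f(1) that] by blast
  have up: "poly f x \<le> poly f y" if "poly (pderiv f) x \<ge> 0"
    using \<open>x < y\<close> by (intro real_closed_poly_mono) (use deriv that in \<open>auto, metis less_imp_le not_less sg_neg_iff\<close>)
  have down: "poly f y \<le> poly f x" if "poly (pderiv f) x \<le> 0"
    using \<open>x < y\<close> by (intro real_closed_poly_antimono) (use deriv that in \<open>auto, metis less_imp_le not_less sg_pos_iff\<close>)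
  consider "poly (pderiv f) x > 0" | "poly (pderiv f) x < 0" | "poly (pderiv f) x = 0"
    by (metis linorder_neqE)
  then show ?thesis
  proof cases
    case 1
    then show ?thesis using up f(2) sg_mono[of "poly f x" "poly f y"] by simp
  next
    case 2
    then show ?thesis using down f(2) sg_mono[of "poly f y" "poly f x"] by simp
  next
    case 3
    then have "poly f x = poly f y" using up down by simp
    then show ?thesis using f(2) by simp
  qed
qed

section \<open>Families of polynomials with the same realized sign conditions\<close>

definition agree :: "'i set \<Rightarrow> ('i \<Rightarrow> 'a::linordered_field poly) \<Rightarrow> ('i \<Rightarrow> 'b::linordered_field poly) \<Rightarrow> 'a \<Rightarrow> 'b \<Rightarrow> bool" where
  "agree Q f g x y \<longleftrightarrow> (\<forall>i\<in>Q. sg (poly (f i) x) = sg (poly (g i) y))"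

lemma agree_swap: "agree Q f g x y \<longleftrightarrow> agree Q g f y x"
  by (auto simp: agree_def)

text \<open>The derivative has to sit at the same index in both families, so that agreement of two
  points covers their derivatives as well. The points with one given sign vector form a cell; the
  last two conditions match the cells of the two families.\<close>

locale matched_family =
  fixes Q :: "'i set" and f :: "'i \<Rightarrow> 'a::real_closed_field poly" and g :: "'i \<Rightarrow> 'b::real_closed_field poly"
  assumes fin: "finite Q"
    and closed: "i \<in> Q \<Longrightarrow> \<exists>j\<in>Q. f j = pderiv (f i) \<and> g j = pderiv (g i)"
    and zero_iff: "i \<in> Q \<Longrightarrow> f i = 0 \<longleftrightarrow> g i = 0"
    and ex_right: "\<exists>y. agree Q f g x y"
    and ex_left: "\<exists>x. agree Q f g x y"
begin

lemma swap: "matched_family Q g f"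
proof
  show "\<exists>j\<in>Q. g j = pderiv (g i) \<and> f j = pderiv (f i)" if "i \<in> Q" for i
    using closed[OF that] by blast
qed (use fin zero_iff ex_right ex_left in \<open>auto simp: agree_swap[of Q g f]\<close>)

text \<open>Let \<open>f i\<close> have least degree among the members with different signs at x and
  x'. The members of smaller degree, its derivative included, agree at x and x', so their partners
  agree at y and y'. \<open>Thom_separation\<close> then applies on both sides, and the same signs
  force the same order.\<close>

lemma order_transfer:
  assumes xy: "agree Q f g x y" and xy': "agree Q f g x' y'"
    and diff: "\<not> agree Q f f x x'" and "x < x'"
  shows "y < y'"
proof -
  obtain i0 where "i0 \<in> Q \<and> sg (poly (f i0) x) \<noteq> sg (poly (f i0) x')"
    using diff by (auto simp: agree_def)
  then obtain i where i: "i \<in> Q" "sg (poly (f i) x) \<noteq> sg (poly (f i) x')"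
    and least: "\<And>j. j \<in> Q \<Longrightarrow> sg (poly (f j) x) \<noteq> sg (poly (f j) x') \<Longrightarrow> pdeg (f i) \<le> pdeg (f j)"
    using ex_has_least_nat[of "\<lambda>i. i \<in> Q \<and> sg (poly (f i) x) \<noteq> sg (poly (f i) x')" i0 "\<lambda>i. pdeg (f i)"] by blast
  define Q' where "Q' = {j \<in> Q. pdeg (f j) < pdeg (f i)}"
  have "pdeg (f i) \<noteq> 0"
  proof
    assume "pdeg (f i) = 0"
    then obtain c where "f i = [:c:]" by (auto elim: degree_eq_zeroE)
    then show False using i(2) by simp
  qed
  then have deg: "pdeg (pderiv (f i)) < pdeg (f i)" by (simp add: degree_pderiv)
  have closed': "\<exists>k\<in>Q'. f k = pderiv (f j) \<and> g k = pderiv (g j)" if "j \<in> Q'" for j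
  proof -
    have "j \<in> Q" using that by (simp add: Q'_def)
    then obtain k where k: "k \<in> Q" "f k = pderiv (f j)" "g k = pderiv (g j)"
      using closed by blast
    moreover have "pdeg (f k) < pdeg (f i)"
      using that k(2) by (auto simp: Q'_def degree_pderiv)
    ultimately show ?thesis by (auto simp: Q'_def)
  qed
  obtain j where j: "j \<in> Q'" "f j = pderiv (f i)" "g j = pderiv (g i)"
    using closed[OF i(1)] deg by (auto simp: Q'_def)
  have eq: "sg (poly (f k) x) = sg (poly (f k) x')" if "k \<in> Q'" for k
    using least[of k] that by (auto simp: Q'_def)
  have eq': "sg (poly (g k) y') = sg (poly (g k) y)" if "k \<in> Q'" for k
    using eq[OF that] xy xy' that by (auto simp: Q'_def agree_def)
  have sgi: "sg (poly (g i) y) = sg (poly (f i) x)" "sg (poly (g i) y') = sg (poly (f i) x')"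
    using xy xy' i(1) by (auto simp: agree_def)
  have K: "poly (pderiv (f i)) x > 0 \<and> sg (poly (f i) x) < sg (poly (f i) x')
    \<or> poly (pderiv (f i)) x < 0 \<and> sg (poly (f i) x') < sg (poly (f i) x)"
  proof (rule Thom_separation[where F = "f ` Q'"])
    show "pderiv (f i) \<in> f ` Q'" using j by force
    show "\<And>h. h \<in> f ` Q' \<Longrightarrow> pderiv h \<in> f ` Q'" using closed' by force
  qed (use eq i(2) \<open>x < x'\<close> in auto)
  show ?thesis
  proof (rule ccontr)
    assume "\<not> y < y'"
    moreover have "y \<noteq> y'" using sgi i(2) by auto
    ultimately have "y' < y" by simp
    have "poly (pderiv (g i)) y' > 0 \<and> sg (poly (g i) y') < sg (poly (g i) y)
      \<or> poly (pderiv (g i)) y' < 0 \<and> sg (poly (g i) y) < sg (poly (g i) y')"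
    proof (rule Thom_separation[where F = "g ` Q'"])
      show "pderiv (g i) \<in> g ` Q'" using j by force
      show "\<And>h. h \<in> g ` Q' \<Longrightarrow> pderiv h \<in> g ` Q'" using closed' by force
    qed (use eq' i(2) sgi \<open>y' < y\<close> in auto)
    moreover have "sg (poly (pderiv (g i)) y') = sg (poly (pderiv (f i)) x)"
      using eq'[OF j(1)] xy j by (auto simp: agree_def Q'_def)
    then have "poly (pderiv (g i)) y' > 0 \<longleftrightarrow> poly (pderiv (f i)) x > 0"
      "poly (pderiv (g i)) y' < 0 \<longleftrightarrow> poly (pderiv (f i)) x < 0"
      by (metis sg_pos_iff, metis sg_neg_iff)
    ultimately show False using K sgi by auto
  qed
qed

text \<open>Here \<open>p'\<close> is the partner of \<open>p\<close> over the second field, not a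
  derivative. Around x no member has a root and p increases, but p' has too small a sign at y0. To
  the right of y0 the partner becomes positive: at the end w of the cell, by comparison with p at a
  matched root z, or far out if the cell is unbounded. The intermediate value theorem supplies the
  missing sign inside the cell.\<close>

lemma move_right:
  assumes H1: "\<And>x y. agree Q f g x y \<Longrightarrow> sg (poly (pderiv p) x) = sg (poly (pderiv p') y)"
    and H2: "\<And>x y i. agree Q f g x y \<Longrightarrow> i \<in> Q \<Longrightarrow> f i \<noteq> 0 \<Longrightarrow> poly (f i) x = 0 \<Longrightarrow> sg (poly p x) = sg (poly p' y)"
    and xy: "agree Q f g x y0"
    and no_root: "\<And>i. i \<in> Q \<Longrightarrow> f i \<noteq> 0 \<Longrightarrow> poly (f i) x \<noteq> 0"
    and incr: "poly (pderiv p) x > 0"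
    and less: "sg (poly p' y0) < sg (poly p x)"
  shows "\<exists>y. agree Q f g x y \<and> sg (poly p x) = sg (poly p' y)"
proof -
  define W where "W = {w. y0 < w \<and> (\<exists>i\<in>Q. g i \<noteq> 0 \<and> poly (g i) w = 0)}"
  have agree_y: "agree Q f g x u" if "y0 \<le> u" "\<And>w. w \<in> W \<Longrightarrow> u < w" for u
    unfolding agree_def
  proof
    fix i assume i: "i \<in> Q"
    have "sg (poly (g i) y0) = sg (poly (g i) u)"
    proof (cases "g i = 0")
      case False
      show ?thesis
      proof (rule sg_constant_if_no_root[OF that(1)])
        fix v assume v: "y0 \<le> v" "v \<le> u"
        show "poly (g i) v \<noteq> 0"
        proof (cases "v = y0")
          case True
          have "poly (f i) x \<noteq> 0" using no_root[OF i] False zero_iff[OF i] by blast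
          then show ?thesis using True xy i by (metis agree_def sg_eq_0_iff)
        next
          case False
          show ?thesis
          proof
            assume "poly (g i) v = 0"
            then have "v \<in> W" using i v False \<open>g i \<noteq> 0\<close> by (auto simp: W_def)
            then show False using that(2)[of v] v by simp
          qed
        qed
      qed
    qed simp
    then show "sg (poly (f i) x) = sg (poly (g i) u)" using xy i by (simp add: agree_def)
  qed
  have "\<exists>w>y0. poly p' w > 0 \<and> (\<forall>u. y0 \<le> u \<longrightarrow> u < w \<longrightarrow> agree Q f g x u)"
  proof (cases "W = {}")
    case True
    then have all: "agree Q f g x u" if "y0 \<le> u" for u using agree_y[OF that] by simp
    have "poly (pderiv p') u > 0" if "y0 \<le> u" for u
      using H1[OF all[OF that]] incr by (metis sg_pos_iff)
    from increasing_poly_eventually_pos[OF this] show ?thesis using all by blast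
  next
    case False
    have "finite W"
    proof (rule finite_subset)
      show "W \<subseteq> (\<Union>i\<in>{i \<in> Q. g i \<noteq> 0}. {w. poly (g i) w = 0})" by (auto simp: W_def)
      show "finite (\<Union>i\<in>{i \<in> Q. g i \<noteq> 0}. {w. poly (g i) w = 0})"
        using fin by (auto intro: poly_roots_finite)
    qed
    define w where "w = Min W"
    have "w \<in> W" unfolding w_def using \<open>finite W\<close> False by (rule Min_in)
    then obtain i where w: "y0 < w" and i: "i \<in> Q" "g i \<noteq> 0" "poly (g i) w = 0" by (auto simp: W_def)
    have all: "agree Q f g x u" if "y0 \<le> u" "u < w" for u
    proof (rule agree_y[OF that(1)])
      fix v assume "v \<in> W"
      then have "w \<le> v" unfolding w_def using \<open>finite W\<close> by simp
      then show "u < v" using that(2) by simp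
    qed
    obtain z where z: "agree Q f g z w" using ex_left by blast
    have fi: "f i \<noteq> 0" using zero_iff i by blast
    have fz: "poly (f i) z = 0" using z i by (metis agree_def sg_eq_0_iff)
    have "\<not> agree Q g g y0 w"
      using no_root[OF i(1) fi] xy i(1,3) by (metis agree_def sg_eq_0_iff)
    then have "x < z"
      using matched_family.order_transfer[OF swap, of y0 x w z] xy z w by (simp add: agree_swap[of Q g f])
    \<comment> \<open>Every u between x and z lies in the cell of x, where p increases. It is not in
      the cell of z, as \<open>f i\<close> would vanish on a whole interval. In a third cell its
      partner would lie strictly between y0 and w, hence match x after all.\<close>
    have pos: "poly (pderiv p) u > 0" if u: "x < u" "u < z" for u
    proof -
      obtain v where v: "agree Q f g u v" using ex_right by blast
      have not_z: "\<not> agree Q f f u z"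
      proof
        assume uz: "agree Q f f u z"
        have zero: "poly (f i) t = 0" if "t \<in> {u..z}" for t
        proof -
          have "sg (poly (f i) t) = sg (poly (f i) u)"
          proof (rule Thom_convex[where F = "f ` Q" and y = z])
            show "\<And>h. h \<in> f ` Q \<Longrightarrow> pderiv h \<in> f ` Q" using closed by force
          qed (use uz i that in \<open>auto simp: agree_def\<close>)
          moreover have "sg (poly (f i) u) = sg (poly (f i) z)" using uz i(1) by (simp add: agree_def)
          ultimately show ?thesis using fz by (metis sg_eq_0_iff)
        qed
        have "infinite {u..z}" using u(2) by (rule infinite_Icc)
        moreover have "finite {u..z}"
          by (rule finite_subset[OF _ poly_roots_finite[OF fi]]) (use zero in blast)
        ultimately show False by blast
      qed
      have ux: "agree Q f f x u"
      proof (rule ccontr)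
        assume not_x: "\<not> agree Q f f x u"
        have "y0 < v" using order_transfer[OF xy v not_x u(1)] .
        moreover have "v < w" using order_transfer[OF v z not_z u(2)] .
        ultimately have "agree Q f g x v" using all by simp
        then show False using not_x v by (auto simp: agree_def)
      qed
      then have "agree Q f g x v" using v by (auto simp: agree_def)
      then have "sg (poly (pderiv p) u) = sg (poly (pderiv p) x)"
        using H1 v by metis
      then show ?thesis using incr by (metis sg_pos_iff)
    qed
    have "poly p x < poly p z" using real_closed_poly_strict_mono[OF \<open>x < z\<close> pos] .
    moreover have "0 \<le> poly p x" using less by (auto simp: sg_def split: if_splits)
    ultimately have "sg (poly p z) > 0" by simp
    then have "poly p' w > 0" using H2[OF z i(1) fi fz] by simp
    then show ?thesis using w all by blast
  qed
  then obtain w where w: "y0 < w" "poly p' w > 0"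
    and all: "\<And>u. y0 \<le> u \<Longrightarrow> u < w \<Longrightarrow> agree Q f g x u" by blast
  \<comment> \<open>The value to be attained between y0 and w: 0 if p vanishes at x, otherwise some
    positive value below p'(w). In both cases it exceeds p'(y0).\<close>
  define t where "t = (if sg (poly p x) = 0 then 0 else poly p' w / 2)"
  have sgx: "sg (poly p x) = 0 \<and> poly p' y0 < 0 \<or> sg (poly p x) = 1 \<and> poly p' y0 \<le> 0"
    using less sg_cases[of "poly p x"] sg_cases[of "poly p' y0"] by (auto simp: sg_def split: if_splits)
  have t: "poly p' y0 < t" "t < poly p' w" "sg t = sg (poly p x)"
    using sgx w(2) by (auto simp: t_def sg_def)
  have "poly (p' - [:t:]) y0 * poly (p' - [:t:]) w < 0"
    using t by (simp add: mult_less_0_iff)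
  from real_closed_poly_IVT[OF w(1) this] obtain y where "y0 < y" "y < w" "poly p' y = t" by auto
  then show ?thesis using all[of y] t(3) by auto
qed

text \<open>Differentiating P(-X) produces a minus sign, so each member is taken with both signs to
  keep the family closed.\<close>

definition reflect :: "('i \<Rightarrow> 'c::linordered_field poly) \<Rightarrow> 'i \<times> bool \<Rightarrow> 'c poly" where
  "reflect h ib = (if snd ib then pcompose (h (fst ib)) [:0, -1:] else - pcompose (h (fst ib)) [:0, -1:])"

end

lemma pderiv_reflect: "pderiv (pcompose (p :: 'a::idom poly) [:0, -1:]) = - pcompose (pderiv p) [:0, -1:]"
  by (simp add: pderiv_pcompose pderiv_pCons)

lemma poly_reflect: "poly (pcompose (p :: 'a::comm_ring_1 poly) [:0, -1:]) x = poly p (- x)"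
  by (simp add: poly_pcompose)

lemma reflect_eq_0_iff: "pcompose (p :: 'a::idom poly) [:0, -1:] = 0 \<longleftrightarrow> p = 0"
  by (rule pcompose_eq_0_iff) simp

context matched_family
begin

lemma agree_reflect: "agree (Q \<times> UNIV) (reflect f) (reflect g) x y \<longleftrightarrow> agree Q f g (- x) (- y)"
  by (auto simp: agree_def reflect_def poly_reflect split: if_splits)

lemma reflected: "matched_family (Q \<times> UNIV) (reflect f) (reflect g)"
proof
  fix ib :: "'i \<times> bool" assume "ib \<in> Q \<times> UNIV"
  then have i: "fst ib \<in> Q" by auto
  then obtain j where j: "j \<in> Q" "f j = pderiv (f (fst ib))" "g j = pderiv (g (fst ib))"
    using closed by blast
  show "\<exists>jb\<in>Q \<times> UNIV. reflect f jb = pderiv (reflect f ib) \<and> reflect g jb = pderiv (reflect g ib)"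
    using j by (intro bexI[of _ "(j, \<not> snd ib)"]) (auto simp: reflect_def pderiv_minus pderiv_reflect)
  show "reflect f ib = 0 \<longleftrightarrow> reflect g ib = 0"
    using zero_iff[OF i] by (auto simp: reflect_def reflect_eq_0_iff)
next
  fix x
  obtain y where "agree Q f g (- x) y" using ex_right by blast
  then show "\<exists>y. agree (Q \<times> UNIV) (reflect f) (reflect g) x y"
    by (intro exI[of _ "- y"]) (simp add: agree_reflect)
next
  fix y
  obtain x where "agree Q f g x (- y)" using ex_left by blast
  then show "\<exists>x. agree (Q \<times> UNIV) (reflect f) (reflect g) x y"
    by (intro exI[of _ "- x"]) (simp add: agree_reflect)
qed (use fin in simp)

lemma move_left:
  assumes H1: "\<And>x y. agree Q f g x y \<Longrightarrow> sg (poly (pderiv p) x) = sg (poly (pderiv p') y)"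
    and H2: "\<And>x y i. agree Q f g x y \<Longrightarrow> i \<in> Q \<Longrightarrow> f i \<noteq> 0 \<Longrightarrow> poly (f i) x = 0 \<Longrightarrow> sg (poly p x) = sg (poly p' y)"
    and xy: "agree Q f g x y0"
    and no_root: "\<And>i. i \<in> Q \<Longrightarrow> f i \<noteq> 0 \<Longrightarrow> poly (f i) x \<noteq> 0"
    and decr: "poly (pderiv p) x < 0"
    and less: "sg (poly p' y0) < sg (poly p x)"
  shows "\<exists>y. agree Q f g x y \<and> sg (poly p x) = sg (poly p' y)"
proof -
  let ?R = "\<lambda>p. pcompose p [:0, -1:]"
  have "\<exists>y. agree (Q \<times> UNIV) (reflect f) (reflect g) (- x) y \<and> sg (poly (?R p) (- x)) = sg (poly (?R p') y)"
  proof (rule matched_family.move_right[OF reflected, where ?y0.0 = "- y0"])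
    show "sg (poly (pderiv (?R p)) x) = sg (poly (pderiv (?R p')) y)"
      if "agree (Q \<times> UNIV) (reflect f) (reflect g) x y" for x y
      using H1 that by (simp add: agree_reflect pderiv_reflect poly_reflect)
    show "sg (poly (?R p) x) = sg (poly (?R p') y)"
      if "agree (Q \<times> UNIV) (reflect f) (reflect g) x y" "ib \<in> Q \<times> UNIV" "reflect f ib \<noteq> 0" "poly (reflect f ib) x = 0"
      for x y and ib :: "'i \<times> bool"
      using H2[of "- x" "- y" "fst ib"] that
      by (auto simp: agree_reflect reflect_def poly_reflect reflect_eq_0_iff split: if_splits)
    show "agree (Q \<times> UNIV) (reflect f) (reflect g) (- x) (- y0)"
      using xy by (simp add: agree_reflect)
    show "poly (reflect f ib) (- x) \<noteq> 0" if "ib \<in> Q \<times> UNIV" "reflect f ib \<noteq> 0" for ib :: "'i \<times> bool"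
      using no_root[of "fst ib"] that by (auto simp: reflect_def poly_reflect reflect_eq_0_iff split: if_splits)
  qed (use decr less in \<open>simp_all add: pderiv_reflect poly_reflect\<close>)
  then obtain y where "agree (Q \<times> UNIV) (reflect f) (reflect g) (- x) y" "sg (poly (?R p) (- x)) = sg (poly (?R p') y)"
    by blast
  then show ?thesis by (intro exI[of _ "- y"]) (simp add: agree_reflect poly_reflect)
qed

text \<open>If a nonzero member vanishes at x, \<open>red\<close> reads the sign of p off another
  member. Otherwise the derivative of p is nonzero at x, and y0 is moved within its cell in the
  direction that corrects the sign of the partner; if that sign is too large, both polynomials are
  negated first. The converse inclusion of sign conditions follows by \<open>swap\<close>.\<close>

lemma extend:
  assumes j: "j \<in> Q" "f j = pderiv p" "g j = pderiv p'" "pderiv p \<noteq> 0"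
    and red: "\<And>i. i \<in> Q \<Longrightarrow> f i \<noteq> 0 \<Longrightarrow> \<exists>k\<in>Q. (\<forall>x. poly (f i) x = 0 \<longrightarrow> sg (poly p x) = sg (poly (f k) x))
      \<and> (\<forall>y. poly (g i) y = 0 \<longrightarrow> sg (poly p' y) = sg (poly (g k) y))"
  shows "\<exists>y. agree Q f g x y \<and> sg (poly p x) = sg (poly p' y)"
proof -
  have H1: "sg (poly (pderiv p) x) = sg (poly (pderiv p') y)" if "agree Q f g x y" for x y
    using that j by (metis agree_def)
  have H2: "sg (poly p x) = sg (poly p' y)"
    if h: "agree Q f g x y" "i \<in> Q" "f i \<noteq> 0" "poly (f i) x = 0" for x y i
  proof -
    obtain k where k: "k \<in> Q" "poly (f i) x = 0 \<longrightarrow> sg (poly p x) = sg (poly (f k) x)"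
        "poly (g i) y = 0 \<longrightarrow> sg (poly p' y) = sg (poly (g k) y)"
      using red[OF h(2,3)] by blast
    have "poly (g i) y = 0" using h by (metis agree_def sg_eq_0_iff)
    then show ?thesis using k h by (simp add: agree_def)
  qed
  obtain y0 where y0: "agree Q f g x y0" using ex_right by blast
  show ?thesis
  proof (cases "\<exists>i\<in>Q. f i \<noteq> 0 \<and> poly (f i) x = 0")
    case True
    then show ?thesis using H2[OF y0] y0 by blast
  next
    case False
    then have no_root: "\<And>i. i \<in> Q \<Longrightarrow> f i \<noteq> 0 \<Longrightarrow> poly (f i) x \<noteq> 0" by blast
    have "poly (pderiv p) x \<noteq> 0" using no_root[OF j(1)] j by simp
    note neg = move_right[of "- p" "- p'", OF _ _ y0 no_root] move_left[of "- p" "- p'", OF _ _ y0 no_root]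
    consider "sg (poly p x) = sg (poly p' y0)"
      | "poly (pderiv p) x > 0" "sg (poly p' y0) < sg (poly p x)"
      | "poly (pderiv p) x < 0" "sg (poly p' y0) < sg (poly p x)"
      | "poly (pderiv p) x > 0" "sg (poly p x) < sg (poly p' y0)"
      | "poly (pderiv p) x < 0" "sg (poly p x) < sg (poly p' y0)"
      using \<open>poly (pderiv p) x \<noteq> 0\<close> by (metis linorder_neqE)
    then show ?thesis
    proof cases
      case 1
      then show ?thesis using y0 by blast
    next
      case 2
      show ?thesis by (rule move_right[OF _ _ y0 no_root]) (use H1 H2 2 in auto)
    next
      case 3
      show ?thesis by (rule move_left[OF _ _ y0 no_root]) (use H1 H2 3 in auto)
    next
      case 4
      have "\<exists>y. agree Q f g x y \<and> sg (poly (- p) x) = sg (poly (- p') y)"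
        by (rule neg(2)) (use H1 H2 4 in \<open>auto simp: pderiv_minus\<close>)
      then show ?thesis by simp
    next
      case 5
      have "\<exists>y. agree Q f g x y \<and> sg (poly (- p) x) = sg (poly (- p') y)"
        by (rule neg(1)) (use H1 H2 5 in \<open>auto simp: pderiv_minus\<close>)
      then show ?thesis by simp
    qed
  qed
qed

end


section \<open>Field embeddings preserve signs\<close>

lemma field_embedding_0:
  assumes "field_embedding h"
  shows "h 0 = 0"
proof -
  have "h (0 + 0) = h 0 + h 0" using assms unfolding field_embedding_def by metis
  then show ?thesis by (simp only: add_0_left add_cancel_right_right)
qed

lemma field_embedding_minus:
  assumes "field_embedding h"
  shows "h (- x) = - h x"
proof -
  have "h (x + - x) = h x + h (- x)" using assms unfolding field_embedding_def by metis
  then show ?thesis using field_embedding_0[OF assms] by (simp add: add_eq_0_iff)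
qed

lemma field_embedding_nonzero:
  assumes "field_embedding h" "x \<noteq> 0"
  shows "h x \<noteq> 0"
proof
  assume "h x = 0"
  have "h (x * inverse x) = h x * h (inverse x)" using assms unfolding field_embedding_def by metis
  then show False using assms \<open>h x = 0\<close> by (simp add: field_embedding_def)
qed

lemma field_embedding_pos:
  fixes h :: "'r::real_closed_field \<Rightarrow> 's::linordered_field"
  assumes "field_embedding h" "0 < x"
  shows "0 < h x"
proof -
  obtain y where y: "y * y = x" using nonneg_imp_square assms(2) by (metis less_imp_le)
  then have "h x = h y * h y" using assms unfolding field_embedding_def by metis
  moreover have "y \<noteq> 0" using y assms(2) by auto
  then have "h y \<noteq> 0" by (rule field_embedding_nonzero[OF assms(1)])
  ultimately show ?thesis by (auto simp: zero_less_mult_iff neq_iff)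
qed

lemma field_embedding_sg:
  fixes h :: "'r::real_closed_field \<Rightarrow> 's::linordered_field"
  assumes "field_embedding h"
  shows "sg (h x) = sg x"
proof -
  consider "x > 0" | "x = 0" | "- x > 0" by fastforce
  then show ?thesis
  proof cases
    case 3
    then have "0 < h (- x)" by (rule field_embedding_pos[OF assms])
    then show ?thesis using 3 by (simp add: sg_def field_embedding_minus[OF assms])
  qed (use field_embedding_pos[OF assms] field_embedding_0[OF assms] in \<open>auto simp: sg_def\<close>)
qed

lemma field_embedding_id: "field_embedding id"
  by (simp add: field_embedding_def)

text \<open>With \<open>id\<close> or the embedding as \<open>h\<close>, one term over R is
  evaluated over R or over S.\<close>

definition ev :: "('r \<Rightarrow> 'k::linordered_field) \<Rightarrow> (nat \<Rightarrow> 'k) \<Rightarrow> 'r trm \<Rightarrow> 'k" where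
  "ev h e t = eval_trm e (map_trm h t)"

lemma ev_simps [simp]:
  "ev h e (Var i) = e i" "ev h e (Const c) = h c"
  "ev h e (Add s t) = ev h e s + ev h e t" "ev h e (Mult s t) = ev h e s * ev h e t"
  by (simp_all add: ev_def)

section \<open>Polynomials with terms as coefficients\<close>

text \<open>Constant coefficient first. The last coefficient may evaluate to 0, so the length only
  bounds the degree.\<close>

primrec evp :: "('r \<Rightarrow> 'k::linordered_field) \<Rightarrow> (nat \<Rightarrow> 'k) \<Rightarrow> 'r trm list \<Rightarrow> 'k poly" where
  "evp h e [] = 0"
| "evp h e (c # cs) = pCons (ev h e c) (evp h e cs)"

fun padd :: "'r trm list \<Rightarrow> 'r trm list \<Rightarrow> 'r trm list" where
  "padd [] bs = bs"
| "padd as [] = as"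
| "padd (a # as) (b # bs) = Add a b # padd as bs"

definition psmul :: "'r trm \<Rightarrow> 'r trm list \<Rightarrow> 'r trm list" where
  "psmul t = map (Mult t)"

primrec pmul :: "'r::zero trm list \<Rightarrow> 'r trm list \<Rightarrow> 'r trm list" where
  "pmul [] bs = []"
| "pmul (a # as) bs = padd (psmul a bs) (Const 0 # pmul as bs)"

text \<open>A term as a polynomial in the variable 0, whose coefficients have the other variables shifted down.\<close>

primrec poly_of_trm :: "'r::{zero,one} trm \<Rightarrow> 'r trm list" where
  "poly_of_trm (Var i) = (case i of 0 \<Rightarrow> [Const 0, Const 1] | Suc j \<Rightarrow> [Var j])"
| "poly_of_trm (Const c) = [Const c]"
| "poly_of_trm (Add s t) = padd (poly_of_trm s) (poly_of_trm t)"
| "poly_of_trm (Mult s t) = pmul (poly_of_trm s) (poly_of_trm t)"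

fun pder :: "'r::zero trm list \<Rightarrow> 'r trm list" where
  "pder [] = []"
| "pder [c] = []"
| "pder (c # d # cs) = padd (d # cs) (Const 0 # pder (d # cs))"

text \<open>The last coefficients of the two summands cancel identically, hence
  \<open>butlast\<close>. The multiplier of p is the square of the leading coefficient of q rather
  than the coefficient itself, so that the sign of p at a root of q survives wherever this
  coefficient is not 0.\<close>

definition pstep :: "'r::{zero,one,uminus} trm list \<Rightarrow> 'r trm list \<Rightarrow> 'r trm list" where
  "pstep p q = butlast (padd (psmul (Mult (last q) (last q)) p)
     (psmul (Mult (Const (-1)) (Mult (last p) (last q))) (replicate (length p - length q) (Const 0) @ q)))"

lemma length_padd [simp]: "length (padd as bs) = max (length as) (length bs)"
  by (induction as bs rule: padd.induct) auto

lemma length_psmul [simp]: "length (psmul t as) = length as"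
  by (simp add: psmul_def)

lemma length_pder [simp]: "length (pder as) = length as - 1"
  by (induction as rule: pder.induct) auto

lemma length_pstep: "length q \<le> length p \<Longrightarrow> length (pstep p q) = length p - 1"
  by (simp add: pstep_def)

function prem :: "'r::{zero,one,uminus} trm list \<Rightarrow> 'r trm list \<Rightarrow> 'r trm list" where
  "prem p q = (if q = [] \<or> length p < length q then p else prem (pstep p q) q)"
  by auto
termination
proof (relation "Wellfounded.measure (\<lambda>(p, q). length p)")
  fix p q :: "'r::{zero,one,uminus} trm list"
  assume "\<not> (q = [] \<or> length p < length q)"
  then have "length q > 0" and len: "length q \<le> length p" by auto
  then have "length p - 1 < length p" by linarith
  then show "((pstep p q, q), p, q) \<in> Wellfounded.measure (\<lambda>(p, q). length p)"
    using length_pstep[OF len] by simp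
qed simp

declare prem.simps [simp del]

lemma length_prem: "q \<noteq> [] \<Longrightarrow> length (prem p q) < length q"
proof (induction p q rule: prem.induct)
  case (1 p q)
  then show ?case by (subst prem.simps) auto
qed

lemma evp_padd [simp]: "evp h e (padd as bs) = evp h e as + evp h e bs"
  by (induction as bs rule: padd.induct) auto

lemma evp_psmul [simp]: "evp h e (psmul t as) = Polynomial.smult (ev h e t) (evp h e as)"
  by (induction as) (simp_all add: psmul_def)

lemma evp_eq_0_iff: "evp h e as = 0 \<longleftrightarrow> (\<forall>c\<in>set as. ev h e c = 0)"
  by (induction as) auto

lemma evp_append_zero: "ev h e c = 0 \<Longrightarrow> evp h e (as @ [c]) = evp h e as"
  by (induction as) auto

lemma evp_butlast: "as \<noteq> [] \<Longrightarrow> ev h e (last as) = 0 \<Longrightarrow> evp h e (butlast as) = evp h e as"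
  by (metis append_butlast_last_id evp_append_zero)

lemma degree_evp: "as \<noteq> [] \<Longrightarrow> ev h e (last as) \<noteq> 0 \<Longrightarrow> pdeg (evp h e as) = length as - 1"
proof (induction as)
  case (Cons a as)
  show ?case
  proof (cases "as = []")
    case False
    then have "evp h e as \<noteq> 0"
      using Cons.prems evp_eq_0_iff[of h e as] last_in_set[of as] by auto
    then show ?thesis using Cons False by (simp add: Suc_diff_Suc)
  qed simp
qed simp


lemma last_padd: "length as = length bs \<Longrightarrow> as \<noteq> [] \<Longrightarrow> last (padd as bs) = Add (last as) (last bs)"
proof (induction as bs rule: list_induct2)
  case (Cons a as b bs)
  show ?case
  proof (cases "as = []")
    case False
    then have "padd as bs \<noteq> []" using Cons.hyps by (metis length_0_conv length_padd max.idem)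
    then show ?thesis using Cons False by auto
  qed (use Cons in auto)
qed simp

section \<open>Meaning of the symbolic operations\<close>

context
  fixes h :: "'r::field \<Rightarrow> 'k::linordered_field"
  assumes h: "field_embedding h"
begin

lemma evp_pmul: "evp h e (pmul as bs) = evp h e as * evp h e bs"
  by (induction as) (simp_all add: field_embedding_0[OF h])

lemma poly_evp_poly_of_trm: "poly (evp h e (poly_of_trm t)) x = ev h (case_nat x e) t"
proof (induction t)
  case (Var i)
  then show ?case
    using h by (cases i) (simp_all add: field_embedding_0[OF h] field_embedding_def)
qed (simp_all add: evp_pmul)

lemma evp_pder: "evp h e (pder as) = pderiv (evp h e as)"
  by (induction as rule: pder.induct) (simp_all add: pderiv_pCons field_embedding_0[OF h])

lemma poly_evp_pstep:
  assumes len: "q \<noteq> []" "length q \<le> length p" and root: "poly (evp h e q) x = 0"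
  shows "poly (evp h e (pstep p q)) x = ev h e (last q) * ev h e (last q) * poly (evp h e p) x"
proof -
  define A where "A = psmul (Mult (last q) (last q)) p"
  define r where "r = replicate (length p - length q) (Const 0) @ q"
  define B where "B = psmul (Mult (Const (-1)) (Mult (last p) (last q))) r"
  have "p \<noteq> []" "r \<noteq> []" "length r = length p" using len by (auto simp: r_def)
  then have AB: "length A = length B" "A \<noteq> []" "B \<noteq> []"
    unfolding A_def B_def by (simp_all add: psmul_def)
  have lastA: "last A = Mult (Mult (last q) (last q)) (last p)"
    using \<open>p \<noteq> []\<close> by (simp add: A_def psmul_def last_map)
  have lastB: "last B = Mult (Mult (Const (-1)) (Mult (last p) (last q))) (last q)"
    using \<open>r \<noteq> []\<close> len by (simp add: B_def psmul_def last_map r_def)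
  have one: "h (-1) = -1" using h field_embedding_minus[OF h, of 1] by (simp add: field_embedding_def)
  have "padd A B \<noteq> []" using AB by (metis length_0_conv length_padd max.idem)
  moreover have "ev h e (last (padd A B)) = 0"
    using AB by (simp add: last_padd lastA lastB one algebra_simps)
  ultimately have "evp h e (pstep p q) = evp h e (padd A B)"
    unfolding pstep_def A_def[symmetric] r_def[symmetric] B_def[symmetric] by (rule evp_butlast)
  moreover have "poly (evp h e (replicate k (Const 0) @ q)) x = 0" for k
    using root by (induction k) (simp_all add: field_embedding_0[OF h])
  then have "poly (evp h e r) x = 0" by (simp add: r_def)
  ultimately show ?thesis by (simp add: A_def B_def)
qed

lemma sg_poly_evp_prem:
  assumes "q \<noteq> []" "ev h e (last q) \<noteq> 0" "poly (evp h e q) x = 0"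
  shows "sg (poly (evp h e (prem p q)) x) = sg (poly (evp h e p) x)"
  using assms
proof (induction p q rule: prem.induct)
  case (1 p q)
  show ?case
  proof (cases "length p < length q")
    case False
    have "ev h e (last q) * ev h e (last q) > 0"
      using "1.prems" by (auto simp: zero_less_mult_iff neq_iff)
    then show ?thesis
      using 1 False poly_evp_pstep[of q p e x] by (subst prem.simps) (simp add: sg_mult_pos not_less)
  qed (subst prem.simps, simp)
qed

end

text \<open>\<open>butlast q\<close> stands in for q at those assignments where the last coefficient
  evaluates to 0; the remainders give signs at the roots of q. At \<open>l = 0\<close> only the
  empty list is exempt.\<close>

definition pclosed :: "nat \<Rightarrow> 'r::{zero,one,uminus} trm list set \<Rightarrow> bool" where
  "pclosed l P \<longleftrightarrow> (\<forall>q\<in>P. l < length q \<longrightarrow> butlast q \<in> P \<and> pder q \<in> P \<and>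
     (\<forall>p\<in>P. length q \<le> length p \<longrightarrow> prem p q \<in> P))"

text \<open>
  Truncation, differentiation and pseudo-remainder by \<open>q\<close> only produce polynomials shorter
  than \<open>q\<close>, so that a finite family can be closed by descending on the length.
\<close>

lemma pclosed_closure_exists:
  fixes F :: "'r::{zero,one,uminus} trm list set"
  assumes "finite F"
  shows "\<exists>P. finite P \<and> F \<subseteq> P \<and> pclosed 0 P"
proof -
  obtain N where N: "\<And>p. p \<in> F \<Longrightarrow> length p \<le> N"
    using assms by (metis Max_ge finite_imageI imageI)
  have "\<exists>P. finite P \<and> F \<subseteq> P \<and> pclosed (N - k) P" for k
  proof (induction k)
    case 0
    show ?case using assms N by (intro exI[of _ F]) (auto simp: pclosed_def dest: leD)
  next
    case (Suc k)
    then obtain P where P: "finite P" "F \<subseteq> P" "pclosed (N - k) P" by blast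
    show ?case
    proof (cases "N - k = 0")
      case True
      then show ?thesis using P by (intro exI[of _ P]) simp
    next
      case False
      define l where "l = N - k"
      define L where "L = {q \<in> P. length q = l}"
      define new where "new = butlast ` L \<union> pder ` L \<union> (\<lambda>(p, q). prem p q) ` (P \<times> L)"
      have "l > 0" using False by (simp add: l_def)
      \<comment> \<open>Nothing of length \<open>l\<close> or more is added, so the conditions
        already established for longer divisors range over the same dividends as before.\<close>
      have short: "length p < l" if "p \<in> new" for p
        using that \<open>l > 0\<close> by (auto simp: new_def L_def intro: length_prem)
      have "pclosed (N - Suc k) (P \<union> new)"
        unfolding pclosed_def
      proof (intro ballI impI)
        fix q assume q: "q \<in> P \<union> new" "N - Suc k < length q"
        then have len: "l \<le> length q" by (simp add: l_def)
        then have qP: "q \<in> P" using q short[of q] by auto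
        show "butlast q \<in> P \<union> new \<and> pder q \<in> P \<union> new \<and>
          (\<forall>p\<in>P \<union> new. length q \<le> length p \<longrightarrow> prem p q \<in> P \<union> new)"
        proof (cases "length q = l")
          case True
          then have "q \<in> L" using qP by (simp add: L_def)
          moreover have "p \<in> P" if "p \<in> P \<union> new" "length q \<le> length p" for p
            using that short[of p] True by auto
          moreover have "prem p q \<in> new" if "p \<in> P" for p
          proof -
            have "(p, q) \<in> P \<times> L" using that \<open>q \<in> L\<close> by blast
            then have "(\<lambda>(p, q). prem p q) (p, q) \<in> new" unfolding new_def by (intro UnI2 imageI)
            then show ?thesis by simp
          qed
          moreover have "butlast q \<in> new" "pder q \<in> new"
            unfolding new_def using \<open>q \<in> L\<close> by blast+
          ultimately show ?thesis by (meson UnI2)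
        next
          case False
          then have "l < length q" using len by simp
          moreover have "p \<in> P" if "p \<in> P \<union> new" "length q \<le> length p" for p
            using that short[of p] calculation by auto
          ultimately show ?thesis using P(3) qP unfolding pclosed_def l_def by (meson UnI1)
        qed
      qed
      moreover have "finite (P \<union> new)" using P(1) by (simp add: new_def L_def)
      ultimately show ?thesis using P(2) by blast
    qed
  qed
  from this[of N] show ?thesis by simp
qed

text \<open>The members are inserted by nondecreasing length, keeping the realized sign conditions
  equal on both sides. If the leading coefficient of the new member evaluates to 0, its truncation
  is already present; if the member is a constant, its sign is given; otherwise its derivative and
  the remainders by the earlier members are shorter, hence present, and \<open>extend\<close>
  applies.\<close>

lemma signs_of_coefficients_determine_cells:
  fixes h :: "'r::real_closed_field \<Rightarrow> 'k::real_closed_field" and h' :: "'r \<Rightarrow> 'l::real_closed_field"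
  assumes h: "field_embedding h" "field_embedding h'"
    and P: "finite P" "pclosed 0 P"
    and sg: "\<And>p c. p \<in> P \<Longrightarrow> c \<in> set p \<Longrightarrow> sg (ev h e c) = sg (ev h' e' c)"
  shows "\<exists>y. agree P (evp h e) (evp h' e') x y"
proof -
  have zero: "ev h e c = 0 \<longleftrightarrow> ev h' e' c = 0" if "p \<in> P" "c \<in> set p" for p c
    using sg[OF that] by (metis sg_eq_0_iff)
  \<comment> \<open>The invariant of the insertion: everything in P strictly shorter than some
    inserted member has been inserted before.\<close>
  define Down where "Down S \<longleftrightarrow> S \<subseteq> P \<and> (\<forall>q\<in>S. \<forall>p\<in>P. length p < length q \<longrightarrow> p \<in> S)" for S
  have "Down P \<longrightarrow> (\<forall>x. \<exists>y. agree P (evp h e) (evp h' e') x y) \<and> (\<forall>y. \<exists>x. agree P (evp h e) (evp h' e') x y)"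
    using P(1)
  proof (induction P rule: finite_ranking_induct[where f = length])
    case empty
    then show ?case by (simp add: agree_def)
  next
    case (insert cs S)
    show ?case
    proof (cases "cs \<in> S")
      case True
      then show ?thesis using insert.IH by (simp add: insert_absorb)
    next
      case new: False
      show ?thesis
      proof
        assume down: "Down (insert cs S)"
        have csP: "cs \<in> P" and SP: "S \<subseteq> P" using down by (auto simp: Down_def)
        have S: "p \<in> S" if "p \<in> P" "length p < length cs" for p
          using down that by (auto simp: Down_def)
        have "Down S" unfolding Down_def
        proof (intro conjI SP ballI impI)
          fix q p assume "q \<in> S" "p \<in> P" "length p < length q"
          then have "length p < length cs" using insert.hyps(2) by (meson less_le_trans)
          then show "p \<in> S" using S \<open>p \<in> P\<close> by blast
        qed
        then have IH: "\<And>x. \<exists>y. agree S (evp h e) (evp h' e') x y" "\<And>y. \<exists>x. agree S (evp h e) (evp h' e') x y"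
          using insert.IH by auto
        have ops: "butlast q \<in> P" "pder q \<in> P" "p \<in> P \<Longrightarrow> length q \<le> length p \<Longrightarrow> prem p q \<in> P"
          if "q \<in> P" "q \<noteq> []" for p q
          using P(2) that by (auto simp: pclosed_def)
        interpret matched_family S "evp h e" "evp h' e'"
        proof
          fix q assume q: "q \<in> S"
          show "\<exists>j\<in>S. evp h e j = pderiv (evp h e q) \<and> evp h' e' j = pderiv (evp h' e' q)"
          proof (cases "q = []")
            case False
            have "length (pder q) < length cs"
              using insert.hyps(2)[OF q] False by (cases q) auto
            then have "pder q \<in> S" using S ops(2) q SP False by blast
            then show ?thesis using evp_pder[OF h(1)] evp_pder[OF h(2)] by blast
          qed (use q in force)
          show "evp h e q = 0 \<longleftrightarrow> evp h' e' q = 0"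
            using zero q SP by (auto simp: evp_eq_0_iff)
        qed (use insert.hyps(1) IH in auto)
        have ext: "(\<exists>y. agree S (evp h e) (evp h' e') x y \<and> sg (poly (evp h e cs) x) = sg (poly (evp h' e' cs) y))
          \<and> (\<exists>y. agree S (evp h' e') (evp h e) x' y \<and> sg (poly (evp h' e' cs) x') = sg (poly (evp h e cs) y))" for x x'
        proof -
          \<comment> \<open>The easy cases: the signs of S already determine that of
            \<open>cs\<close>, so any matching point will do.\<close>
          have via_const: ?thesis
            if "\<And>x y. agree S (evp h e) (evp h' e') x y \<Longrightarrow> sg (poly (evp h e cs) x) = sg (poly (evp h' e' cs) y)"
            using that ex_right[of x] ex_left[of x'] unfolding agree_swap[of S "evp h' e'"] by metis
          show ?thesis
          proof (cases "cs = []")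
            case True
            then show ?thesis by (intro via_const) simp
          next
            case nonempty: False
            have last: "last cs \<in> set cs" using nonempty by simp
            show ?thesis
            proof (cases "ev h e (last cs) = 0")
              case True
              have "butlast cs \<in> S" using S ops(1)[OF csP nonempty] nonempty by simp
              moreover have "ev h' e' (last cs) = 0" using True zero[OF csP last] by simp
              ultimately show ?thesis
                using True nonempty by (intro via_const) (metis agree_def evp_butlast)
            next
              case lead: False
              then have lead': "ev h' e' (last cs) \<noteq> 0" using zero[OF csP last] by simp
              show ?thesis
              proof (cases "length cs = 1")
                case True
                then obtain c where "cs = [c]" by (auto simp: length_Suc_conv)
                then show ?thesis using sg[OF csP] by (intro via_const) simp
              next
                case False
                then have len: "length cs \<ge> 2" using nonempty by (cases cs) (auto simp: Suc_le_eq)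
                have dS: "pder cs \<in> S" using S ops(2)[OF csP nonempty] len by simp
                have "pdeg (evp h e cs) \<noteq> 0" "pdeg (evp h' e' cs) \<noteq> 0"
                  using degree_evp[OF nonempty lead] degree_evp[OF nonempty lead'] len by auto
                then have nz: "pderiv (evp h e cs) \<noteq> 0" "pderiv (evp h' e' cs) \<noteq> 0"
                  by (auto simp: pderiv_eq_0_iff)
                \<comment> \<open>At a root of q the member to look at is the remainder of
                  \<open>cs\<close> by q. This requires a nonzero leading coefficient of q, so q is
                  truncated until it has one.\<close>
                have red: "\<exists>k\<in>S. (\<forall>x. poly (evp h e q) x = 0 \<longrightarrow> sg (poly (evp h e cs) x) = sg (poly (evp h e k) x))
                  \<and> (\<forall>y. poly (evp h' e' q) y = 0 \<longrightarrow> sg (poly (evp h' e' cs) y) = sg (poly (evp h' e' k) y))"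
                  if "q \<in> S" "evp h e q \<noteq> 0" for q
                  using that
                proof (induction "length q" arbitrary: q rule: less_induct)
                  case less
                  have qP: "q \<in> P" "q \<noteq> []" using less.prems SP by auto
                  have lq: "length q \<le> length cs" using insert.hyps(2) less.prems(1) by blast
                  show ?case
                  proof (cases "ev h e (last q) = 0")
                    case True
                    then have "ev h' e' (last q) = 0" using zero[OF qP(1)] qP(2) by simp
                    then have eq: "evp h e (butlast q) = evp h e q" "evp h' e' (butlast q) = evp h' e' q"
                      using True qP(2) by (simp_all add: evp_butlast)
                    have short: "length (butlast q) < length q" using qP(2) by simp
                    then have "butlast q \<in> S" using S ops(1)[OF qP] lq by simp
                    from less.hyps[OF short this] less.prems(2) show ?thesis unfolding eq by blast
                  next
                    case False
                    then have "ev h' e' (last q) \<noteq> 0" using zero[OF qP(1)] qP(2) by simp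
                    moreover have "length (prem cs q) < length cs"
                      using length_prem[OF qP(2), of cs] lq by simp
                    then have "prem cs q \<in> S" using S ops(3)[OF qP csP lq] by blast
                    ultimately show ?thesis
                      using sg_poly_evp_prem[OF h(1) qP(2) False] sg_poly_evp_prem[OF h(2) qP(2)]
                      by (intro bexI[of _ "prem cs q"]) auto
                  qed
                qed
                have "\<exists>y. agree S (evp h e) (evp h' e') x y \<and> sg (poly (evp h e cs) x) = sg (poly (evp h' e' cs) y)"
                  using red by (intro extend[OF dS]) (use nz in \<open>simp_all add: evp_pder[OF h(1)] evp_pder[OF h(2)]\<close>)
                moreover have "\<exists>y. agree S (evp h' e') (evp h e) x' y \<and> sg (poly (evp h' e' cs) x') = sg (poly (evp h e cs) y)"
                proof (rule matched_family.extend[OF swap dS])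
                  fix q assume q: "q \<in> S" "evp h' e' q \<noteq> 0"
                  then have "evp h e q \<noteq> 0" using zero_iff by blast
                  from red[OF q(1) this] show "\<exists>k\<in>S. (\<forall>x. poly (evp h' e' q) x = 0 \<longrightarrow> sg (poly (evp h' e' cs) x) = sg (poly (evp h' e' k) x))
                  \<and> (\<forall>y. poly (evp h e q) y = 0 \<longrightarrow> sg (poly (evp h e cs) y) = sg (poly (evp h e k) y))" by blast
                qed (use nz in \<open>simp_all add: evp_pder[OF h(1)] evp_pder[OF h(2)]\<close>)
                ultimately show ?thesis by blast
              qed
            qed
          qed
        qed
        show "(\<forall>x. \<exists>y. agree (insert cs S) (evp h e) (evp h' e') x y) \<and> (\<forall>y. \<exists>x. agree (insert cs S) (evp h e) (evp h' e') x y)"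
        proof (intro conjI allI)
          fix x
          obtain y where "agree S (evp h e) (evp h' e') x y" "sg (poly (evp h e cs) x) = sg (poly (evp h' e' cs) y)"
            using ext by blast
          then have "agree (insert cs S) (evp h e) (evp h' e') x y" by (simp add: agree_def)
          then show "\<exists>y. agree (insert cs S) (evp h e) (evp h' e') x y" by blast
        next
          fix y
          obtain x where "agree S (evp h' e') (evp h e) y x" "sg (poly (evp h' e' cs) y) = sg (poly (evp h e cs) x)"
            using ext by blast
          then have "agree (insert cs S) (evp h e) (evp h' e') x y" by (simp add: agree_def)
          then show "\<exists>x. agree (insert cs S) (evp h e) (evp h' e') x y" by blast
        qed
      qed
    qed
  qed
  then show ?thesis by (simp add: Down_def)
qed


section \<open>Auxiliary facts on signs and assignments\<close>

lemma sg_eq_iffs: "sg x = 1 \<longleftrightarrow> 0 < x" "sg x = -1 \<longleftrightarrow> x < 0"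
  by (auto simp: sg_def)

lemma sg_range: "sg x \<in> {-1, 0, 1}"
  by (simp add: sg_def)

text \<open>Lets the bound variable 0 stand for variable j, so that a de Bruijn quantifier becomes a
  quantifier over the value at j.\<close>

lemma rename_upd: "(\<lambda>i. case_nat x e (if i = j then 0 else Suc i)) = e(j := x)"
  by auto

lemma ex_agree_off_insert:
  "(\<exists>e'. (\<forall>i. i \<notin> insert j J \<longrightarrow> e' i = e i) \<and> R e')
    \<longleftrightarrow> (\<exists>x. \<exists>e'. (\<forall>i. i \<notin> J \<longrightarrow> e' i = (e(j := x)) i) \<and> R e')"
proof
  assume "\<exists>e'. (\<forall>i. i \<notin> insert j J \<longrightarrow> e' i = e i) \<and> R e'"
  then obtain e' where "\<forall>i. i \<notin> insert j J \<longrightarrow> e' i = e i" "R e'" by blast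
  then show "\<exists>x. \<exists>e'. (\<forall>i. i \<notin> J \<longrightarrow> e' i = (e(j := x)) i) \<and> R e'"
    by (intro exI[of _ "e' j"] exI[of _ e']) auto
next
  assume "\<exists>x. \<exists>e'. (\<forall>i. i \<notin> J \<longrightarrow> e' i = (e(j := x)) i) \<and> R e'"
  then obtain x e' where e': "\<forall>i. i \<notin> J \<longrightarrow> e' i = (e(j := x)) i" "R e'" by blast
  then have "\<forall>i. i \<notin> insert j J \<longrightarrow> e' i = e i" by auto
  then show "\<exists>e'. (\<forall>i. i \<notin> insert j J \<longrightarrow> e' i = e i) \<and> R e'" using e'(2) by blast
qed

section \<open>Substitution in quantifier-free formulas\<close>

primrec subst_trm :: "(nat \<Rightarrow> 'a trm) \<Rightarrow> 'a trm \<Rightarrow> 'a trm" where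
  "subst_trm \<tau> (Var i) = \<tau> i"
| "subst_trm \<tau> (Const c) = Const c"
| "subst_trm \<tau> (Add s t) = Add (subst_trm \<tau> s) (subst_trm \<tau> t)"
| "subst_trm \<tau> (Mult s t) = Mult (subst_trm \<tau> s) (subst_trm \<tau> t)"

text \<open>Only meant for quantifier-free formulas: quantified subformulas are left unchanged.\<close>

primrec subst_fm :: "(nat \<Rightarrow> 'a trm) \<Rightarrow> 'a fm \<Rightarrow> 'a fm" where
  "subst_fm \<tau> (Equal s t) = Equal (subst_trm \<tau> s) (subst_trm \<tau> t)"
| "subst_fm \<tau> (Less s t) = Less (subst_trm \<tau> s) (subst_trm \<tau> t)"
| "subst_fm \<tau> (Neg p) = Neg (subst_fm \<tau> p)"
| "subst_fm \<tau> (Conj p q) = Conj (subst_fm \<tau> p) (subst_fm \<tau> q)"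
| "subst_fm \<tau> (Exists p) = Exists p"

lemma eval_subst_trm: "eval_trm e (subst_trm \<tau> t) = eval_trm (\<lambda>i. eval_trm e (\<tau> i)) t"
  by (induction t) simp_all

lemma sat_subst_fm: "quantifier_free q \<Longrightarrow> sat e (subst_fm \<tau> q) = sat (\<lambda>i. eval_trm e (\<tau> i)) q"
  by (induction q) (simp_all add: eval_subst_trm)

lemma map_subst_trm: "map_trm h (subst_trm \<tau> t) = subst_trm (\<lambda>i. map_trm h (\<tau> i)) (map_trm h t)"
  by (induction t) simp_all

lemma map_subst_fm: "map_fm h (subst_fm \<tau> q) = subst_fm (\<lambda>i. map_trm h (\<tau> i)) (map_fm h q)" if "quantifier_free q"
  using that by (induction q) (simp_all add: map_subst_trm)

lemma quantifier_free_subst_fm [simp]: "quantifier_free (subst_fm \<tau> q) = quantifier_free q"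
  by (induction q) simp_all

lemma quantifier_free_map_fm [simp]: "quantifier_free (map_fm h q) = quantifier_free q"
  by (induction q) simp_all

lemma trm_in_subst: "(\<And>i. trm_in n (\<tau> i)) \<Longrightarrow> trm_in n (subst_trm \<tau> t)"
  by (induction t) simp_all

lemma fm_in_subst: "quantifier_free q \<Longrightarrow> (\<And>i. trm_in n (\<tau> i)) \<Longrightarrow> fm_in n (subst_fm \<tau> q)"
  by (induction q) (simp_all add: trm_in_subst)

lemma trm_in_map [simp]: "trm_in n (map_trm h t) = trm_in n t"
  by (induction t) simp_all

lemma fm_in_map [simp]: "fm_in n (map_fm h q) = fm_in n q"
  by (induction q arbitrary: n) simp_all

lemma trm_in_mono: "trm_in m t \<Longrightarrow> m \<le> n \<Longrightarrow> trm_in n t"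
  by (induction t) auto

lemma fm_in_mono: "fm_in m q \<Longrightarrow> m \<le> n \<Longrightarrow> fm_in n q"
proof (induction q arbitrary: m n)
  case (Neg p)
  then show ?case using Neg.IH[of m n] by simp
next
  case (Conj p q)
  then show ?case using Conj.IH(1)[of m n] Conj.IH(2)[of m n] by simp
next
  case (Exists q)
  then show ?case using Exists.IH[of "Suc m" "Suc n"] by simp
qed (auto intro: trm_in_mono)

lemma eval_trm_cong: "trm_in n t \<Longrightarrow> (\<And>i. i < n \<Longrightarrow> e i = e' i) \<Longrightarrow> eval_trm e t = eval_trm e' t"
  by (induction t) auto

lemma sat_cong: "fm_in n q \<Longrightarrow> (\<And>i. i < n \<Longrightarrow> e i = e' i) \<Longrightarrow> sat e q = sat e' q"
proof (induction q arbitrary: n e e')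
  case (Equal s t)
  then show ?case using eval_trm_cong[of n s e e'] eval_trm_cong[of n t e e'] by simp
next
  case (Less s t)
  then show ?case using eval_trm_cong[of n s e e'] eval_trm_cong[of n t e e'] by simp
next
  case (Neg p)
  have "sat e p = sat e' p" by (rule Neg.IH[of n]) (use Neg.prems in auto)
  then show ?case by simp
next
  case (Conj p q)
  have "sat e p = sat e' p" by (rule Conj.IH(1)[of n]) (use Conj.prems in auto)
  moreover have "sat e q = sat e' q" by (rule Conj.IH(2)[of n]) (use Conj.prems in auto)
  ultimately show ?case by simp
next
  case (Exists q)
  have "sat (case_nat x e) q = sat (case_nat x e') q" for x
    using Exists.prems by (intro Exists.IH[of "Suc n"]) (auto split: nat.split)
  then show ?case by simp
qed

lemma trm_in_bound: "\<exists>n. trm_in n t"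
proof (induction t)
  case (Var i)
  show ?case by (intro exI[of _ "Suc i"]) simp
next
  case (Add s t)
  then show ?case by (metis max.cobounded1 max.cobounded2 trm_in.simps(3) trm_in_mono)
next
  case (Mult s t)
  then show ?case by (metis max.cobounded1 max.cobounded2 trm_in.simps(4) trm_in_mono)
qed simp

lemma fm_in_bound: "\<exists>n. fm_in n q"
proof (induction q)
  case (Equal s t)
  then show ?case using trm_in_bound by (metis max.cobounded1 max.cobounded2 fm_in.simps(1) trm_in_mono)
next
  case (Less s t)
  then show ?case using trm_in_bound by (metis max.cobounded1 max.cobounded2 fm_in.simps(2) trm_in_mono)
next
  case (Conj p q)
  then show ?case by (metis max.cobounded1 max.cobounded2 fm_in.simps(4) fm_in_mono)
next
  case (Exists q)
  then obtain n where "fm_in n q" by blast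
  then show ?case by (intro exI[of _ n]) (simp add: fm_in_mono)
qed simp

section \<open>Quantifier elimination\<close>

primrec differences :: "'r::{one,uminus} fm \<Rightarrow> 'r trm set" where
  "differences (Equal s t) = {Add s (Mult (Const (-1)) t)}"
| "differences (Less s t) = {Add s (Mult (Const (-1)) t)}"
| "differences (Neg p) = differences p"
| "differences (Conj p q) = differences p \<union> differences q"
| "differences (Exists p) = {}"

lemma finite_differences: "finite (differences q)"
  by (induction q) simp_all

lemma sat_determined_by_signs:
  fixes h :: "'r::field \<Rightarrow> 'k::linordered_field" and h' :: "'r \<Rightarrow> 'l::linordered_field"
  assumes h: "field_embedding h" "field_embedding h'"
    and "quantifier_free q" "\<And>t. t \<in> differences q \<Longrightarrow> sg (ev h e t) = sg (ev h' e' t)"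
  shows "sat e (map_fm h q) = sat e' (map_fm h' q)"
proof -
  have one: "h (-1) = -1" "h' (-1) = -1"
    using h field_embedding_minus[of h 1] field_embedding_minus[of h' 1] by (auto simp: field_embedding_def)
  have eq: "a = b \<longleftrightarrow> a' = b'" "a < b \<longleftrightarrow> a' < b'" if "sg (a - b) = sg (a' - b')" for a b :: 'k and a' b' :: 'l
    using that sg_eq_0_iff[of "a - b"] sg_eq_0_iff[of "a' - b'"] sg_neg_iff[of "a - b"] sg_neg_iff[of "a' - b'"]
    by simp_all
  show ?thesis
    using assms(3,4)
  proof (induction q)
    case (Equal s t)
    then show ?case using eq(1)[of "ev h e s" "ev h e t"] by (simp add: one ev_def[symmetric])
  next
    case (Less s t)
    then show ?case using eq(2)[of "ev h e s" "ev h e t"] by (simp add: one ev_def[symmetric])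
  qed auto
qed

text \<open>The same formula must serve for both fields, so that closure under existential
  quantifiers yields elimination and transfer at once. Predicates instead of formulas are paired, so
  that conditions can be written in HOL and treated by closure rules.\<close>

definition qdef :: "('r \<Rightarrow> 's) \<Rightarrow> ((nat \<Rightarrow> 'r::linordered_field) \<Rightarrow> bool) \<Rightarrow> ((nat \<Rightarrow> 's::linordered_field) \<Rightarrow> bool) \<Rightarrow> bool" where
  "qdef h P P' \<longleftrightarrow> (\<exists>q. quantifier_free q \<and> (\<forall>e. P e = sat e q) \<and> (\<forall>e. P' e = sat e (map_fm h q)))"

lemma qdef_sat: "quantifier_free q \<Longrightarrow> qdef h (\<lambda>e. sat e q) (\<lambda>e. sat e (map_fm h q))"
  unfolding qdef_def by blast

lemma qdef_neg: "qdef h P P' \<Longrightarrow> qdef h (\<lambda>e. \<not> P e) (\<lambda>e. \<not> P' e)"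
  unfolding qdef_def
proof (elim exE conjE)
  fix q assume "quantifier_free q" "\<forall>e. P e = sat e q" "\<forall>e. P' e = sat e (map_fm h q)"
  then show "\<exists>q. quantifier_free q \<and> (\<forall>e. (\<not> P e) = sat e q) \<and> (\<forall>e. (\<not> P' e) = sat e (map_fm h q))"
    by (intro exI[of _ "Neg q"]) simp
qed

lemma qdef_conj: "qdef h P P' \<Longrightarrow> qdef h Q Q' \<Longrightarrow> qdef h (\<lambda>e. P e \<and> Q e) (\<lambda>e. P' e \<and> Q' e)"
  unfolding qdef_def
proof (elim exE conjE)
  fix p q assume "quantifier_free p" "\<forall>e. P e = sat e p" "\<forall>e. P' e = sat e (map_fm h p)"
    "quantifier_free q" "\<forall>e. Q e = sat e q" "\<forall>e. Q' e = sat e (map_fm h q)"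
  then show "\<exists>q. quantifier_free q \<and> (\<forall>e. (P e \<and> Q e) = sat e q) \<and> (\<forall>e. (P' e \<and> Q' e) = sat e (map_fm h q))"
    by (intro exI[of _ "Conj p q"]) simp
qed

lemma qdef_disj: "qdef h P P' \<Longrightarrow> qdef h Q Q' \<Longrightarrow> qdef h (\<lambda>e. P e \<or> Q e) (\<lambda>e. P' e \<or> Q' e)"
  using qdef_neg[OF qdef_conj[OF qdef_neg[of h P P'] qdef_neg[of h Q Q']]] by simp

lemma qdef_False: "qdef h (\<lambda>e. False) (\<lambda>e. False)"
  unfolding qdef_def by (intro exI[of _ "Less (Var 0) (Var 0)"]) simp

lemma qdef_ball: "finite A \<Longrightarrow> (\<And>a. a \<in> A \<Longrightarrow> qdef h (P a) (P' a)) \<Longrightarrow> qdef h (\<lambda>e. \<forall>a\<in>A. P a e) (\<lambda>e. \<forall>a\<in>A. P' a e)"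
proof (induction A rule: finite_induct)
  case empty
  then show ?case using qdef_neg[OF qdef_False, of h] by simp
next
  case (insert a A)
  then show ?case using qdef_conj[of h "P a" "P' a"] by simp
qed

lemma qdef_bex: "finite A \<Longrightarrow> (\<And>a. a \<in> A \<Longrightarrow> qdef h (P a) (P' a)) \<Longrightarrow> qdef h (\<lambda>e. \<exists>a\<in>A. P a e) (\<lambda>e. \<exists>a\<in>A. P' a e)"
proof (induction A rule: finite_induct)
  case empty
  then show ?case using qdef_False[of h] by simp
next
  case (insert a A)
  then show ?case using qdef_disj[of h "P a" "P' a"] by simp
qed

lemma qdef_subst: "qdef h P P' \<Longrightarrow> qdef h (\<lambda>e. P (\<lambda>i. eval_trm e (\<tau> i))) (\<lambda>e. P' (\<lambda>i. eval_trm e (map_trm h (\<tau> i))))"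
  unfolding qdef_def
proof (elim exE conjE)
  fix q assume "quantifier_free q" "\<forall>e. P e = sat e q" "\<forall>e. P' e = sat e (map_fm h q)"
  then show "\<exists>q. quantifier_free q \<and> (\<forall>e. P (\<lambda>i. eval_trm e (\<tau> i)) = sat e q)
    \<and> (\<forall>e. P' (\<lambda>i. eval_trm e (map_trm h (\<tau> i))) = sat e (map_fm h q))"
    by (intro exI[of _ "subst_fm \<tau> q"]) (simp add: sat_subst_fm map_subst_fm)
qed

lemma qdef_rename: "qdef h P P' \<Longrightarrow> qdef h (\<lambda>e. P (\<lambda>i. e (\<sigma> i))) (\<lambda>e. P' (\<lambda>i. e (\<sigma> i)))"
  using qdef_subst[of h P P' "\<lambda>i. Var (\<sigma> i)"] by simp

context
  fixes h :: "'r::real_closed_field \<Rightarrow> 's::real_closed_field"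
  assumes h: "field_embedding h"
begin

lemma qdef_sg: "qdef h (\<lambda>e. sg (ev id e c) = s) (\<lambda>e. sg (ev h e c) = s)"
proof -
  have *: "qdef h (\<lambda>e. sat e q) (\<lambda>e. sat e (map_fm h q))" if "quantifier_free q" for q
    using qdef_sat[OF that] .
  have ev: "ev id e c = eval_trm e c" for e :: "nat \<Rightarrow> 'r" by (simp add: ev_def trm.map_id)
  consider "s = -1" | "s = 0" | "s = 1" | "s \<noteq> -1" "s \<noteq> 0" "s \<noteq> 1" by blast
  then show ?thesis
  proof cases
    case 1
    then show ?thesis using *[of "Less c (Const 0)"]
      by (simp add: sg_eq_iffs ev ev_def[symmetric] field_embedding_0[OF h])
  next
    case 2
    then show ?thesis using *[of "Equal c (Const 0)"]
      by (simp add: ev ev_def[symmetric] field_embedding_0[OF h])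
  next
    case 3
    then show ?thesis using *[of "Less (Const 0) c"]
      by (simp add: sg_eq_iffs ev ev_def[symmetric] field_embedding_0[OF h])
  next
    case 4
    have "sg x \<noteq> s" for x :: 'r using sg_cases[of x] 4 by metis
    moreover have "sg x \<noteq> s" for x :: 's using sg_cases[of x] 4 by metis
    ultimately show ?thesis using qdef_False[of h] by simp
  qed
qed

text \<open>Whether a suitable x exists depends only on the signs of the finitely many coefficients
  in \<open>C\<close>. The eliminating formula is the disjunction over the sign vectors at which
  some x exists for some assignment over R or S.\<close>

theorem quantifier_elimination_step:
  assumes q: "quantifier_free q"
  shows "qdef h (\<lambda>e. \<exists>x. sat (case_nat x e) q) (\<lambda>e. \<exists>x. sat (case_nat x e) (map_fm h q))"
proof -
  obtain P where P: "finite P" "poly_of_trm ` differences q \<subseteq> P" "pclosed 0 P"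
    using pclosed_closure_exists[of "poly_of_trm ` differences q"] finite_differences by blast
  define C where "C = (\<Union>p\<in>P. set p)"
  have "finite C" using P(1) by (simp add: C_def)
  have idq: "map_fm id q = q" by (rule fm.map_id)
  \<comment> \<open>Generic in both embeddings because a listed sign vector may have been witnessed
    in either field: it is used from R to R, S to R, R to S and S to S.\<close>
  have transfer: "\<exists>y. sat (case_nat y e') (map_fm g' q)"
    if g: "field_embedding g" "field_embedding g'"
      and signs: "\<And>c. c \<in> C \<Longrightarrow> sg (ev g e c) = sg (ev g' e' c)"
      and sat: "sat (case_nat x e) (map_fm g q)"
    for g :: "'r \<Rightarrow> 'k::real_closed_field" and g' :: "'r \<Rightarrow> 'l::real_closed_field" and e e' x
  proof -
    obtain y where y: "agree P (evp g e) (evp g' e') x y"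
      using signs_of_coefficients_determine_cells[OF g P(1,3), of e e' x] signs by (auto simp: C_def)
    have "sat (case_nat x e) (map_fm g q) = sat (case_nat y e') (map_fm g' q)"
    proof (rule sat_determined_by_signs[OF g q])
      fix t assume "t \<in> differences q"
      then have "sg (poly (evp g e (poly_of_trm t)) x) = sg (poly (evp g' e' (poly_of_trm t)) y)"
        using P(2) y by (auto simp: agree_def)
      then show "sg (ev g (case_nat x e) t) = sg (ev g' (case_nat y e') t)"
        by (simp add: poly_evp_poly_of_trm g)
    qed
    then show ?thesis using sat by blast
  qed
  define type_of where "type_of S = {\<sigma> \<in> C \<rightarrow>\<^sub>E {-1, 0, 1 :: int}. S \<sigma>}" for S
  define S where "S \<sigma> \<longleftrightarrow> (\<exists>e. (\<forall>c\<in>C. sg (ev id e c) = \<sigma> c) \<and> (\<exists>x. sat (case_nat x e) q))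
    \<or> (\<exists>e. (\<forall>c\<in>C. sg (ev h e c) = \<sigma> c) \<and> (\<exists>x. sat (case_nat x e) (map_fm h q)))" for \<sigma>
  have fin: "finite (type_of S)"
    unfolding type_of_def using \<open>finite C\<close> by (intro finite_subset[OF _ finite_PiE[of C "\<lambda>_. {-1, 0, 1}"]]) auto
  have "(\<exists>x. sat (case_nat x e) q) \<longleftrightarrow> (\<exists>\<sigma>\<in>type_of S. \<forall>c\<in>C. sg (ev id e c) = \<sigma> c)" for e
  proof
    assume "\<exists>x. sat (case_nat x e) q"
    then have "S (\<lambda>c\<in>C. sg (ev id e c))" unfolding S_def by (intro disjI1 exI[of _ e]) simp
    moreover have "(\<lambda>c\<in>C. sg (ev id e c)) \<in> C \<rightarrow>\<^sub>E {-1, 0, 1}"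
      unfolding restrict_PiE_iff by (intro ballI sg_range)
    ultimately have "(\<lambda>c\<in>C. sg (ev id e c)) \<in> type_of S" by (simp only: type_of_def mem_Collect_eq simp_thms)
    then show "\<exists>\<sigma>\<in>type_of S. \<forall>c\<in>C. sg (ev id e c) = \<sigma> c"
      by (intro bexI[of _ "\<lambda>c\<in>C. sg (ev id e c)"]) simp_all
  next
    assume "\<exists>\<sigma>\<in>type_of S. \<forall>c\<in>C. sg (ev id e c) = \<sigma> c"
    then obtain \<sigma> where "S \<sigma>" "\<forall>c\<in>C. sg (ev id e c) = \<sigma> c" by (auto simp: type_of_def)
    then show "\<exists>x. sat (case_nat x e) q"
      using transfer[OF field_embedding_id field_embedding_id, of _ e] transfer[OF h field_embedding_id, of _ e]
      unfolding S_def idq by metis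
  qed
  moreover have "(\<exists>x. sat (case_nat x e) (map_fm h q)) \<longleftrightarrow> (\<exists>\<sigma>\<in>type_of S. \<forall>c\<in>C. sg (ev h e c) = \<sigma> c)" for e
  proof
    assume "\<exists>x. sat (case_nat x e) (map_fm h q)"
    then have "S (\<lambda>c\<in>C. sg (ev h e c))" unfolding S_def by (intro disjI2 exI[of _ e]) simp
    moreover have "(\<lambda>c\<in>C. sg (ev h e c)) \<in> C \<rightarrow>\<^sub>E {-1, 0, 1}"
      unfolding restrict_PiE_iff by (intro ballI sg_range)
    ultimately have "(\<lambda>c\<in>C. sg (ev h e c)) \<in> type_of S" by (simp only: type_of_def mem_Collect_eq simp_thms)
    then show "\<exists>\<sigma>\<in>type_of S. \<forall>c\<in>C. sg (ev h e c) = \<sigma> c"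
      by (intro bexI[of _ "\<lambda>c\<in>C. sg (ev h e c)"]) simp_all
  next
    assume "\<exists>\<sigma>\<in>type_of S. \<forall>c\<in>C. sg (ev h e c) = \<sigma> c"
    then obtain \<sigma> where "S \<sigma>" "\<forall>c\<in>C. sg (ev h e c) = \<sigma> c" by (auto simp: type_of_def)
    then show "\<exists>x. sat (case_nat x e) (map_fm h q)"
      using transfer[OF field_embedding_id h, of _ e] transfer[OF h h, of _ e]
      unfolding S_def idq by metis
  qed
  moreover have "qdef h (\<lambda>e. \<exists>\<sigma>\<in>type_of S. \<forall>c\<in>C. sg (ev id e c) = \<sigma> c)
      (\<lambda>e. \<exists>\<sigma>\<in>type_of S. \<forall>c\<in>C. sg (ev h e c) = \<sigma> c)"
    by (intro qdef_bex[OF fin] qdef_ball[OF \<open>finite C\<close>] qdef_sg)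
  ultimately show ?thesis by presburger
qed

lemma qdef_Exists: "qdef h P P' \<Longrightarrow> qdef h (\<lambda>e. \<exists>x. P (case_nat x e)) (\<lambda>e. \<exists>x. P' (case_nat x e))"
  unfolding qdef_def[of h P P'] using quantifier_elimination_step by auto

theorem quantifier_elimination: "qdef h (\<lambda>e. sat e p) (\<lambda>e. sat e (map_fm h p))"
proof (induction p)
  case (Equal s t)
  show ?case by (rule qdef_sat) simp
next
  case (Less s t)
  show ?case by (rule qdef_sat) simp
next
  case (Neg p)
  then show ?case using qdef_neg by simp
next
  case (Conj p q)
  then show ?case using qdef_conj by simp
next
  case (Exists p)
  then show ?case using qdef_Exists by simp
qed

lemma qdef_ex_upd: "qdef h P P' \<Longrightarrow> qdef h (\<lambda>e. \<exists>x. P (e(j := x))) (\<lambda>e. \<exists>x. P' (e(j := x)))"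
proof -
  assume "qdef h P P'"
  from qdef_Exists[OF qdef_rename[OF this, of "\<lambda>i. if i = j then 0 else Suc i"]]
  have "qdef h (\<lambda>e. \<exists>x. P (\<lambda>i. case_nat x e (if i = j then 0 else Suc i)))
    (\<lambda>e. \<exists>x. P' (\<lambda>i. case_nat x e (if i = j then 0 else Suc i)))" .
  then show ?thesis by (simp only: rename_upd)
qed

lemma qdef_ex_block:
  assumes "finite J" "qdef h P P'"
  shows "qdef h (\<lambda>e. \<exists>e'. (\<forall>i. i \<notin> J \<longrightarrow> e' i = e i) \<and> P e') (\<lambda>e. \<exists>e'. (\<forall>i. i \<notin> J \<longrightarrow> e' i = e i) \<and> P' e')"
  using assms(1)
proof (induction J rule: finite_induct)
  case empty
  then show ?case using assms(2) by (simp add: fun_eq_iff[symmetric])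
next
  case (insert j J)
  then show ?case unfolding ex_agree_off_insert using qdef_ex_upd[OF insert.IH, of j] by simp
qed

end


section \<open>Definable predicates of points\<close>

text \<open>
  A sequence of points, each with infinitely many coordinates, is coded by a single variable
  assignment. A definable predicate only looks at finitely many of the coordinates.
\<close>

definition unflat :: "(nat \<Rightarrow> 'a) \<Rightarrow> nat \<Rightarrow> nat \<Rightarrow> 'a" where
  "unflat e j i = e (prod_encode (j, i))"

definition flat :: "(nat \<Rightarrow> nat \<Rightarrow> 'a) \<Rightarrow> nat \<Rightarrow> 'a" where
  "flat v k = v (fst (prod_decode k)) (snd (prod_decode k))"

lemma unflat_flat [simp]: "unflat (flat v) = v"
  by (intro ext) (simp add: unflat_def flat_def)

text \<open>The sequence of points is a de Bruijn stack, with the point bound last at index 0.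
  \<open>td\<close> below is the analogue for values given by a term.\<close>

definition pd :: "('r \<Rightarrow> 's) \<Rightarrow> ((nat \<Rightarrow> nat \<Rightarrow> 'r::linordered_field) \<Rightarrow> bool) \<Rightarrow> ((nat \<Rightarrow> nat \<Rightarrow> 's::linordered_field) \<Rightarrow> bool) \<Rightarrow> bool" where
  "pd h P P' \<longleftrightarrow> qdef h (\<lambda>e. P (unflat e)) (\<lambda>e. P' (unflat e))"

definition td :: "('r \<Rightarrow> 's) \<Rightarrow> ((nat \<Rightarrow> nat \<Rightarrow> 'r::linordered_field) \<Rightarrow> 'r) \<Rightarrow> ((nat \<Rightarrow> nat \<Rightarrow> 's::linordered_field) \<Rightarrow> 's) \<Rightarrow> bool" where
  "td h s s' \<longleftrightarrow> (\<exists>t. (\<forall>e. s (unflat e) = eval_trm e t) \<and> (\<forall>e. s' (unflat e) = eval_trm e (map_trm h t)))"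

text \<open>Point j + 1 of the stack under a quantifier is point j of the stack outside it.\<close>

definition shift_var :: "nat \<Rightarrow> nat" where
  "shift_var k = prod_encode (fst (prod_decode k) - 1, snd (prod_decode k))"

text \<open>A point has infinitely many coordinates, but q only sees variables below N. So
  quantifying over the point amounts to quantifying over the finite block of its coordinates with
  code below N.\<close>

lemma ex_point_iff:
  assumes Q: "\<And>e. Q (unflat e 0) (\<lambda>k. unflat e (Suc k)) = sat e q" and N: "fm_in N q"
  shows "(\<exists>x. Q x (unflat e)) \<longleftrightarrow>
    (\<exists>e'. (\<forall>i. i \<notin> {k \<in> {..<N}. fst (prod_decode k) = 0} \<longrightarrow> e' i = e (shift_var i)) \<and> sat e' q)"
proof -
  have val: "Q x (unflat e) = sat (flat (case_nat x (unflat e))) q" for x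
    using Q[of "flat (case_nat x (unflat e))"] by simp
  have shifted: "flat (case_nat x (unflat e)) i = e (shift_var i)" if "fst (prod_decode i) \<noteq> 0" for x i
    using that by (auto simp: flat_def unflat_def shift_var_def split: nat.split)
  have zero: "flat (case_nat x (unflat e)) i = x (snd (prod_decode i))" if "fst (prod_decode i) = 0" for x i
    using that by (simp add: flat_def)
  show ?thesis
  proof
    assume "\<exists>x. Q x (unflat e)"
    then obtain x where x: "sat (flat (case_nat x (unflat e))) q" using val by blast
    define e' where "e' i = (if i \<in> {k \<in> {..<N}. fst (prod_decode k) = 0} then flat (case_nat x (unflat e)) i
      else e (shift_var i))" for i
    have "sat e' q = sat (flat (case_nat x (unflat e))) q"
      by (rule sat_cong[OF N]) (simp add: e'_def shifted)
    then show "\<exists>e'. (\<forall>i. i \<notin> {k \<in> {..<N}. fst (prod_decode k) = 0} \<longrightarrow> e' i = e (shift_var i)) \<and> sat e' q"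
      using x by (intro exI[of _ e']) (simp add: e'_def)
  next
    assume "\<exists>e'. (\<forall>i. i \<notin> {k \<in> {..<N}. fst (prod_decode k) = 0} \<longrightarrow> e' i = e (shift_var i)) \<and> sat e' q"
    then obtain e' where e': "\<And>i. i \<notin> {k \<in> {..<N}. fst (prod_decode k) = 0} \<Longrightarrow> e' i = e (shift_var i)"
      and sat: "sat e' q" by blast
    define x where "x k = e' (prod_encode (0, k))" for k
    have "flat (case_nat x (unflat e)) i = e' i" if "i < N" for i
    proof (cases "fst (prod_decode i) = 0")
      case True
      then have "prod_encode (0, snd (prod_decode i)) = i"
        by (metis prod.collapse prod_decode_inverse)
      then show ?thesis using zero[OF True] by (simp add: x_def)
    next
      case False
      then show ?thesis using shifted[OF False] e'[of i] by simp
    qed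
    then have "sat (flat (case_nat x (unflat e))) q = sat e' q" by (rule sat_cong[OF N])
    then show "\<exists>x. Q x (unflat e)" using sat val by blast
  qed
qed

lemma pd_neg: "pd h P P' \<Longrightarrow> pd h (\<lambda>v. \<not> P v) (\<lambda>v. \<not> P' v)"
  unfolding pd_def by (rule qdef_neg)

lemma pd_conj: "pd h P P' \<Longrightarrow> pd h Q Q' \<Longrightarrow> pd h (\<lambda>v. P v \<and> Q v) (\<lambda>v. P' v \<and> Q' v)"
  unfolding pd_def by (rule qdef_conj)

lemma pd_imp: "pd h P P' \<Longrightarrow> pd h Q Q' \<Longrightarrow> pd h (\<lambda>v. P v \<longrightarrow> Q v) (\<lambda>v. P' v \<longrightarrow> Q' v)"
  unfolding pd_def imp_conv_disj by (intro qdef_disj qdef_neg)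

lemma pd_all_less:
  fixes n :: nat
  assumes "\<And>i. i < n \<Longrightarrow> pd h (P i) (P' i)"
  shows "pd h (\<lambda>v. \<forall>i<n. P i v) (\<lambda>v. \<forall>i<n. P' i v)"
  using qdef_ball[OF finite_lessThan, of n h "\<lambda>i e. P i (unflat e)" "\<lambda>i e. P' i (unflat e)"] assms
  by (simp add: pd_def Ball_def)

lemma pd_all_le:
  fixes n :: nat
  assumes "\<And>i. i \<le> n \<Longrightarrow> pd h (P i) (P' i)"
  shows "pd h (\<lambda>v. \<forall>i\<le>n. P i v) (\<lambda>v. \<forall>i\<le>n. P' i v)"
  using qdef_ball[OF finite_atMost, of n h "\<lambda>i e. P i (unflat e)" "\<lambda>i e. P' i (unflat e)"] assms
  by (simp add: pd_def Ball_def)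

lemma pd_ex_le:
  fixes n :: nat
  assumes "\<And>i. i \<le> n \<Longrightarrow> pd h (P i) (P' i)"
  shows "pd h (\<lambda>v. \<exists>i\<le>n. P i v) (\<lambda>v. \<exists>i\<le>n. P' i v)"
  using qdef_bex[OF finite_atMost, of n h "\<lambda>i e. P i (unflat e)" "\<lambda>i e. P' i (unflat e)"] assms
  by (simp add: pd_def Bex_def)

lemma td_var: "td h (\<lambda>v. v j i) (\<lambda>v. v j i)"
  unfolding td_def by (intro exI[of _ "Var (prod_encode (j, i))"]) (simp add: unflat_def)

lemma td_if: "td h s s' \<Longrightarrow> td h t t' \<Longrightarrow> td h (\<lambda>v. if b then s v else t v) (\<lambda>v. if b then s' v else t' v)"
  by (cases b) simp_all

lemma td_add: "td h s s' \<Longrightarrow> td h t t' \<Longrightarrow> td h (\<lambda>v. s v + t v) (\<lambda>v. s' v + t' v)"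
  unfolding td_def
proof (elim exE conjE)
  fix a b assume "\<forall>e. s (unflat e) = eval_trm e a" "\<forall>e. s' (unflat e) = eval_trm e (map_trm h a)"
    "\<forall>e. t (unflat e) = eval_trm e b" "\<forall>e. t' (unflat e) = eval_trm e (map_trm h b)"
  then show "\<exists>c. (\<forall>e. s (unflat e) + t (unflat e) = eval_trm e c)
      \<and> (\<forall>e. s' (unflat e) + t' (unflat e) = eval_trm e (map_trm h c))"
    by (intro exI[of _ "Add a b"]) simp
qed

lemma pd_less: "td h s s' \<Longrightarrow> td h t t' \<Longrightarrow> pd h (\<lambda>v. s v < t v) (\<lambda>v. s' v < t' v)"
  unfolding td_def pd_def qdef_def
proof (elim exE conjE)
  fix a b assume "\<forall>e. s (unflat e) = eval_trm e a" "\<forall>e. s' (unflat e) = eval_trm e (map_trm h a)"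
    "\<forall>e. t (unflat e) = eval_trm e b" "\<forall>e. t' (unflat e) = eval_trm e (map_trm h b)"
  then show "\<exists>q. quantifier_free q \<and> (\<forall>e. (s (unflat e) < t (unflat e)) = sat e q)
      \<and> (\<forall>e. (s' (unflat e) < t' (unflat e)) = sat e (map_fm h q))"
    by (intro exI[of _ "Less a b"]) simp
qed

lemma pd_le: "td h s s' \<Longrightarrow> td h t t' \<Longrightarrow> pd h (\<lambda>v. s v \<le> t v) (\<lambda>v. s' v \<le> t' v)"
  using pd_neg[OF pd_less[of h t t' s s']] by (simp add: not_less)

lemma pd_eq: "td h s s' \<Longrightarrow> td h t t' \<Longrightarrow> pd h (\<lambda>v. s v = t v) (\<lambda>v. s' v = t' v)"
  unfolding order_eq_iff by (intro pd_conj pd_le)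

context
  fixes h :: "'r::real_closed_field \<Rightarrow> 's::real_closed_field"
  assumes h: "field_embedding h"
begin

lemma td_0: "td h (\<lambda>v. 0) (\<lambda>v. 0)"
  unfolding td_def by (intro exI[of _ "Const 0"]) (simp add: field_embedding_0[OF h])

lemma td_1: "td h (\<lambda>v. 1) (\<lambda>v. 1)"
  unfolding td_def using h by (intro exI[of _ "Const 1"]) (simp add: field_embedding_def)

lemma pd_sat:
  assumes "\<And>i. td h (\<tau> i) (\<tau>' i)"
  shows "pd h (\<lambda>v. sat (\<lambda>i. \<tau> i v) q) (\<lambda>v. sat (\<lambda>i. \<tau>' i v) (map_fm h q))"
proof -
  obtain t where t: "\<And>i e. \<tau> i (unflat e) = eval_trm e (t i)" "\<And>i e. \<tau>' i (unflat e) = eval_trm e (map_trm h (t i))"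
    using assms unfolding td_def by metis
  show ?thesis
    unfolding pd_def t by (rule qdef_subst[OF quantifier_elimination[OF h]])
qed

lemma pd_ex:
  assumes "pd h (\<lambda>v. Q (v 0) (\<lambda>k. v (Suc k))) (\<lambda>v. Q' (v 0) (\<lambda>k. v (Suc k)))"
  shows "pd h (\<lambda>v. \<exists>x. Q x v) (\<lambda>v. \<exists>x. Q' x v)"
proof -
  obtain q where qf: "quantifier_free q"
    and q: "\<And>e. Q (unflat e 0) (\<lambda>k. unflat e (Suc k)) = sat e q"
    and q': "\<And>e. Q' (unflat e 0) (\<lambda>k. unflat e (Suc k)) = sat e (map_fm h q)"
    using assms unfolding pd_def qdef_def by blast
  obtain N where N: "fm_in N q" using fm_in_bound by blast
  define J where "J = {k \<in> {..<N}. fst (prod_decode k) = 0}"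
  have "finite J" by (simp add: J_def)
  have "qdef h (\<lambda>e. \<exists>e'. (\<forall>i. i \<notin> J \<longrightarrow> e' i = e (shift_var i)) \<and> sat e' q)
      (\<lambda>e. \<exists>e'. (\<forall>i. i \<notin> J \<longrightarrow> e' i = e (shift_var i)) \<and> sat e' (map_fm h q))"
    using qdef_rename[OF qdef_ex_block[OF h \<open>finite J\<close> qdef_sat[OF qf]], of shift_var] .
  then show ?thesis
    unfolding pd_def J_def ex_point_iff[of Q q, OF q N] ex_point_iff[of Q' "map_fm h q" N, OF q', unfolded fm_in_map, OF N] .
qed

lemma pd_all:
  assumes "pd h (\<lambda>v. Q (v 0) (\<lambda>k. v (Suc k))) (\<lambda>v. Q' (v 0) (\<lambda>k. v (Suc k)))"
  shows "pd h (\<lambda>v. \<forall>x. Q x v) (\<lambda>v. \<forall>x. Q' x v)"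
  using pd_neg[OF pd_ex[of "\<lambda>x v. \<not> Q x v" "\<lambda>x v. \<not> Q' x v"]] pd_neg[OF assms] by simp

text \<open>A constant predicate may be tested at the zero assignment. There \<open>h\<close> maps
  the value of each term over R to its value over S, keeping the sign.\<close>

lemma pd_sentence:
  assumes "pd h (\<lambda>v. A) (\<lambda>v. A')"
  shows "A \<longleftrightarrow> A'"
proof -
  from assms[unfolded pd_def qdef_def]
  obtain q where "quantifier_free q \<and> (\<forall>e :: nat \<Rightarrow> 'r. A = sat e q) \<and> (\<forall>e :: nat \<Rightarrow> 's. A' = sat e (map_fm h q))"
    by (rule exE)
  then have q: "quantifier_free q" "A = sat (\<lambda>i. 0) q" "A' = sat (\<lambda>i. 0) (map_fm h q)"
    by simp_all
  have "sat (\<lambda>i. 0) (map_fm id q) = sat (\<lambda>i. 0) (map_fm h q)"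
  proof (rule sat_determined_by_signs[OF field_embedding_id h q(1)])
    fix t
    have "ev h (\<lambda>i. h 0) t = h (ev id (\<lambda>i. 0) t)"
      using h by (induction t) (simp_all add: field_embedding_def)
    then show "sg (ev id (\<lambda>i. 0) t) = sg (ev h (\<lambda>i. 0) t)"
      using field_embedding_sg[OF h] by (simp add: field_embedding_0[OF h])
  qed
  then show ?thesis using q(2,3) by (simp add: fm.map_id)
qed

end

section \<open>The topology of affine space\<close>

text \<open>The sup-norm ball of radius d, written with addition only so that \<open>td_add\<close>
  is enough to see that it is definable.\<close>

definition near :: "nat \<Rightarrow> (nat \<Rightarrow> 'a::linordered_field) \<Rightarrow> (nat \<Rightarrow> 'a) \<Rightarrow> 'a \<Rightarrow> bool" where
  "near n x y d \<longleftrightarrow> (\<forall>i<n. x i < y i + d \<and> y i < x i + d)"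

lemma topspace_aff_top: "topspace (aff_top n) = aff n"
  by (simp add: aff_top_def aff_def)

lemma near_eq_PiE: "{y \<in> aff n. near n x y d} = (\<Pi>\<^sub>E i\<in>{..<n}. {x i - d<..<x i + d})"
proof (rule Set.set_eqI)
  fix y
  show "y \<in> {y \<in> aff n. near n x y d} \<longleftrightarrow> y \<in> (\<Pi>\<^sub>E i\<in>{..<n}. {x i - d<..<x i + d})"
    unfolding aff_def near_def PiE_iff mem_Collect_eq greaterThanLessThan_iff diff_less_eq by blast
qed

lemma openin_near: "openin (aff_top n) {y \<in> aff n. near n (x :: nat \<Rightarrow> 'a::{linordered_field,linorder_topology}) y d}"
  unfolding aff_top_def near_eq_PiE by (simp add: openin_PiE)

lemma open_interval_around:
  fixes a :: "'a::{linordered_field,linorder_topology}"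
  assumes "open V" "a \<in> V"
  shows "\<exists>d>0. {a - d<..<a + d} \<subseteq> V"
proof -
  obtain b where b: "a < b" "{a..<b} \<subseteq> V" using open_right[OF assms, of "a + 1"] by auto
  obtain c where c: "c < a" "{c<..a} \<subseteq> V" using open_left[OF assms, of "a - 1"] by auto
  define m where "m = min (b - a) (a - c)"
  have m: "m \<le> b - a" "m \<le> a - c" by (simp_all add: m_def)
  have "{a - m<..<a + m} \<subseteq> V"
  proof
    fix y assume y: "y \<in> {a - m<..<a + m}"
    then have "a - m < y" "y < a + m" by simp_all
    then have "c < y" "y < b" using m by linarith+
    then show "y \<in> V" using b(2) c(2) by (cases "y \<le> a") auto
  qed
  moreover have "m > 0" using b c by (simp add: m_def)
  ultimately show ?thesis by blast
qed

lemma openin_aff_iff: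
  fixes A :: "(nat \<Rightarrow> 'a::{linordered_field,linorder_topology}) set"
  assumes "A \<subseteq> aff n"
  shows "openin (subtopology (aff_top n) A) U \<longleftrightarrow> U \<subseteq> A \<and> (\<forall>x\<in>U. \<exists>d>0. \<forall>y\<in>A. near n x y d \<longrightarrow> y \<in> U)"
proof
  assume "openin (subtopology (aff_top n) A) U"
  then obtain T where T: "openin (aff_top n) T" "U = T \<inter> A" by (auto simp: openin_subtopology)
  show "U \<subseteq> A \<and> (\<forall>x\<in>U. \<exists>d>0. \<forall>y\<in>A. near n x y d \<longrightarrow> y \<in> U)"
  proof (intro conjI ballI)
    fix x assume "x \<in> U"
    then have "x \<in> T" using T(2) by blast
    from bspec[OF T(1)[unfolded aff_top_def openin_product_topology_alt] this]
    obtain V where "\<forall>i\<in>{..<n}. openin euclidean (V i)" "x \<in> Pi\<^sub>E {..<n} V" "Pi\<^sub>E {..<n} V \<subseteq> T"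
      by (elim exE conjE)
    then have V: "\<And>i. i < n \<Longrightarrow> open (V i)" "x \<in> Pi\<^sub>E {..<n} V" "Pi\<^sub>E {..<n} V \<subseteq> T"
      by (simp_all flip: open_openin)
    have "\<exists>d>0. {x i - d<..<x i + d} \<subseteq> V i" if "i < n" for i
      using open_interval_around[OF V(1)[OF that]] V(2) that by (auto simp: PiE_iff)
    then obtain d where d: "\<And>i. i < n \<Longrightarrow> d i > 0 \<and> {x i - d i<..<x i + d i} \<subseteq> V i" by metis
    \<comment> \<open>The inserted 1 keeps the set nonempty when n = 0.\<close>
    define m where "m = Min (insert 1 (d ` {..<n}))"
    have "m > 0" unfolding m_def using d by (subst Min_gr_iff) auto
    moreover have "y \<in> U" if y: "y \<in> A" "near n x y m" for y
    proof -
      have "y i \<in> V i" if "i < n" for i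
      proof -
        have "m \<le> d i" unfolding m_def using that by (intro Min_le) auto
        moreover have "x i < y i + m" "y i < x i + m" using y(2) that unfolding near_def by blast+
        ultimately have "x i - d i < y i" "y i < x i + d i" by linarith+
        then have "y i \<in> {x i - d i<..<x i + d i}" by simp
        then show ?thesis using d[OF that] by blast
      qed
      then have "y \<in> Pi\<^sub>E {..<n} V" using y(1) assms by (auto simp: aff_def PiE_iff)
      then show ?thesis using V(3) T(2) y(1) by blast
    qed
    ultimately show "\<exists>d>0. \<forall>y\<in>A. near n x y d \<longrightarrow> y \<in> U" by blast
  qed (use T in blast)
next
  assume U: "U \<subseteq> A \<and> (\<forall>x\<in>U. \<exists>d>0. \<forall>y\<in>A. near n x y d \<longrightarrow> y \<in> U)"
  then obtain d where d: "\<And>x. x \<in> U \<Longrightarrow> d x > 0 \<and> (\<forall>y\<in>A. near n x y (d x) \<longrightarrow> y \<in> U)" by metis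
  define T where "T = (\<Union>x\<in>U. {y \<in> aff n. near n x y (d x)})"
  have "openin (aff_top n) T" unfolding T_def using openin_near by blast
  moreover have "x \<in> T" if "x \<in> U" for x
    using that d[OF that] U assms by (auto simp: T_def near_def intro!: bexI[of _ x])
  then have "U = T \<inter> A" using U d by (auto simp: T_def)
  ultimately show "openin (subtopology (aff_top n) A) U" by (auto simp: openin_subtopology)
qed

lemma continuous_map_aff_iff:
  fixes A :: "(nat \<Rightarrow> 'a::{linordered_field,linorder_topology}) set"
  assumes A: "A \<subseteq> aff m" and B: "B \<subseteq> aff n"
  shows "continuous_map (subtopology (aff_top m) A) (subtopology (aff_top n) B) f \<longleftrightarrow>
    f ` A \<subseteq> B \<and> (\<forall>x\<in>A. \<forall>e>0. \<exists>d>0. \<forall>y\<in>A. near m x y d \<longrightarrow> near n (f x) (f y) e)"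
proof -
  have top: "topspace (subtopology (aff_top m) A) = A" "topspace (subtopology (aff_top n) B) = B"
    using A B by (auto simp: topspace_aff_top)
  show ?thesis
  proof
    assume cont: "continuous_map (subtopology (aff_top m) A) (subtopology (aff_top n) B) f"
    then have fA: "f ` A \<subseteq> B" using continuous_map_image_subset_topspace[OF cont] by (simp only: top)
    have "\<exists>d>0. \<forall>y\<in>A. near m x y d \<longrightarrow> near n (f x) (f y) e" if "x \<in> A" "e > 0" for x e
    proof -
      define W where "W = {y \<in> aff n. near n (f x) y e} \<inter> B"
      have "openin (subtopology (aff_top n) B) W"
        unfolding W_def using openin_near by (metis openin_subtopology)
      then have "openin (subtopology (aff_top m) A) {y \<in> A. f y \<in> W}"
        using openin_continuous_map_preimage[OF cont] by (simp only: top)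
      moreover have "x \<in> {y \<in> A. f y \<in> W}"
        using that fA B by (auto simp: W_def near_def)
      ultimately have "\<exists>d>0. \<forall>y\<in>A. near m x y d \<longrightarrow> y \<in> {y \<in> A. f y \<in> W}"
        unfolding openin_aff_iff[OF A] by blast
      then show ?thesis by (auto simp: W_def)
    qed
    then show "f ` A \<subseteq> B \<and> (\<forall>x\<in>A. \<forall>e>0. \<exists>d>0. \<forall>y\<in>A. near m x y d \<longrightarrow> near n (f x) (f y) e)"
      using fA by blast
  next
    assume f: "f ` A \<subseteq> B \<and> (\<forall>x\<in>A. \<forall>e>0. \<exists>d>0. \<forall>y\<in>A. near m x y d \<longrightarrow> near n (f x) (f y) e)"
    show "continuous_map (subtopology (aff_top m) A) (subtopology (aff_top n) B) f"
      unfolding continuous_map_def top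
    proof (intro conjI allI impI)
      fix W assume "openin (subtopology (aff_top n) B) W"
      then have W: "\<And>y. y \<in> W \<Longrightarrow> \<exists>e>0. \<forall>z\<in>B. near n y z e \<longrightarrow> z \<in> W"
        unfolding openin_aff_iff[OF B] by blast
      have nbhd: "\<exists>d>0. \<forall>y\<in>A. near m x y d \<longrightarrow> y \<in> {x \<in> A. f x \<in> W}" if "x \<in> {x \<in> A. f x \<in> W}" for x
      proof -
        have x: "x \<in> A" "f x \<in> W" using that by auto
        obtain e where e: "e > 0" "\<And>z. z \<in> B \<Longrightarrow> near n (f x) z e \<Longrightarrow> z \<in> W" using W[OF x(2)] by blast
        have "\<exists>d>0. \<forall>y\<in>A. near m x y d \<longrightarrow> near n (f x) (f y) e"
          using f x(1) e(1) by simp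
        then obtain d where d: "d > 0" "\<And>y. y \<in> A \<Longrightarrow> near m x y d \<Longrightarrow> near n (f x) (f y) e"
          by blast
        have "\<forall>y\<in>A. near m x y d \<longrightarrow> y \<in> {x \<in> A. f x \<in> W}"
        proof (intro ballI impI)
          fix y assume y: "y \<in> A" "near m x y d"
          have "f y \<in> B" by (rule subsetD[OF conjunct1[OF f] imageI[OF y(1)]])
          then have "f y \<in> W" by (rule e(2)[OF _ d(2)[OF y]])
          then show "y \<in> {x \<in> A. f x \<in> W}" using y(1) by simp
        qed
        then show ?thesis using d(1) by blast
      qed
      show "openin (subtopology (aff_top m) A) {x \<in> A. f x \<in> W}"
        unfolding openin_aff_iff[OF A] by (intro conjI ballI nbhd) simp_all
    qed (use f in auto)
  qed
qed


section \<open>Categorical covers as a first-order condition\<close>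

text \<open>All quantifiers range over points, so the radii are the coordinates 0 of the points d
  and e. \<open>G\<close> is the graph of the homotopy, at the argument (x, t) coded by a point z
  with t = z n. In the intended instances \<open>G\<close> looks at n + 1 coordinates of z but only
  at n of w; thus \<open>G x x\<close> with x n = 0 says that the homotopy starts at the
  inclusion.\<close>

definition good_member :: "nat \<Rightarrow> ((nat \<Rightarrow> 'a::linordered_field) \<Rightarrow> bool) \<Rightarrow> ((nat \<Rightarrow> 'a) \<Rightarrow> bool) \<Rightarrow>
    ((nat \<Rightarrow> 'a) \<Rightarrow> (nat \<Rightarrow> 'a) \<Rightarrow> bool) \<Rightarrow> bool" where
  "good_member n X U G \<longleftrightarrow>
    (\<forall>x. U x \<longrightarrow> X x) \<and>
    (\<forall>x. U x \<longrightarrow> (\<exists>d :: nat \<Rightarrow> 'a. 0 < d 0 \<and> (\<forall>y. X y \<longrightarrow> near n x y (d 0) \<longrightarrow> U y))) \<and>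
    (\<forall>z w. G z w \<longrightarrow> U z \<and> 0 \<le> z n \<and> z n \<le> 1 \<and> X w) \<and>
    (\<forall>z. U z \<longrightarrow> 0 \<le> z n \<longrightarrow> z n \<le> 1 \<longrightarrow> (\<exists>w. G z w)) \<and>
    (\<forall>z w w'. G z w \<longrightarrow> G z w' \<longrightarrow> (\<forall>i<n. w i = w' i)) \<and>
    (\<forall>z w (e :: nat \<Rightarrow> 'a). G z w \<longrightarrow> 0 < e 0 \<longrightarrow> (\<exists>d :: nat \<Rightarrow> 'a. 0 < d 0 \<and>
      (\<forall>z' w'. G z' w' \<longrightarrow> near (Suc n) z z' (d 0) \<longrightarrow> near n w w' (e 0)))) \<and>
    (\<forall>x. U x \<longrightarrow> x n = 0 \<longrightarrow> G x x) \<and>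
    (\<exists>c. \<forall>x. U x \<longrightarrow> x n = 1 \<longrightarrow> G x c)"

definition good_cover :: "nat \<Rightarrow> nat \<Rightarrow> ((nat \<Rightarrow> 'a::linordered_field) \<Rightarrow> bool) \<Rightarrow> (nat \<Rightarrow> (nat \<Rightarrow> 'a) \<Rightarrow> bool) \<Rightarrow>
    (nat \<Rightarrow> (nat \<Rightarrow> 'a) \<Rightarrow> (nat \<Rightarrow> 'a) \<Rightarrow> bool) \<Rightarrow> bool" where
  "good_cover n m X U G \<longleftrightarrow> (\<forall>x. X x \<longrightarrow> (\<exists>i\<le>m. U i x)) \<and> (\<forall>i\<le>m. good_member n X (U i) (G i))"

text \<open>
  The first \<open>n\<close> variables of a template are the coordinates of a point; the others stand for the
  coordinates of the parameter point \<open>c\<close>. In \<open>graph_env\<close>, \<open>z\<close> and \<open>w\<close> are a point of the graph of a homotopy.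
\<close>

definition set_env :: "nat \<Rightarrow> (nat \<Rightarrow> 'a) \<Rightarrow> (nat \<Rightarrow> 'a) \<Rightarrow> nat \<Rightarrow> 'a" where
  "set_env n x c i = (if i < n then x i else c (i - n))"

definition graph_env :: "nat \<Rightarrow> (nat \<Rightarrow> 'a) \<Rightarrow> (nat \<Rightarrow> 'a) \<Rightarrow> (nat \<Rightarrow> 'a) \<Rightarrow> nat \<Rightarrow> 'a" where
  "graph_env n z w c i = (if i < Suc n then z i else if i < Suc n + n then w (i - Suc n) else c (i - (Suc n + n)))"

lemma good_cover_transfer:
  fixes h :: "'r::real_closed_field \<Rightarrow> 's::real_closed_field"
  assumes h: "field_embedding h"
  shows "(\<exists>c. good_cover n m (\<lambda>x. sat x p) (\<lambda>i x. sat (set_env n x c) (u i)) (\<lambda>i z w. sat (graph_env n z w c) (g i)))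
    \<longleftrightarrow> (\<exists>c. good_cover n m (\<lambda>x. sat x (map_fm h p)) (\<lambda>i x. sat (set_env n x c) (map_fm h (u i)))
      (\<lambda>i z w. sat (graph_env n z w c) (map_fm h (g i))))"
proof (rule pd_sentence[OF h])
  have point: "pd h (\<lambda>v. sat (v j) q) (\<lambda>v. sat (v j) (map_fm h q))" for j q
    using pd_sat[OF h, of "\<lambda>i v. v j i" "\<lambda>i v. v j i"] td_var[of h j] by simp
  have set: "pd h (\<lambda>v. sat (set_env n (v j) (v k)) q) (\<lambda>v. sat (set_env n (v j) (v k)) (map_fm h q))" for j k q
    unfolding set_env_def by (intro pd_sat[OF h] td_if td_var)
  have graph: "pd h (\<lambda>v. sat (graph_env n (v j) (v j') (v k)) q) (\<lambda>v. sat (graph_env n (v j) (v j') (v k)) (map_fm h q))" for j j' k q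
    unfolding graph_env_def by (intro pd_sat[OF h] td_if td_var)
  \<comment> \<open>The rules follow the syntax of the unfolded condition, in which every quantifier
    is over points or over indices below a fixed bound.\<close>
  show "pd h (\<lambda>v. \<exists>c. good_cover n m (\<lambda>x. sat x p) (\<lambda>i x. sat (set_env n x c) (u i)) (\<lambda>i z w. sat (graph_env n z w c) (g i)))
    (\<lambda>v. \<exists>c. good_cover n m (\<lambda>x. sat x (map_fm h p)) (\<lambda>i x. sat (set_env n x c) (map_fm h (u i)))
      (\<lambda>i z w. sat (graph_env n z w c) (map_fm h (g i))))"
    unfolding good_cover_def good_member_def near_def
    by (intro pd_ex[OF h] pd_all[OF h] pd_conj pd_imp pd_all_less pd_all_le pd_ex_le point set graph
        pd_less pd_le pd_eq td_add td_0[OF h] td_1[OF h] td_var)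
qed

section \<open>Arbitrary coordinate sequences as representatives of affine points\<close>

abbreviation proj :: "nat \<Rightarrow> (nat \<Rightarrow> 'a) \<Rightarrow> nat \<Rightarrow> 'a" where
  "proj n x \<equiv> restrict x {..<n}"

lemma proj_in_aff: "proj n x \<in> aff n"
  by (simp add: aff_def)

lemma proj_aff: "x \<in> aff n \<Longrightarrow> proj n x = x"
  by (simp add: aff_def PiE_iff extensional_restrict)

lemma proj_eq_iff: "proj n x = proj n y \<longleftrightarrow> (\<forall>i<n. x i = y i)"
  by (auto simp: restrict_def fun_eq_iff)

lemma near_proj [simp]: "near n (proj n x) y d = near n x y d" "near n x (proj n y) d = near n x y d"
  by (auto simp: near_def)

lemma append_pt_in_aff: "append_pt m n x y \<in> aff (m + n)"
  by (simp add: append_pt_def aff_def)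

lemma append_pt_proj: "append_pt m n (proj m x) (proj n y) = append_pt m n x y"
  by (auto simp: append_pt_def restrict_def fun_eq_iff)

lemma append_pt_eq_iff: "append_pt m n x y = append_pt m n x' y' \<longleftrightarrow> proj m x = proj m x' \<and> proj n y = proj n y'"
proof
  assume eq: "append_pt m n x y = append_pt m n x' y'"
  have "x i = x' i" if "i < m" for i
    using fun_cong[OF eq, of i] that by (simp add: append_pt_def)
  moreover have "y i = y' i" if "i < n" for i
    using fun_cong[OF eq, of "m + i"] that by (simp add: append_pt_def)
  ultimately show "proj m x = proj m x' \<and> proj n y = proj n y'" by (simp add: proj_eq_iff)
next
  assume "proj m x = proj m x' \<and> proj n y = proj n y'"
  then show "append_pt m n x y = append_pt m n x' y'" by (metis append_pt_proj)
qed

lemma append_pt_split: "y \<in> aff (m + n) \<Longrightarrow> y = append_pt m n y (\<lambda>i. y (m + i))"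
  by (rule ext) (auto simp: append_pt_def aff_def PiE_iff extensional_def)

lemma cylinder_eq:
  assumes "A \<subseteq> aff n"
  shows "cylinder n A = {z \<in> aff (Suc n). proj n z \<in> A \<and> 0 \<le> z n \<and> z n \<le> 1}"
proof (intro subset_antisym subsetI)
  fix z assume "z \<in> cylinder n A"
  then obtain x t where x: "z = x(n := t)" "x \<in> A" "0 \<le> t" "t \<le> 1" by (auto simp: cylinder_def)
  then have "x \<in> aff n" using assms by blast
  then have "proj n x = x" by (rule proj_aff)
  moreover have "proj n z = proj n x" unfolding x(1) proj_eq_iff by simp
  ultimately have "proj n z = x" by simp
  moreover have "z \<in> aff (Suc n)" using \<open>x \<in> aff n\<close> x(1) by (auto simp: aff_def PiE_iff extensional_def)
  ultimately show "z \<in> {z \<in> aff (Suc n). proj n z \<in> A \<and> 0 \<le> z n \<and> z n \<le> 1}" using x by simp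
next
  fix z assume z: "z \<in> {z \<in> aff (Suc n). proj n z \<in> A \<and> 0 \<le> z n \<and> z n \<le> 1}"
  then have eq: "z = (proj n z)(n := z n)"
    by (auto simp: aff_def PiE_iff extensional_def restrict_def fun_eq_iff)
  show "z \<in> cylinder n A"
    unfolding cylinder_def mem_Collect_eq
  proof (intro exI conjI)
    show "z = (proj n z)(n := z n)" by (rule eq)
  qed (use z in simp_all)
qed

text \<open>The quantifiers of \<open>good_member\<close> run over all coordinate sequences, while
  the topology lives on \<open>aff n\<close>. Since the predicates only see projections, the clauses
  become the box criteria for open sets and continuous maps; the homotopy is recovered from its
  graph by choice.\<close>

lemma good_member_iff:
  fixes Y A :: "(nat \<Rightarrow> 'a::{linordered_field,linorder_topology}) set"
  assumes Y: "Y \<subseteq> aff n" and A: "A \<subseteq> aff n" and Gr: "Gr \<subseteq> aff (Suc n + n)"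
  shows "good_member n (\<lambda>x. proj n x \<in> Y) (\<lambda>x. proj n x \<in> A) (\<lambda>z w. append_pt (Suc n) n z w \<in> Gr) \<longleftrightarrow>
    openin (subtopology (aff_top n) Y) A \<and>
    (\<exists>H. continuous_map (subtopology (aff_top (Suc n)) (cylinder n A)) (subtopology (aff_top n) Y) H \<and>
      graph_of (Suc n) n (cylinder n A) H = Gr \<and>
      (\<forall>x\<in>A. H (x(n := 0)) = x) \<and> (\<lambda>x. H (x(n := 1))) constant_on A)"
    (is "?good \<longleftrightarrow> ?open \<and> (\<exists>H. ?homotopy H)")
proof -
  let ?C = "cylinder n A"
  let ?G = "\<lambda>z w. append_pt (Suc n) n z w \<in> Gr"
  note C_eq = cylinder_eq[OF A]
  have C: "?C \<subseteq> aff (Suc n)" unfolding C_eq by blast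
  have proj_Suc: "proj n (proj (Suc n) z) = proj n z" for z :: "nat \<Rightarrow> 'a"
    unfolding proj_eq_iff by simp
  have inC: "proj (Suc n) z \<in> ?C \<longleftrightarrow> proj n z \<in> A \<and> 0 \<le> z n \<and> z n \<le> 1" for z
    unfolding C_eq mem_Collect_eq proj_Suc by (simp add: proj_in_aff)
  have open_iff: "?open \<longleftrightarrow> A \<subseteq> Y \<and> (\<forall>x\<in>A. \<exists>d>0. \<forall>y\<in>Y. near n x y d \<longrightarrow> y \<in> A)"
    by (rule openin_aff_iff[OF Y])
  have end_pt: "proj n (x(n := t)) = x" if "x \<in> A" for x t
  proof -
    have "proj n (x(n := t)) = proj n x" unfolding proj_eq_iff by simp
    moreover have "proj n x = x" using A that by (intro proj_aff) blast
    ultimately show ?thesis by simp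
  qed
  have end_in: "x(n := t) \<in> ?C" if "x \<in> A" "0 \<le> t" "t \<le> 1" for x t
    using that by (auto simp: cylinder_def)
  show ?thesis
  proof
    assume good: ?good
    have 1: "\<And>x. proj n x \<in> A \<Longrightarrow> proj n x \<in> Y"
      and 2: "\<And>x. proj n x \<in> A \<Longrightarrow> \<exists>d :: nat \<Rightarrow> 'a. 0 < d 0 \<and> (\<forall>y. proj n y \<in> Y \<longrightarrow> near n x y (d 0) \<longrightarrow> proj n y \<in> A)"
      and 3: "\<And>z w. ?G z w \<Longrightarrow> proj n z \<in> A \<and> 0 \<le> z n \<and> z n \<le> 1 \<and> proj n w \<in> Y"
      and 4: "\<And>z. proj n z \<in> A \<Longrightarrow> 0 \<le> z n \<Longrightarrow> z n \<le> 1 \<Longrightarrow> \<exists>w. ?G z w"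

      and 6: "\<And>z w e. ?G z w \<Longrightarrow> 0 < e 0 \<Longrightarrow> \<exists>d :: nat \<Rightarrow> 'a. 0 < d 0 \<and>
        (\<forall>z' w'. ?G z' w' \<longrightarrow> near (Suc n) z z' (d 0) \<longrightarrow> near n w w' (e (0 :: nat)))"
      and 7: "\<And>x. proj n x \<in> A \<Longrightarrow> x n = 0 \<Longrightarrow> ?G x x"
      and 8: "\<exists>c. \<forall>x. proj n x \<in> A \<longrightarrow> x n = 1 \<longrightarrow> ?G x c"
      using good unfolding good_member_def by (simp_all only: simp_thms)
    have functional: "\<forall>z w w'. ?G z w \<longrightarrow> ?G z w' \<longrightarrow> (\<forall>i<n. w i = w' i)"
      using good unfolding good_member_def by (elim conjE)
    have 5: "proj n w = proj n w'" if "?G z w" "?G z w'" for z w w'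
      unfolding proj_eq_iff by (rule functional[THEN spec, THEN spec, THEN spec, THEN mp, THEN mp, OF that])
    have "A \<subseteq> Y"
    proof
      fix x assume x: "x \<in> A"
      then have "proj n x = x" using A proj_aff by blast
      then show "x \<in> Y" using 1[of x] x by simp
    qed
    moreover have "\<exists>d>0. \<forall>y\<in>Y. near n x y d \<longrightarrow> y \<in> A" if x: "x \<in> A" for x
    proof -
      have "proj n x = x" using A x proj_aff by blast
      then obtain d :: "nat \<Rightarrow> 'a" where d: "0 < d 0" "\<And>y. proj n y \<in> Y \<Longrightarrow> near n x y (d 0) \<Longrightarrow> proj n y \<in> A"
        using 2[of x] x by auto
      have "y \<in> A" if "y \<in> Y" "near n x y (d 0)" for y
        using d(2)[of y] that proj_aff[of y n] Y by auto
      then show ?thesis using d(1) by blast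
    qed
    ultimately have ?open unfolding open_iff by blast
    \<comment> \<open>The graph determines w only in its first n coordinates; projecting makes the
      chosen value a point of \<open>aff n\<close>.\<close>
    define H where "H z = proj n (SOME w. ?G z w)" for z
    have GH: "?G z (H z)" if "z \<in> ?C" for z
    proof -
      have "\<exists>w. ?G z w" using that unfolding C_eq by (intro 4) auto
      then have "?G z (SOME w. ?G z w)" by (rule someI_ex)
      moreover have "append_pt (Suc n) n z (H z) = append_pt (Suc n) n z (SOME w. ?G z w)"
        unfolding H_def append_pt_eq_iff by simp
      ultimately show ?thesis by simp
    qed
    have projH: "proj n (H z) = H z" for z by (simp add: H_def)
    have H_eq: "H z = proj n w" if "z \<in> ?C" "?G z w" for z w
      using 5[OF GH[OF that(1)] that(2)] projH by simp
    have HY: "H z \<in> Y" if "z \<in> ?C" for z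
      using 3[OF GH[OF that]] projH by simp
    have "continuous_map (subtopology (aff_top (Suc n)) ?C) (subtopology (aff_top n) Y) H"
      unfolding continuous_map_aff_iff[OF C Y]
    proof (intro conjI ballI allI impI)
      show "H ` ?C \<subseteq> Y" using HY by (rule image_subsetI)
      fix z and e :: 'a assume z: "z \<in> ?C" and e: "0 < e"
      obtain d :: "nat \<Rightarrow> 'a" where d: "0 < d 0"
        "\<And>z' w'. ?G z' w' \<Longrightarrow> near (Suc n) z z' (d 0) \<Longrightarrow> near n (H z) w' e"
        using 6[OF GH[OF z], of "\<lambda>_. e"] e by auto
      have "near n (H z) (H z') e" if "z' \<in> ?C" "near (Suc n) z z' (d 0)" for z'
        by (rule d(2)[OF GH[OF that(1)] that(2)])
      then show "\<exists>d>0. \<forall>z'\<in>?C. near (Suc n) z z' d \<longrightarrow> near n (H z) (H z') e"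
        using d(1) by blast
    qed
    moreover have "graph_of (Suc n) n ?C H = Gr"
    proof (intro subset_antisym subsetI)
      fix y assume "y \<in> graph_of (Suc n) n ?C H"
      then show "y \<in> Gr" using GH by (auto simp: graph_of_def)
    next
      fix y assume y: "y \<in> Gr"
      then have y_eq: "y = append_pt (Suc n) n y (\<lambda>i. y (Suc n + i))" using Gr append_pt_split by blast
      then have "?G y (\<lambda>i. y (Suc n + i))" using y by simp
      moreover have zC: "proj (Suc n) y \<in> ?C" using 3[OF calculation] by (simp add: inC)
      moreover have "append_pt (Suc n) n (proj (Suc n) y) (\<lambda>i. y (Suc n + i)) = append_pt (Suc n) n y (\<lambda>i. y (Suc n + i))"
        by (simp add: append_pt_eq_iff)
      ultimately have "H (proj (Suc n) y) = proj n (\<lambda>i. y (Suc n + i))" by (intro H_eq) simp_all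
      then have "y = append_pt (Suc n) n (proj (Suc n) y) (H (proj (Suc n) y))"
        using y_eq append_pt_proj by metis
      then show "y \<in> graph_of (Suc n) n ?C H" unfolding graph_of_def using zC by (rule image_eqI)
    qed
    moreover have "H (x(n := 0)) = x" if "x \<in> A" for x
    proof -
      have "?G (x(n := 0)) (x(n := 0))" using that end_pt[OF that] by (intro 7) simp_all
      from H_eq[OF end_in[OF that] this] show ?thesis using end_pt[OF that] by simp
    qed
    moreover have "(\<lambda>x. H (x(n := 1))) constant_on A"
    proof -
      obtain c where c: "\<And>x. proj n x \<in> A \<Longrightarrow> x n = 1 \<Longrightarrow> ?G x c" using 8 by blast
      have "H (x(n := 1)) = proj n c" if "x \<in> A" for x
        using that end_pt[OF that] by (intro H_eq end_in c) simp_all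
      then show ?thesis unfolding constant_on_def by blast
    qed
    ultimately show "?open \<and> (\<exists>H. ?homotopy H)" using \<open>?open\<close> by blast
  next
    assume "?open \<and> (\<exists>H. ?homotopy H)"
    then obtain H where op: ?open
      and cont: "continuous_map (subtopology (aff_top (Suc n)) ?C) (subtopology (aff_top n) Y) H"
      and graph: "graph_of (Suc n) n ?C H = Gr"
      and start: "\<And>x. x \<in> A \<Longrightarrow> H (x(n := 0)) = x" and const: "(\<lambda>x. H (x(n := 1))) constant_on A"
      by blast
    have HC: "H ` ?C \<subseteq> Y" and eps: "\<And>z e. z \<in> ?C \<Longrightarrow> e > 0 \<Longrightarrow> \<exists>d>0. \<forall>z'\<in>?C. near (Suc n) z z' d \<longrightarrow> near n (H z) (H z') e"
      using cont unfolding continuous_map_aff_iff[OF C Y] by simp_all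
    have HY: "H z \<in> Y" if "z \<in> ?C" for z using HC that by (rule subsetD[OF _ imageI])
    have projH: "proj n (H z) = H z" if "z \<in> ?C" for z using HY[OF that] Y proj_aff by blast
    have G_iff: "?G z w \<longleftrightarrow> proj (Suc n) z \<in> ?C \<and> proj n w = H (proj (Suc n) z)" for z w
    proof
      assume "?G z w"
      then obtain z0 where z0: "z0 \<in> ?C" "append_pt (Suc n) n z w = append_pt (Suc n) n z0 (H z0)"
        unfolding graph[symmetric] graph_of_def by blast
      have "proj (Suc n) z0 = z0" using z0(1) C proj_aff by blast
      then show "proj (Suc n) z \<in> ?C \<and> proj n w = H (proj (Suc n) z)"
        using z0 projH unfolding append_pt_eq_iff by simp
    next
      assume zw: "proj (Suc n) z \<in> ?C \<and> proj n w = H (proj (Suc n) z)"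
      then have "append_pt (Suc n) n z w = append_pt (Suc n) n (proj (Suc n) z) (H (proj (Suc n) z))"
        using append_pt_proj by metis
      then show "?G z w" unfolding graph[symmetric] graph_of_def using zw by blast
    qed
    have AY: "A \<subseteq> Y" and opn: "\<And>x. x \<in> A \<Longrightarrow> \<exists>d>0. \<forall>y\<in>Y. near n x y d \<longrightarrow> y \<in> A"
      using op unfolding open_iff by simp_all
    \<comment> \<open>For x n = 0 or 1, the point x itself codes an end of the cylinder over its
      projection.\<close>
    have ends: "proj (Suc n) x = (proj n x)(n := x n)" for x :: "nat \<Rightarrow> 'a"
      by (auto simp: restrict_def fun_eq_iff)
    show ?good
      unfolding good_member_def
    proof (intro conjI allI impI)
      fix x assume "proj n x \<in> A"
      then show "proj n x \<in> Y" using AY by blast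
    next
      fix x assume "proj n x \<in> A"
      from opn[OF this] obtain d where d: "d > 0" "\<And>y. y \<in> Y \<Longrightarrow> near n x y d \<Longrightarrow> y \<in> A" by auto
      show "\<exists>d :: nat \<Rightarrow> 'a. 0 < d 0 \<and> (\<forall>y. proj n y \<in> Y \<longrightarrow> near n x y (d 0) \<longrightarrow> proj n y \<in> A)"
        using d by (intro exI[of _ "\<lambda>_. d"]) simp
    next
      fix z w assume "?G z w"
      then have zw: "proj (Suc n) z \<in> ?C" "proj n w = H (proj (Suc n) z)" unfolding G_iff by simp_all
      show "proj n z \<in> A" "0 \<le> z n" "z n \<le> 1" using zw(1) by (simp_all add: inC)
      show "proj n w \<in> Y" unfolding zw(2) by (rule HY[OF zw(1)])
    next
      fix z assume "proj n z \<in> A" "0 \<le> z n" "z n \<le> 1"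
      then have zC: "proj (Suc n) z \<in> ?C" by (simp add: inC)
      then show "\<exists>w. ?G z w" unfolding G_iff using projH by blast
    next
      fix z w w' i assume "?G z w" "?G z w'" "i < n"
      then show "w i = w' i" unfolding G_iff by (metis proj_eq_iff)
    next
      fix z w and e :: "nat \<Rightarrow> 'a" assume G: "?G z w" and e: "0 < e 0"
      have zw: "proj (Suc n) z \<in> ?C" "proj n w = H (proj (Suc n) z)" using G unfolding G_iff by simp_all
      obtain d where d: "d > 0" "\<And>z'. z' \<in> ?C \<Longrightarrow> near (Suc n) z z' d \<Longrightarrow> near n (proj n w) (H z') (e 0)"
        using eps[OF zw(1) e] unfolding zw(2) near_proj by blast
      have "near n w w' (e 0)" if "?G z' w'" "near (Suc n) z z' d" for z' w'
      proof -
        have zw': "proj (Suc n) z' \<in> ?C" "proj n w' = H (proj (Suc n) z')" using that(1) unfolding G_iff by simp_all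
        have "near n (proj n w) (proj n w') (e 0)"
          unfolding zw'(2) using zw'(1) that(2) by (intro d(2)) simp_all
        then show ?thesis by simp
      qed
      then show "\<exists>d :: nat \<Rightarrow> 'a. 0 < d 0 \<and> (\<forall>z' w'. ?G z' w' \<longrightarrow> near (Suc n) z z' (d 0) \<longrightarrow> near n w w' (e 0))"
        using d(1) by (intro exI[of _ "\<lambda>_. d"]) simp
    next
      fix x assume x: "proj n x \<in> A" "x n = 0"
      have "proj (Suc n) x \<in> ?C" using x by (simp add: inC)
      moreover have "H (proj (Suc n) x) = proj n x" unfolding ends x(2) by (rule start[OF x(1)])
      ultimately show "?G x x" unfolding G_iff by simp
    next
      obtain c where c: "\<And>x. x \<in> A \<Longrightarrow> H (x(n := 1)) = c" using const unfolding constant_on_def by blast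
      have "?G x c" if x: "proj n x \<in> A" "x n = 1" for x
      proof -
        have zC: "proj (Suc n) x \<in> ?C" using x by (simp add: inC)
        moreover have "H (proj (Suc n) x) = c" unfolding ends x(2) by (rule c[OF x(1)])
        ultimately show ?thesis unfolding G_iff using projH[OF zC] by simp
      qed
      then show "\<exists>c. \<forall>x. proj n x \<in> A \<longrightarrow> x n = 1 \<longrightarrow> ?G x c" by blast
    qed
  qed
qed

lemma semialgebraic_subset_aff: "semialgebraic n A \<Longrightarrow> A \<subseteq> aff n"
  by (auto simp: semialgebraic_def realization_def)

lemma semialgebraic_cylinder:
  fixes A :: "(nat \<Rightarrow> 'a::linordered_field) set"
  assumes "semialgebraic n A"
  shows "semialgebraic (Suc n) (cylinder n A)"
proof -
  obtain q where q: "quantifier_free q" "fm_in n q" "A = realization n q"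
    using assms by (auto simp: semialgebraic_def)
  define q' where "q' = Conj q (Conj (Neg (Less (Var n) (Const 0))) (Neg (Less (Const 1) (Var n))))"
  have "sat (proj n z) q = sat z q" for z by (rule sat_cong[OF q(2)]) simp
  then have "cylinder n A = realization (Suc n) q'"
    unfolding cylinder_eq[OF semialgebraic_subset_aff[OF assms]]
    by (auto simp: q(3) realization_def q'_def proj_in_aff not_less)
  moreover have "fm_in (Suc n) q'" using q(2) by (simp add: q'_def fm_in_mono[of n])
  moreover have "quantifier_free q'" using q(1) by (simp add: q'_def)
  ultimately show ?thesis unfolding semialgebraic_def by blast
qed

lemma sa_categorical_cover_iff:
  fixes Y :: "(nat \<Rightarrow> 'a::{linordered_field,linorder_topology}) set"
  assumes Y: "semialgebraic n Y"
  shows "(\<exists>U. sa_categorical_cover n Y m U) \<longleftrightarrow>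
    (\<exists>U Gr. (\<forall>i\<le>m. semialgebraic n (U i) \<and> semialgebraic (Suc n + n) (Gr i)) \<and>
      good_cover n m (\<lambda>x. proj n x \<in> Y) (\<lambda>i x. proj n x \<in> U i) (\<lambda>i z w. append_pt (Suc n) n z w \<in> Gr i))"
    (is "?cover \<longleftrightarrow> ?good")
proof
  note YA = semialgebraic_subset_aff[OF Y]
  assume ?cover
  then obtain U where U: "(\<Union>i\<le>m. U i) = Y"
    and opn: "\<And>i. i \<le> m \<Longrightarrow> openin (subtopology (aff_top n) Y) (U i)"
    and sa: "\<And>i. i \<le> m \<Longrightarrow> semialgebraic n (U i)" and cat: "\<And>i. i \<le> m \<Longrightarrow> sa_categorical n Y (U i)"
    unfolding sa_categorical_cover_def by blast
  have "\<forall>i. \<exists>H. i \<le> m \<longrightarrow> continuous_semialgebraic_map (Suc n) (cylinder n (U i)) n Y H \<and>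
          (\<forall>x\<in>U i. H (x(n := 0)) = x) \<and> (\<lambda>x. H (x(n := 1))) constant_on U i"
    using cat unfolding sa_categorical_def by blast
  then obtain H where H: "\<And>i. i \<le> m \<Longrightarrow> continuous_semialgebraic_map (Suc n) (cylinder n (U i)) n Y (H i) \<and>
          (\<forall>x\<in>U i. H i (x(n := 0)) = x) \<and> (\<lambda>x. H i (x(n := 1))) constant_on U i"
    by metis
  define Gr where "Gr i = graph_of (Suc n) n (cylinder n (U i)) (H i)" for i
  have saG: "semialgebraic (Suc n + n) (Gr i)" if "i \<le> m" for i
    using H[OF that] by (simp add: continuous_semialgebraic_map_def Gr_def)
  have "good_member n (\<lambda>x. proj n x \<in> Y) (\<lambda>x. proj n x \<in> U i) (\<lambda>z w. append_pt (Suc n) n z w \<in> Gr i)" if i: "i \<le> m" for i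
    unfolding good_member_iff[OF YA semialgebraic_subset_aff[OF sa[OF i]] semialgebraic_subset_aff[OF saG[OF i]]]
    using opn[OF i] H[OF i] unfolding continuous_semialgebraic_map_def Gr_def by blast
  moreover have "\<exists>i\<le>m. proj n x \<in> U i" if "proj n x \<in> Y" for x
    using that U by blast
  ultimately have "good_cover n m (\<lambda>x. proj n x \<in> Y) (\<lambda>i x. proj n x \<in> U i) (\<lambda>i z w. append_pt (Suc n) n z w \<in> Gr i)"
    unfolding good_cover_def by blast
  then show ?good using sa saG by blast
next
  note YA = semialgebraic_subset_aff[OF Y]
  assume ?good
  then obtain U Gr where sa: "\<And>i. i \<le> m \<Longrightarrow> semialgebraic n (U i)" and saG: "\<And>i. i \<le> m \<Longrightarrow> semialgebraic (Suc n + n) (Gr i)"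
    and good: "good_cover n m (\<lambda>x. proj n x \<in> Y) (\<lambda>i x. proj n x \<in> U i) (\<lambda>i z w. append_pt (Suc n) n z w \<in> Gr i)"
    by blast
  have mem: "openin (subtopology (aff_top n) Y) (U i) \<and>
    (\<exists>H. continuous_map (subtopology (aff_top (Suc n)) (cylinder n (U i))) (subtopology (aff_top n) Y) H \<and>
      graph_of (Suc n) n (cylinder n (U i)) H = Gr i \<and>
      (\<forall>x\<in>U i. H (x(n := 0)) = x) \<and> (\<lambda>x. H (x(n := 1))) constant_on U i)" if i: "i \<le> m" for i
    using good i good_member_iff[OF YA semialgebraic_subset_aff[OF sa[OF i]] semialgebraic_subset_aff[OF saG[OF i]]]
    unfolding good_cover_def by blast
  have sub: "U i \<subseteq> Y" if "i \<le> m" for i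
    using mem[OF that] unfolding openin_aff_iff[OF YA] by blast
  have "sa_categorical n Y (U i)" if i: "i \<le> m" for i
  proof -
    obtain H where H: "continuous_map (subtopology (aff_top (Suc n)) (cylinder n (U i))) (subtopology (aff_top n) Y) H"
      "graph_of (Suc n) n (cylinder n (U i)) H = Gr i"
      "\<forall>x\<in>U i. H (x(n := 0)) = x" "(\<lambda>x. H (x(n := 1))) constant_on U i"
      using mem[OF i] by blast
    have "continuous_semialgebraic_map (Suc n) (cylinder n (U i)) n Y H"
      unfolding continuous_semialgebraic_map_def H(2)
      using H(1) Y semialgebraic_cylinder[OF sa[OF i]] saG[OF i] by blast
    then show ?thesis unfolding sa_categorical_def using H sa[OF i] sub[OF i] by blast
  qed
  moreover have "(\<Union>i\<le>m. U i) = Y"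
  proof (intro subset_antisym subsetI)
    fix x assume x: "x \<in> Y"
    then have "proj n x = x" using YA proj_aff by blast
    then show "x \<in> (\<Union>i\<le>m. U i)" using good x unfolding good_cover_def by (metis UN_I atMost_iff)
  qed (use sub in blast)
  ultimately show ?cover unfolding sa_categorical_cover_def using mem sa by blast
qed

section \<open>Replacing parameters by variables\<close>

text \<open>The result contains no constants, so its coefficient type is free: a formula over S
  becomes a template over R.\<close>

primrec abstract_trm :: "nat \<Rightarrow> ('s \<Rightarrow> nat) \<Rightarrow> 's trm \<Rightarrow> 'r trm" where
  "abstract_trm N k (Var i) = Var i"
| "abstract_trm N k (Const c) = Var (N + k c)"
| "abstract_trm N k (Add s t) = Add (abstract_trm N k s) (abstract_trm N k t)"
| "abstract_trm N k (Mult s t) = Mult (abstract_trm N k s) (abstract_trm N k t)"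

text \<open>Only meant for quantifier-free formulas: the variable of a parameter is not shifted under a quantifier.\<close>

primrec abstract_fm :: "nat \<Rightarrow> ('s \<Rightarrow> nat) \<Rightarrow> 's fm \<Rightarrow> 'r fm" where
  "abstract_fm N k (Equal s t) = Equal (abstract_trm N k s) (abstract_trm N k t)"
| "abstract_fm N k (Less s t) = Less (abstract_trm N k s) (abstract_trm N k t)"
| "abstract_fm N k (Neg p) = Neg (abstract_fm N k p)"
| "abstract_fm N k (Conj p q) = Conj (abstract_fm N k p) (abstract_fm N k q)"
| "abstract_fm N k (Exists p) = Exists (abstract_fm N k p)"

lemma eval_abstract_trm:
  assumes "trm_in N t" "\<And>a. a \<in> set_trm t \<Longrightarrow> c (k a) = a"
  shows "eval_trm (\<lambda>i. if i < N then x i else c (i - N)) (map_trm h (abstract_trm N k t)) = eval_trm x t"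
  using assms by (induction t) auto

lemma sat_abstract_fm:
  assumes "quantifier_free q" "fm_in N q" "\<And>a. a \<in> set_fm q \<Longrightarrow> c (k a) = a"
  shows "sat (\<lambda>i. if i < N then x i else c (i - N)) (map_fm h (abstract_fm N k q)) = sat x q"
  using assms by (induction q) (auto simp: eval_abstract_trm)

lemma quantifier_free_abstract_fm [simp]: "quantifier_free (abstract_fm N k q) = quantifier_free q"
  by (induction q) simp_all

lemma finite_set_trm: "finite (set_trm t)"
  by (induction t) simp_all

lemma finite_set_fm: "finite (set_fm q)"
  by (induction q) (simp_all add: finite_set_trm)

text \<open>The converse of abstraction: substituting the coordinates of c as constants for the
  parameter variables turns a template into a defining formula.\<close>

lemma semialgebraic_instance:
  assumes "quantifier_free q"
  shows "semialgebraic N {x \<in> aff N. sat (\<lambda>i. if i < N then x i else c (i - N)) q}"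
proof -
  define \<rho> where "\<rho> i = (if i < N then Var i else Const (c (i - N)))" for i
  have "fm_in N (subst_fm \<rho> q)"
    by (rule fm_in_subst[OF assms]) (simp add: \<rho>_def)
  moreover have "sat x (subst_fm \<rho> q) = sat (\<lambda>i. if i < N then x i else c (i - N)) q" for x
  proof -
    have "(\<lambda>i. eval_trm x (\<rho> i)) = (\<lambda>i. if i < N then x i else c (i - N))" by (auto simp: \<rho>_def)
    then show ?thesis by (simp add: sat_subst_fm[OF assms])
  qed
  ultimately show ?thesis
    unfolding semialgebraic_def realization_def using assms by (intro exI[of _ "subst_fm \<rho> q"]) simp
qed

lemma good_cover_cong:
  assumes "\<And>x. X x = X' x" "\<And>i x. i \<le> m \<Longrightarrow> U i x = U' i x" "\<And>i z w. i \<le> m \<Longrightarrow> G i z w = G' i z w"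
  shows "good_cover n m X U G = good_cover n m X' U' G'"
proof -
  have "X = X'" using assms(1) by blast
  moreover have "U i = U' i" "G i = G' i" if "i \<le> m" for i using assms(2,3) that by blast+
  ultimately show ?thesis unfolding good_cover_def by (metis (no_types, lifting))
qed

definition join :: "nat \<Rightarrow> (nat \<Rightarrow> 'a) \<Rightarrow> (nat \<Rightarrow> 'a) \<Rightarrow> nat \<Rightarrow> 'a" where
  "join n z w i = (if i < Suc n then z i else w (i - Suc n))"

lemma proj_join: "proj (Suc n + n) (join n z w) = append_pt (Suc n) n z w"
  by (auto simp: join_def append_pt_def restrict_def fun_eq_iff)

lemma graph_env_join: "graph_env n z w c = (\<lambda>i. if i < Suc n + n then join n z w i else c (i - (Suc n + n)))"
  by (auto simp: graph_env_def join_def fun_eq_iff)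

lemma set_env_eq: "set_env n x c = (\<lambda>i. if i < n then x i else c (i - n))"
  by (auto simp: set_env_def)

text \<open>The cover lives over the target of h, the templates over its source. Used with
  \<open>id\<close> and with the embedding, it describes covers over R and over S by the same supply
  of templates.\<close>

lemma ex_cover_iff_template:
  fixes h :: "'r::linordered_field \<Rightarrow> 's::{linordered_field,linorder_topology}" and p :: "'s fm"
  assumes Y: "semialgebraic n Y" "fm_in n p" "Y = realization n p"
  shows "(\<exists>U. sa_categorical_cover n Y m U) \<longleftrightarrow>
    (\<exists>u g. (\<forall>i\<le>m. quantifier_free (u i) \<and> quantifier_free (g i)) \<and>
      (\<exists>c. good_cover n m (\<lambda>x. sat x p) (\<lambda>i x. sat (set_env n x c) (map_fm h (u i)))
        (\<lambda>i z w. sat (graph_env n z w c) (map_fm h (g i)))))"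
    (is "_ \<longleftrightarrow> (\<exists>u g. ?qf u g \<and> (\<exists>c. ?good u g c))")
  unfolding sa_categorical_cover_iff[OF Y(1)]
proof
  have inY: "proj n x \<in> Y \<longleftrightarrow> sat x p" for x
    using sat_cong[OF Y(2), of "proj n x" x] by (simp add: Y(3) realization_def proj_in_aff)
  {
    assume "\<exists>U Gr. (\<forall>i\<le>m. semialgebraic n (U i) \<and> semialgebraic (Suc n + n) (Gr i)) \<and>
      good_cover n m (\<lambda>x. proj n x \<in> Y) (\<lambda>i x. proj n x \<in> U i) (\<lambda>i z w. append_pt (Suc n) n z w \<in> Gr i)"
    then obtain U Gr where sa: "\<And>i. i \<le> m \<Longrightarrow> semialgebraic n (U i)" "\<And>i. i \<le> m \<Longrightarrow> semialgebraic (Suc n + n) (Gr i)"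
      and good: "good_cover n m (\<lambda>x. proj n x \<in> Y) (\<lambda>i x. proj n x \<in> U i) (\<lambda>i z w. append_pt (Suc n) n z w \<in> Gr i)"
      by blast
    from sa(1) obtain a where a: "\<And>i. i \<le> m \<Longrightarrow> quantifier_free (a i) \<and> fm_in n (a i) \<and> U i = realization n (a i)"
      unfolding semialgebraic_def by metis
    from sa(2) obtain b where b: "\<And>i. i \<le> m \<Longrightarrow> quantifier_free (b i) \<and> fm_in (Suc n + n) (b i) \<and> Gr i = realization (Suc n + n) (b i)"
      unfolding semialgebraic_def by metis
    \<comment> \<open>All constants of the cover, finitely many, are numbered by \<open>k\<close>;
      the parameter point c lists them in this order.\<close>
    define K where "K = (\<Union>i\<le>m. set_fm (a i) \<union> set_fm (b i))"
    have "finite K" by (simp add: K_def finite_set_fm)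
    then obtain k :: "'s \<Rightarrow> nat" where k: "inj_on k K"
      using finite_imp_inj_to_nat_seg by metis
    define c where "c = inv_into K k"
    have ck: "c (k x) = x" if "x \<in> K" for x using k that by (simp add: c_def)
    define u :: "nat \<Rightarrow> 'r fm" where "u i = abstract_fm n k (a i)" for i
    define g :: "nat \<Rightarrow> 'r fm" where "g i = abstract_fm (Suc n + n) k (b i)" for i
    have "proj n x \<in> U i \<longleftrightarrow> sat (set_env n x c) (map_fm h (u i))" if i: "i \<le> m" for i x
    proof -
      have "sat (set_env n x c) (map_fm h (u i)) = sat x (a i)"
        unfolding set_env_eq u_def using a[OF i] i by (intro sat_abstract_fm ck) (auto simp: K_def)
      also have "\<dots> = sat (proj n x) (a i)"
        using a[OF i] by (intro sat_cong[of n]) auto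
      finally show ?thesis using a[OF i] by (simp add: realization_def proj_in_aff)
    qed
    moreover have "append_pt (Suc n) n z w \<in> Gr i \<longleftrightarrow> sat (graph_env n z w c) (map_fm h (g i))" if i: "i \<le> m" for i z w
    proof -
      have "sat (graph_env n z w c) (map_fm h (g i)) = sat (join n z w) (b i)"
        unfolding graph_env_join g_def using b[OF i] i by (intro sat_abstract_fm ck) (auto simp: K_def)
      also have "\<dots> = sat (proj (Suc n + n) (join n z w)) (b i)"
        using b[OF i] by (intro sat_cong[of "Suc n + n"]) auto
      finally show ?thesis using b[OF i] unfolding proj_join by (simp add: realization_def append_pt_in_aff del: add_Suc)
    qed
    ultimately have "?good u g c"
      using good inY good_cover_cong[of "\<lambda>x. proj n x \<in> Y" "\<lambda>x. sat x p" m
        "\<lambda>i x. proj n x \<in> U i" "\<lambda>i x. sat (set_env n x c) (map_fm h (u i))"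
        "\<lambda>i z w. append_pt (Suc n) n z w \<in> Gr i" "\<lambda>i z w. sat (graph_env n z w c) (map_fm h (g i))" n] by simp
    moreover have "?qf u g" using a b by (simp add: u_def g_def)
    ultimately show "\<exists>u g. ?qf u g \<and> (\<exists>c. ?good u g c)" by blast
  next
    assume "\<exists>u g. ?qf u g \<and> (\<exists>c. ?good u g c)"
    then obtain u g c where qf: "?qf u g" and good: "?good u g c" by blast
    define U where "U i = {x \<in> aff n. sat (set_env n x c) (map_fm h (u i))}" for i
    define Gr where "Gr i = {x \<in> aff (Suc n + n). sat (\<lambda>j. if j < Suc n + n then x j else c (j - (Suc n + n))) (map_fm h (g i))}" for i
    have "semialgebraic n (U i) \<and> semialgebraic (Suc n + n) (Gr i)" if "i \<le> m" for i
      unfolding U_def Gr_def set_env_eq using qf that by (intro conjI semialgebraic_instance) simp_all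
    moreover have "proj n x \<in> U i \<longleftrightarrow> sat (set_env n x c) (map_fm h (u i))" for i x
    proof -
      have "set_env n (proj n x) c = set_env n x c" by (auto simp: set_env_def)
      then show ?thesis by (simp add: U_def proj_in_aff)
    qed
    moreover have "append_pt (Suc n) n z w \<in> Gr i \<longleftrightarrow> sat (graph_env n z w c) (map_fm h (g i))" for i z w
    proof -
      have "(\<lambda>j. if j < Suc n + n then append_pt (Suc n) n z w j else c (j - (Suc n + n))) = graph_env n z w c"
        unfolding graph_env_join proj_join[symmetric] by auto
      then show ?thesis by (simp add: Gr_def append_pt_in_aff del: add_Suc)
    qed
    ultimately show "\<exists>U Gr. (\<forall>i\<le>m. semialgebraic n (U i) \<and> semialgebraic (Suc n + n) (Gr i)) \<and>
      good_cover n m (\<lambda>x. proj n x \<in> Y) (\<lambda>i x. proj n x \<in> U i) (\<lambda>i z w. append_pt (Suc n) n z w \<in> Gr i)"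
      using good inY by (intro exI[of _ U] exI[of _ Gr]) simp
  }
qed

text \<open>The formula chosen for X may contain quantifiers, whereas covers are taken of
  semialgebraic sets; elimination within a single field, with h the identity, bridges the
  gap.\<close>

lemma semialgebraic_realization:
  fixes p :: "'a::real_closed_field fm"
  assumes "fm_in n p"
  shows "semialgebraic n (realization n p)"
proof -
  obtain q where q: "quantifier_free q" "\<And>e :: nat \<Rightarrow> 'a. sat e p = sat e q"
    using quantifier_elimination[OF field_embedding_id, of p] unfolding qdef_def by blast
  have "realization n p = {x \<in> aff n. sat (\<lambda>i. if i < n then x i else (\<lambda>_. 0) (i - n)) q}"
  proof -
    have "sat (\<lambda>i. if i < n then x i else 0) q = sat x p" for x
      unfolding q(2)[symmetric] by (rule sat_cong[OF assms]) simp
    then show ?thesis by (simp add: realization_def)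
  qed
  then show ?thesis using semialgebraic_instance[OF q(1), of n "\<lambda>_. 0"] by simp
qed

theorem theorem3p6:
  fixes h :: "'r::{real_closed_field,linorder_topology} \<Rightarrow> 's::{real_closed_field,linorder_topology}"
    and n :: nat
    and X :: "(nat \<Rightarrow> 'r) set"
    and p :: "'r fm"
  assumes "field_embedding h"
    and "semialgebraic n X"
    and "fm_in n p"
    and "X = realization n p"
  shows "sa_cat n X = sa_cat n (realization n (map_fm h p))"
proof -
  have p': "fm_in n (map_fm h p)" using assms(3) by simp
  \<comment> \<open>Both sides become statements about templates over R, so the transfer works
    template by template, separately for each m.\<close>
  have "(\<exists>U. sa_categorical_cover n X m U) \<longleftrightarrow> (\<exists>U. sa_categorical_cover n (realization n (map_fm h p)) m U)" for m
    unfolding ex_cover_iff_template[OF assms(2-4), where h = "id :: 'r \<Rightarrow> 'r"]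
      ex_cover_iff_template[OF semialgebraic_realization[OF p'] p' refl, where h = h]
    unfolding good_cover_transfer[OF assms(1), symmetric] fm.map_id0 id_apply ..
  then show ?thesis unfolding sa_cat_def by simp
qed

end
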